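(* For every integer $k\ge 2$ and every sufficiently large $N$, there is a 3D $k\times N$ rectangle $R^3_{k,N}$ whose directed tile complexity at temperature 1 satisfies $K^1_{USA}\left(R^3_{k,N}\right)=O\left(N^{\frac{1}{\lfloor k/2\rfloor}}+\log N\right)$.
   Context: We work in the 3D abstract Tile Assembly Model (aTAM). A tile type is a unit cube each of whose six sides carries a glue, a pair (label, nonnegative integer strength); a tile set $T$ is a finite set of tile types, each available in unlimited copies. A tile assembly system (TAS) is $\mathcal{T}=(T,\sigma,\tau)$ where $\sigma$ is a seed assembly consisting of a single tile placed at a fixed location of $\mathbb{Z}^3$ and $\tau\in\mathbb{Z}^+$ is the temperature. Two tiles at adjacent locations bind if the glues on their abutting sides are equal (in label and strength) and have positive strength. An assembly is a connected placement of tiles on $\mathbb{Z}^3$; starting from the seed, a tile may be added at an empty location if the sum of strengths of glues with which it binds to the current assembly is at least $\tau$ (at temperature 1: it binds to at least one adjacent tile). Assemblies obtainable this way are producible; a producible assembly is terminal if no tile can be added; $\mathcal{T}$ is directed if it has exactly one terminal producible assembly. A shape $X\subseteq\mathbb{Z}^3$ uniquely self-assembles in $\mathcal{T}$ if $\mathcal{T}$ is directed and its unique terminal assembly has domain exactly $X$. The directed tile complexity $K^\tau_{USA}(X)$ is the minimum of $|T|$ over all TAS $(T,\sigma,\tau)$ in which $X$ uniquely self-assembles. For $k,N\in\mathbb{Z}^+$, a 3D $k\times N$ rectangle $R^3_{k,N}$ is any set $R$ with $\{0,\dots,N-1\}\times\{0,\dots,k-1\}\times\{0\}\subseteq R\subseteq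 \{0,\dots,N-1\}\times\{0,\dots,k-1\}\times\{0,1\}$. Logarithms are base 2. *)

theory Defs
  imports Complex_Main "HOL-Library.Extended_Real"
begin

type_synonym pos = "int \<times> int \<times> int"

datatype dir = East | West | North | South | Up | Down

lemma UNIV_dir: "UNIV = {East, West, North, South, Up, Down}"
  by (auto intro: dir.exhaust)

instance dir :: finite
  by standard (simp add: UNIV_dir)

fun neighbour :: "pos \<Rightarrow> dir \<Rightarrow> pos" where
  "neighbour (x, y, z) East  = (x + 1, y, z)"
| "neighbour (x, y, z) West  = (x - 1, y, z)"
| "neighbour (x, y, z) North = (x, y + 1, z)"
| "neighbour (x, y, z) South = (x, y - 1, z)"
| "neighbour (x, y, z) Up    = (x, y, z + 1)"
| "neighbour (x, y, z) Down  = (x, y, z - 1)"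

fun opposite :: "dir \<Rightarrow> dir" where
  "opposite East  = West"
| "opposite West  = East"
| "opposite North = South"
| "opposite South = North"
| "opposite Up    = Down"
| "opposite Down  = Up"

text \<open>A glue is a pair (label, strength). Labels only matter up to equality and a tile set is
  finite, so natural numbers provide enough of them. Tiles are not rotated.\<close>

type_synonym glue = "nat \<times> nat"

type_synonym tile_type = "dir \<Rightarrow> glue"

type_synonym assembly = "pos \<Rightarrow> tile_type option"

text \<open>\<open>binds t d t'\<close>: tile \<open>t\<close> binds to the tile \<open>t'\<close> that is adjacent to it in direction \<open>d\<close>.\<close>

definition binds :: "tile_type \<Rightarrow> dir \<Rightarrow> tile_type \<Rightarrow> bool" where
  "binds t d t' \<longleftrightarrow> t d = t' (opposite d) \<and> snd (t d) > 0"

definition binding_strength :: "assembly \<Rightarrow> pos \<Rightarrow> tile_type \<Rightarrow> nat" where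
  "binding_strength \<alpha> p t =
     (\<Sum>d\<in>UNIV. case \<alpha> (neighbour p d) of
        None \<Rightarrow> 0
      | Some t' \<Rightarrow> if binds t d t' then snd (t d) else 0)"

definition attachable :: "tile_type set \<Rightarrow> nat \<Rightarrow> assembly \<Rightarrow> pos \<Rightarrow> tile_type \<Rightarrow> bool" where
  "attachable T \<tau> \<alpha> p t \<longleftrightarrow> t \<in> T \<and> \<alpha> p = None \<and> \<tau> \<le> binding_strength \<alpha> p t"

definition is_tas :: "tile_type set \<Rightarrow> assembly \<Rightarrow> nat \<Rightarrow> bool" where
  "is_tas T \<sigma> \<tau> \<longleftrightarrow> finite T \<and> (\<exists>p. \<exists>t\<in>T. \<sigma> = [p \<mapsto> t]) \<and> \<tau> > 0"

text \<open>Assembly sequences may be finite or infinite; a finite one is represented by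
  repeating its last assembly forever.\<close>

definition assembly_seq ::
    "tile_type set \<Rightarrow> assembly \<Rightarrow> nat \<Rightarrow> (nat \<Rightarrow> assembly) \<Rightarrow> bool" where
  "assembly_seq T \<sigma> \<tau> s \<longleftrightarrow>
     s 0 = \<sigma> \<and>
     (\<forall>i. s (Suc i) = s i \<or>
          (\<exists>p t. attachable T \<tau> (s i) p t \<and> s (Suc i) = (s i)(p \<mapsto> t)))"

text \<open>Since assemblies only grow along a sequence, the result of the sequence is the union
  of its members. For a finite sequence this is the last assembly. Results of infinite
  sequences must be included: otherwise a system that can also grow forever could count as
  directed.\<close>

definition producible :: "tile_type set \<Rightarrow> assembly \<Rightarrow> nat \<Rightarrow> assembly \<Rightarrow> bool" where
  "producible T \<sigma> \<tau> \<alpha> \<longleftrightarrow>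
     (\<exists>s. assembly_seq T \<sigma> \<tau> s \<and> (\<forall>p t. \<alpha> p = Some t \<longleftrightarrow> (\<exists>i. s i p = Some t)))"

definition terminal :: "tile_type set \<Rightarrow> nat \<Rightarrow> assembly \<Rightarrow> bool" where
  "terminal T \<tau> \<alpha> \<longleftrightarrow> \<not> (\<exists>p t. attachable T \<tau> \<alpha> p t)"

definition directed :: "tile_type set \<Rightarrow> assembly \<Rightarrow> nat \<Rightarrow> bool" where
  "directed T \<sigma> \<tau> \<longleftrightarrow> (\<exists>!\<alpha>. producible T \<sigma> \<tau> \<alpha> \<and> terminal T \<tau> \<alpha>)"

definition uniquely_self_assembles ::
    "pos set \<Rightarrow> tile_type set \<Rightarrow> assembly \<Rightarrow> nat \<Rightarrow> bool" where
  "uniquely_self_assembles X T \<sigma> \<tau> \<longleftrightarrow>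
     directed T \<sigma> \<tau> \<and>
     (\<forall>\<alpha>. producible T \<sigma> \<tau> \<alpha> \<and> terminal T \<tau> \<alpha> \<longrightarrow> dom \<alpha> = X)"

text \<open>The minimum is taken in the extended naturals, so that the value is \<open>\<infinity>\<close> (and not \<open>0\<close>)
  when no system uniquely self-assembles the shape.\<close>

definition K_USA :: "nat \<Rightarrow> pos set \<Rightarrow> enat" where
  "K_USA \<tau> X =
     Inf {enat (card T) | T \<sigma>. is_tas T \<sigma> \<tau> \<and> uniquely_self_assembles X T \<sigma> \<tau>}"

definition is_rectangle_3D :: "nat \<Rightarrow> nat \<Rightarrow> pos set \<Rightarrow> bool" where
  "is_rectangle_3D k N R \<longleftrightarrow>
     {0..<int N} \<times> {0..<int k} \<times> {0} \<subseteq> R \<and>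
     R \<subseteq> {0..<int N} \<times> {0..<int k} \<times> {0, 1}"

end

theory Submission imports Defs "HOL-Library.Countable" begin

text \<open>For \<open>k < 4\<close> every position may have its own tile. For \<open>k \<ge> 4\<close> put \<open>d = k div 2\<close>,
  choose the least \<open>n\<close> with \<open>N \<le> 2 ^ (n * d)\<close>, and let a path of tiles count with \<open>c = d - 1\<close>
  digits of \<open>n\<close> bits each; the missing factor \<open>2 ^ n\<close> in the length comes from the width of a
  digit, which is covered by hard-coded tiles.

  A digit owns two rows. Its value is stored as geometry: the path that writes a bit obstructs one
  of two positions, and when the path later comes back to read the bit, the tile next to both
  positions can only grow into the free one. Passing a value on over the long distance to
  the next block would cost \<open>2 ^ n\<close> tiles per column if the columns were counted; instead
  the value travels by repeating a single tile that also offers a glue to the north. Northern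
  neighbours are obstructed by an earlier part of the path until a prepared hole is reached, and
  behind the hole a prepared wall stops the repetition. So \<open>O(2 ^ n)\<close> tile types
  suffice for fixed \<open>k\<close>, and \<open>2 ^ n\<close> is \<open>O(N powr (1 / d))\<close> by minimality of \<open>n\<close>.

  Directedness holds because each glue names the tile type that is to be attached and the direction
  of attachment, so every attached tile has a unique predecessor, and each position that a
  tile offers to grow into is either filled as intended or is filled before that tile.\<close>

section \<open>Directed growth at temperature 1\<close>

text \<open>Temperature 1 knows no cooperation: all that a growing tile can learn is that an offered
  position is taken. For the outcome not to depend on the order of attachment, the obstructing tile
  must be an ancestor of the obstructed one. Hence all writing, reading and carrying lies on a
  single path from the seed; teeth, leaves and columns branch off only to fill the bottom layer and
  never obstruct anything.

  One pair of rows holds no digit because the return path passes an old digit in the row north of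
  it, and for the top digit this row must still belong to the rectangle.

  The exact length comes from the start value \<open>2 ^ (n * c) - S\<close>: value number
  \<open>S\<close> is then the one that overflows, and the carry out of the top digit is the signal
  to stop. The overflowed value has only zero digits, so the last windows leave straight free rows
  for the teeth. The remainder of the length modulo the width \<open>c * D\<close> of a block
  becomes padding on the left.\<close>

lemma opposite_opposite [simp]: "opposite (opposite d) = d"
  by (cases d) auto

lemma opposite_neq [simp]: "opposite d \<noteq> d" "d \<noteq> opposite d"
  by (cases d; auto)+

lemma opposite_eq_iff [simp]: "opposite d = opposite e \<longleftrightarrow> d = e"
  by (metis opposite_opposite)

lemma neighbour_opposite [simp]:
  "neighbour (neighbour p d) (opposite d) = p"
  "neighbour (neighbour p (opposite d)) d = p"
  by (cases p; cases d; auto)+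

instance dir :: countable
  by countable_datatype

text \<open>The direction belongs to the label so that a binding always joins an output to an input:
  two outputs, or two inputs, that face each other carry opposite directions. The default glue
  \<open>(0, 0)\<close> has strength 0 and never binds.\<close>

definition state_tile :: "('s::countable \<Rightarrow> dir \<Rightarrow> 's option) \<Rightarrow> 's \<times> dir \<Rightarrow> tile_type" where
  "state_tile out = (\<lambda>(q, d) e. if e = opposite d then (to_nat (q, d), 1)
     else case out q e of None \<Rightarrow> (0, 0) | Some q' \<Rightarrow> (to_nat (q', e), 1))"

text \<open>An output counts as an edge only if the target assembly \<open>F\<close> really contains
  the offered tile there; obstructed outputs give no edge.\<close>

definition growth_edges ::
  "('s \<Rightarrow> dir \<Rightarrow> 's option) \<Rightarrow> (pos \<Rightarrow> ('s \<times> dir) option) \<Rightarrow> (pos \<times> pos) set" where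
  "growth_edges out F = {(p, p'). \<exists>q d e q'. F p = Some (q, d) \<and> out q e = Some q' \<and>
     e \<noteq> opposite d \<and> p' = neighbour p e \<and> F p' = Some (q', e)}"

lemma growth_edgesI:
  assumes "F p = Some (q, d)" "out q e = Some q'" "e \<noteq> opposite d" "neighbour p e = p'"
    "F p' = Some (q', e)"
  shows "(p, p') \<in> growth_edges out F"
  using assms unfolding growth_edges_def by blast

text \<open>\<open>outs\<close> is the criterion for directedness: an output that is not accepted as
  intended points at an ancestor, which is present whenever the offering tile is. The direction
  \<open>d\<^sub>0\<close> is fictitious, as the seed is never attached; \<open>no_seed\<close>
  keeps its input side from binding.\<close>

locale tree_growth =
  fixes out :: "'s::countable \<Rightarrow> dir \<Rightarrow> 's option"
    and F :: "pos \<Rightarrow> ('s \<times> dir) option" and p\<^sub>0 q\<^sub>0 d\<^sub>0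
  assumes seed: "F p\<^sub>0 = Some (q\<^sub>0, d\<^sub>0)"
    and finite_dom: "finite (dom F)"
    and reach: "p \<in> dom F \<Longrightarrow> (p\<^sub>0, p) \<in> (growth_edges out F)\<^sup>*"
    and outs: "\<lbrakk>F p = Some (q, d); out q e = Some q'; e \<noteq> opposite d\<rbrakk> \<Longrightarrow>
       F (neighbour p e) = Some (q', e) \<or> (neighbour p e, p) \<in> (growth_edges out F)\<^sup>*"
    and no_seed: "F p = Some (q, d) \<Longrightarrow> out q d\<^sub>0 \<noteq> Some q\<^sub>0"
begin

abbreviation "E \<equiv> growth_edges out F"
abbreviation "tile \<equiv> state_tile out"

definition final :: assembly where "final p = map_option tile (F p)"
definition tiles :: "tile_type set" where "tiles = tile ` ran F"
definition start :: assembly where "start = [p\<^sub>0 \<mapsto> tile (q\<^sub>0, d\<^sub>0)]"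

text \<open>The invariant of growth. Closure under predecessors is what turns "ancestor of a present
  tile" into "already occupied".\<close>

definition partial :: "assembly \<Rightarrow> bool" where
  "partial \<beta> \<longleftrightarrow> \<beta> \<subseteq>\<^sub>m final \<and> p\<^sub>0 \<in> dom \<beta> \<and> (\<forall>p p'. (p, p') \<in> E \<longrightarrow> p' \<in> dom \<beta> \<longrightarrow> p \<in> dom \<beta>)"

lemma E_unique: "(p, p') \<in> E \<Longrightarrow> F p' = Some (q, d) \<Longrightarrow> p = neighbour p' (opposite d)"
  by (auto simp: growth_edges_def)

lemma E_seed: "(p, p\<^sub>0) \<notin> E"
  using seed no_seed[of p] unfolding growth_edges_def by fastforce

lemma E_exists: "p \<in> dom F \<Longrightarrow> p \<noteq> p\<^sub>0 \<Longrightarrow> \<exists>p'. (p', p) \<in> E"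
  by (metis reach rtranclE)

lemma partial_ancestor:
  assumes "partial \<beta>" "(p, p') \<in> E\<^sup>*" "p' \<in> dom \<beta>" shows "p \<in> dom \<beta>"
  using assms(2,3)
proof (induction rule: converse_rtrancl_induct)
  case (step a b)
  then show ?case using assms(1) unfolding partial_def by blast
qed

lemma map_le_Some: "\<beta> \<subseteq>\<^sub>m \<gamma> \<Longrightarrow> \<beta> p = Some t \<Longrightarrow> \<gamma> p = Some t"
  by (metis domI map_le_def)

lemma binding_strength_pos:
  "1 \<le> binding_strength \<beta> p t \<longleftrightarrow> (\<exists>e t'. \<beta> (neighbour p e) = Some t' \<and> binds t e t')"
proof -
  have "binding_strength \<beta> p t = 0 \<longleftrightarrow> \<not> (\<exists>e t'. \<beta> (neighbour p e) = Some t' \<and> binds t e t')"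
    unfolding binding_strength_def binds_def
    by (simp add: split: option.splits) (metis not_gr_zero)
  then show ?thesis by (simp only: Suc_le_eq One_nat_def neq0_conv[symmetric]) blast
qed

text \<open>Some side of the new tile binds. If it is the input side, \<open>outs\<close> applies to
  the neighbour, and its second alternative would make the empty position \<open>p\<close> an
  ancestor of a present tile. If it is an output side, it meets the input of the neighbour, whose
  predecessor is then \<open>p\<close>, again a contradiction.\<close>

lemma attach_partial:
  assumes "partial \<beta>" "attachable tiles 1 \<beta> p t"
  shows "final p = Some t" "partial (\<beta>(p \<mapsto> t))"
proof -
  have le: "\<beta> \<subseteq>\<^sub>m final" using assms(1) by (simp add: partial_def)
  have pn: "p \<notin> dom \<beta>" and "t \<in> tiles" and "1 \<le> binding_strength \<beta> p t"
    using assms(2) by (auto simp: attachable_def)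
  then obtain e t' where b: "\<beta> (neighbour p e) = Some t'" "binds t e t'"
    unfolding binding_strength_pos by blast
  obtain s where "t = tile s" "s \<in> ran F"
    using \<open>t \<in> tiles\<close> unfolding tiles_def by blast
  then obtain q d p1 where t: "t = tile (q, d)" and q: "F p1 = Some (q, d)"
    by (cases s) (auto simp: ran_def simp del: split_paired_Ex)
  have "final (neighbour p e) = Some t'" by (rule map_le_Some[OF le b(1)])
  then obtain q' d' where t': "t' = tile (q', d')" and q': "F (neighbour p e) = Some (q', d')"
    unfolding final_def by (cases "F (neighbour p e)") auto
  have nb: "neighbour p e \<in> dom \<beta>" using b(1) by (rule domI)
  have eq: "tile (q, d) e = tile (q', d') (opposite e)" and sp: "snd (tile (q, d) e) > 0"
    using b(2) t t' by (auto simp: binds_def)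
  have *: "F p = Some (q, d) \<and> (neighbour p e, p) \<in> E"
  proof (cases "e = opposite d")
    case True
    have o: "out q' d = Some q" and dd: "d \<noteq> opposite d'"
      using eq True by (auto simp: state_tile_def split: option.splits if_splits)
    have np: "neighbour (neighbour p e) d = p" using True by simp
    have "F p = Some (q, d) \<or> (p, neighbour p e) \<in> E\<^sup>*"
      using outs[OF q' o dd] np by simp
    moreover have "(p, neighbour p e) \<notin> E\<^sup>*"
      using partial_ancestor[OF assms(1) _ nb] pn by blast
    ultimately have "F p = Some (q, d)" by blast
    with growth_edgesI[of F _ q' d' out d q p, OF q' o dd np] show ?thesis by blast
  next
    case False
    then obtain q1 where o: "out q e = Some q1" "tile (q, d) e = (to_nat (q1, e), 1)"
      using sp by (auto simp: state_tile_def split: option.splits)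
    have "e = d' \<and> q1 = q'"
      using eq o(2) by (auto simp: state_tile_def split: option.splits if_splits)
    then have e: "e = d'" "q1 = q'" by auto
    \<comment> \<open>The seed is the only tile without a predecessor, so it has to be excluded by
      \<open>no_seed\<close> first.\<close>
    have "neighbour p e \<noteq> p\<^sub>0"
      using no_seed[OF q] seed q' o(1) e by auto
    then obtain p' where p': "(p', neighbour p e) \<in> E" using E_exists q' by blast
    then have "p' = p" using E_unique[OF p' q'] e by simp
    then have False using p' nb pn assms(1) unfolding partial_def by blast
    then show ?thesis ..
  qed
  then show f: "final p = Some t" by (simp add: final_def t)
  have "\<beta>(p \<mapsto> t) \<subseteq>\<^sub>m final" using le f by (auto simp: map_le_def)
  moreover have "p1 \<in> dom \<beta>" if "(p1, p) \<in> E" for p1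
    using E_unique[OF that] * E_unique[of "neighbour p e" p q d] nb by auto
  moreover have "p\<^sub>0 \<in> dom \<beta>" "\<And>a b. (a, b) \<in> E \<Longrightarrow> b \<in> dom \<beta> \<Longrightarrow> a \<in> dom \<beta>"
    using assms(1) unfolding partial_def by blast+
  ultimately show "partial (\<beta>(p \<mapsto> t))" unfolding partial_def dom_fun_upd by auto
qed

section \<open>Assembly sequences and their results\<close>

lemma seq_partial:
  assumes "assembly_seq tiles start 1 s" shows "partial (s i)"
proof (induction i)
  case 0
  have "partial start"
    using seed E_seed by (auto simp: partial_def start_def final_def map_le_def split: if_splits)
  then show ?case using assms by (simp add: assembly_seq_def)
next
  case (Suc i)
  from assms have "s (Suc i) = s i \<or> (\<exists>p t. attachable tiles 1 (s i) p t \<and> s (Suc i) = (s i)(p \<mapsto> t))"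
    by (auto simp: assembly_seq_def)
  then show ?case
  proof (elim disjE exE conjE)
    fix p t assume "attachable tiles 1 (s i) p t" "s (Suc i) = (s i)(p \<mapsto> t)"
    then show ?thesis by (simp only: attach_partial(2)[OF Suc])
  qed (use Suc in simp)
qed

text \<open>The invariant passes to unions of increasing sequences, so infinite assembly sequences
  are covered as well.\<close>

lemma producible_partial: assumes "producible tiles start 1 \<gamma>" shows "partial \<gamma>"
proof -
  obtain s where s: "assembly_seq tiles start 1 s" "\<And>p t. \<gamma> p = Some t \<longleftrightarrow> (\<exists>i. s i p = Some t)"
    using assms by (auto simp: producible_def)
  have "\<gamma> \<subseteq>\<^sub>m final"
    unfolding map_le_def using s(2) map_le_Some[of "s _" final] seq_partial[OF s(1)]
    by (metis domD partial_def)
  moreover have dom: "p \<in> dom \<gamma> \<longleftrightarrow> (\<exists>i. p \<in> dom (s i))" for p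
    using s(2) by (auto simp: dom_def)
  ultimately show ?thesis using seq_partial[OF s(1)] unfolding partial_def dom by blast
qed

text \<open>On the tree path from the seed to a missing position some edge leaves
  \<open>dom \<beta>\<close>; its end accepts the tile prescribed by \<open>F\<close>.\<close>

lemma frontier:
  assumes "partial \<beta>" "\<beta> \<noteq> final"
  obtains p t where "attachable tiles 1 \<beta> p t"
proof -
  have le: "\<beta> \<subseteq>\<^sub>m final" and p0: "p\<^sub>0 \<in> dom \<beta>" using assms(1) by (auto simp: partial_def)
  obtain p where p: "p \<in> dom final" "p \<notin> dom \<beta>"
    using le assms(2) by (metis map_le_antisym map_le_def subsetI map_le_implies_dom_le)
  then have "(p\<^sub>0, p) \<in> E\<^sup>*" by (intro reach) (auto simp: final_def dom_def)
  then have "\<exists>a b. (a, b) \<in> E \<and> a \<in> dom \<beta> \<and> b \<notin> dom \<beta>"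
    using p0 p(2) by (induction rule: rtrancl_induct) blast+
  then obtain a b where ab: "(a, b) \<in> E" "a \<in> dom \<beta>" "b \<notin> dom \<beta>" by blast
  obtain q d e q' where F: "F a = Some (q, d)" "out q e = Some q'" "e \<noteq> opposite d"
    "b = neighbour a e" "F b = Some (q', e)" using ab(1) by (auto simp: growth_edges_def)
  obtain t where "\<beta> a = Some t" using ab by auto
  then have \<beta>: "\<beta> a = Some (tile (q, d))"
    using map_le_Some[OF le] F(1) by (metis final_def option.simps(9))
  have "attachable tiles 1 \<beta> b (tile (q', e))"
    unfolding attachable_def binding_strength_pos
  proof (intro conjI exI)
    show "tile (q', e) \<in> tiles" unfolding tiles_def ran_def using F(5) by blast
    show "\<beta> b = None" using ab(3) by auto
    show "\<beta> (neighbour b (opposite e)) = Some (tile (q, d))" using \<beta> F(4) by simp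
    show "binds (tile (q', e)) (opposite e) (tile (q, d))"
      using F(2,3) by (simp add: binds_def state_tile_def)
  qed
  then show thesis by (rule that)
qed

text \<open>Results of finite sequences. Unlike the limit of an infinite sequence, such a result can
  be extended by one more attachment.\<close>

definition reachable :: "assembly \<Rightarrow> bool" where
  "reachable \<beta> \<longleftrightarrow> (\<exists>s N. assembly_seq tiles start 1 s \<and> (\<forall>i\<ge>N. s i = \<beta>))"

lemma reachable_start: "reachable start"
  unfolding reachable_def by (rule exI[of _ "\<lambda>_. start"]) (auto simp: assembly_seq_def)

lemma reachable_attach:
  assumes "reachable \<beta>" "attachable tiles 1 \<beta> p t" shows "reachable (\<beta>(p \<mapsto> t))"
proof -
  obtain s N where s: "assembly_seq tiles start 1 s" "\<And>i. i \<ge> N \<Longrightarrow> s i = \<beta>"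
    using assms(1) by (auto simp: reachable_def)
  let ?s = "\<lambda>i. if i \<le> N then s i else \<beta>(p \<mapsto> t)"
  have "assembly_seq tiles start 1 ?s"
    unfolding assembly_seq_def
  proof (intro conjI allI)
    show "?s 0 = start" using s(1) by (simp add: assembly_seq_def)
    fix i
    have st: "s (Suc i) = s i \<or> (\<exists>p t. attachable tiles 1 (s i) p t \<and> s (Suc i) = (s i)(p \<mapsto> t))"
      using s(1) by (simp add: assembly_seq_def)
    consider "Suc i \<le> N" | "i = N" | "i > N" by linarith
    then show "?s (Suc i) = ?s i \<or> (\<exists>p t. attachable tiles 1 (?s i) p t \<and> ?s (Suc i) = (?s i)(p \<mapsto> t))"
    proof cases
      case 1
      then show ?thesis using st by (simp only: if_True) simp
    next
      case 2
      have "s N = \<beta>" using s(2) by simp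
      then show ?thesis using 2 assms(2) by (intro disjI2 exI[of _ p] exI[of _ t]) simp
    qed simp
  qed
  then show ?thesis unfolding reachable_def by (intro exI[of _ ?s] exI[of _ "Suc N"]) auto
qed

lemma reachable_partial: "reachable \<beta> \<Longrightarrow> partial \<beta>"
  unfolding reachable_def using seq_partial by (metis order_refl)

lemma dom_final: "dom final = dom F"
  by (auto simp: final_def dom_def)

text \<open>Domains of reachable assemblies lie in the finite set \<open>dom F\<close>, so one of
  maximal size exists; by \<open>frontier\<close> it could still grow if it were not
  \<open>final\<close>.\<close>

lemma reachable_final: "reachable final"
proof -
  have bd: "card (dom \<beta>) \<le> card (dom final)" if "reachable \<beta>" for \<beta>
    using reachable_partial[OF that] finite_dom unfolding partial_def dom_final[symmetric]
    by (intro card_mono map_le_implies_dom_le) blast+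
  obtain \<beta> where \<beta>: "reachable \<beta>" "\<And>\<gamma>. reachable \<gamma> \<Longrightarrow> card (dom \<gamma>) \<le> card (dom \<beta>)"
    using ex_has_greatest_nat[of reachable start "\<lambda>\<beta>. card (dom \<beta>)" "Suc (card (dom final))"]
      bd reachable_start by (metis le_imp_less_Suc less_imp_le)
  have "\<beta> = final"
  proof (rule ccontr)
    assume "\<beta> \<noteq> final"
    then obtain p t where a: "attachable tiles 1 \<beta> p t"
      using frontier reachable_partial[OF \<beta>(1)] by blast
    have "finite (dom \<beta>)"
      using reachable_partial[OF \<beta>(1)] finite_dom
      by (metis dom_final finite_subset map_le_implies_dom_le partial_def)
    moreover have "p \<notin> dom \<beta>" using a by (auto simp: attachable_def)
    ultimately have "card (dom (\<beta>(p \<mapsto> t))) = Suc (card (dom \<beta>))" by simp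
    then show False using \<beta>(2)[OF reachable_attach[OF \<beta>(1) a]] by simp
  qed
  then show ?thesis using \<beta>(1) by simp
qed

lemma reachable_producible: assumes "reachable \<beta>" shows "producible tiles start 1 \<beta>"
proof -
  obtain s N where s: "assembly_seq tiles start 1 s" "\<And>i. i \<ge> N \<Longrightarrow> s i = \<beta>"
    using assms by (auto simp: reachable_def)
  have mono: "s i \<subseteq>\<^sub>m s (Suc i)" for i
    using s(1) unfolding assembly_seq_def map_le_def attachable_def
    by (metis domIff fun_upd_other)
  have "s i \<subseteq>\<^sub>m s (i + j)" for i j
    by (induction j) (use mono map_le_trans in \<open>auto intro: map_le_refl\<close>)
  then have "s i p = Some t \<Longrightarrow> \<beta> p = Some t" for i p t
    using s(2)[of "i + N"] map_le_Some by (metis le_add2)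
  then show ?thesis unfolding producible_def using s by blast
qed

lemma terminal_final: "terminal tiles 1 final"
  unfolding terminal_def
proof safe
  fix p t assume a: "attachable tiles 1 final p t"
  have "final p = Some t" by (rule attach_partial(1)[OF reachable_partial[OF reachable_final] a])
  then show False using a by (simp add: attachable_def)
qed

theorem uniquely_self_assembles_dom: "uniquely_self_assembles (dom F) tiles start 1"
proof -
  have "\<gamma> = final" if "producible tiles start 1 \<gamma>" "terminal tiles 1 \<gamma>" for \<gamma>
    using producible_partial[OF that(1)] that(2) frontier unfolding terminal_def by metis
  then show ?thesis
    using reachable_producible[OF reachable_final] terminal_final dom_final
    unfolding uniquely_self_assembles_def directed_def by metis
qed

theorem K_USA_le:
  assumes "finite Q" "ran F \<subseteq> Q"
  shows "K_USA 1 (dom F) \<le> enat (card Q)"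
proof -
  have "finite (ran F)" using assms finite_subset by blast
  have fin: "finite tiles" using \<open>finite (ran F)\<close> by (simp add: tiles_def)
  have "(q\<^sub>0, d\<^sub>0) \<in> ran F" using seed by (rule ranI)
  then have "tile (q\<^sub>0, d\<^sub>0) \<in> tiles" by (simp add: tiles_def)
  then have "is_tas tiles start 1"
    unfolding is_tas_def start_def using fin by blast
  then have "K_USA 1 (dom F) \<le> enat (card tiles)"
    unfolding K_USA_def using uniquely_self_assembles_dom by (intro Inf_lower) blast
  also have "card tiles \<le> card (ran F)" unfolding tiles_def
    using \<open>finite (ran F)\<close> by (rule card_image_le)
  also have "card (ran F) \<le> card Q" using assms by (intro card_mono)
  finally show ?thesis by simp
qed

end

section \<open>A counter in two layers\<close>

text \<open>Step \<open>t\<close> processes digit \<open>i = t mod c\<close> of the counter value number \<open>t div c\<close>, in rows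
  \<open>2 * i\<close> and \<open>2 * i + 1\<close>; the columns \<open>B t\<close> up to \<open>B t + c * D\<close> of these rows form window \<open>t\<close>.
  Relative to \<open>B t\<close>, columns \<open>0\<close> to \<open>4\<close> contain the wall, the hole and the start of the writer,
  the \<open>j\<close>-th bit occupies the four columns from \<open>5 + 4 * j\<close> on, and the remaining columns belong to
  step \<open>t + c\<close>, which reads the digit of window \<open>t\<close> and writes its successor in window \<open>t + c\<close>.
  The last \<open>c\<close> steps have no successor; there the bottom layer is filled by teeth growing
  west from a spine in the last column.

  In the order of the path through step \<open>t\<close>, the constructors are: \<open>Gadget\<close> builds the wall,
  \<open>Ret\<close>, \<open>Rise\<close> and \<open>Over\<close> return west to the beginning of the old digit (passing over its bits in the
  top layer of the row above), \<open>Read\<close> reads it, \<open>Sum\<close> adds the incoming carry, \<open>Carry\<close> is the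
  repeated tile, \<open>Exit\<close> leaves through the hole, \<open>Begin\<close> and \<open>Write\<close> write, \<open>Run\<close> and \<open>Vertical\<close> go on to
  the rows of step \<open>t + 1\<close>. In the first \<open>c\<close> steps there is no old digit, the value is hard-coded,
  and the mode (of type \<open>bool option\<close>, otherwise the carry) is \<open>None\<close>. The others are fillers.

  The argument \<open>u\<close> of \<open>Read\<close> is the part of the digit read so far, and that of \<open>Write\<close> is the
  part still to be written.\<close>

datatype state =
    Climb nat
  | Tooth nat bool
  | Leaf nat
  | Gadget nat "bool option" nat
  | Base nat nat
  | Ret nat bool nat
  | Rise nat bool
  | Over nat bool nat
  | Read nat bool nat nat nat
  | Sum nat bool nat nat
  | Carry nat bool nat
  | Exit nat bool nat nat
  | Begin nat "bool option" nat
  | Write nat "bool option" nat nat nat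
  | Run nat "bool option" nat
  | Vertical nat "bool option" nat
  | Finish
  | Spine nat

instance state :: countable
  by countable_datatype

locale counter =
  fixes n c D off S k :: nat
  assumes n_pos: "0 < n" and c_pos: "0 < c" and D_ge: "4 * n + 10 \<le> D"
    and S_pos: "0 < S" and S_le: "S \<le> 2 ^ (n * c)" and k_ge: "2 * c + 2 \<le> k"
begin

abbreviation "W \<equiv> c * D"
abbreviation "bits_end \<equiv> 5 + 4 * n"
text \<open>The last step: it processes the top digit of value number \<open>S\<close>, values being
  numbered from 0.\<close>

definition "T = S * c + (c - 1)"
definition "N = off + (S + 1) * (c * D)"
definition "B t = off + t * D"

text \<open>Deliberately not reduced modulo \<open>2 ^ (n * c)\<close>: for \<open>b = S\<close> the
  overflow remains visible as divisibility in \<open>carry_out\<close>.\<close>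

definition count :: "nat \<Rightarrow> nat" where "count b = 2 ^ (n * c) - S + b"
definition digit :: "nat \<Rightarrow> nat" where
  "digit t = (count (t div c) div 2 ^ (n * (t mod c))) mod 2 ^ n"
text \<open>An increment has carried past the lower digits iff these are all zero afterwards. In
  this form the carry into digit 0 is always true, which is the increment itself.\<close>

definition carry_in :: "nat \<Rightarrow> bool" where "carry_in t \<longleftrightarrow> 2 ^ (n * (t mod c)) dvd count (t div c)"
definition carry_out :: "nat \<Rightarrow> bool" where "carry_out t \<longleftrightarrow> 2 ^ (n * (t mod c + 1)) dvd count (t div c)"
definition mode_in :: "nat \<Rightarrow> bool option" where "mode_in t = (if t < c then None else Some (carry_in t))"
definition mode_out :: "nat \<Rightarrow> bool option" where "mode_out t = (if t < c then None else Some (carry_out t))"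

definition climb :: "nat \<Rightarrow> state option" where
  "climb i = (if Suc i = c then Some (Climb (2 * c)) else None)"

text \<open>Teeth start just west of the spine. In the lower row they stop behind the last
  \<open>Write\<close> tile, in the upper row behind the head (column 5), since the bits of a zero
  digit leave that row free.\<close>

definition tooth_length :: "nat \<Rightarrow> nat" where
  "tooth_length y = (c - y div 2) * D - 2 - (if even y then bits_end + 1 else 5)"

text \<open>Only two kinds of state make offers that may be obstructed: \<open>Read\<close> at the
  start of a bit offers both \<open>Down\<close> and \<open>East\<close>, and \<open>Carry\<close>
  offers both \<open>East\<close> and \<open>North\<close>. This is where the system decides
  anything.\<close>

fun out :: "state \<Rightarrow> dir \<Rightarrow> state option" where
  "out (Climb y) e = (if e = North \<and> y + 1 < k then Some (Climb (y + 1)) else None)"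
| "out (Tooth l b) e =
     (if e = West \<and> 0 < l then Some (Tooth (l - 1) b)
      else if e = North \<and> b then Some (Climb (2 * c)) else None)"
| "out (Leaf i) e = (if e = North then climb i else None)"
| "out (Gadget i \<mu> p) e =
     (if e = East \<and> p < 2 then Some (Gadget i \<mu> (Suc p))
      else if e = Down \<and> p = 2 then Some (Gadget i \<mu> 3)
      else if e = East \<and> p = 3 then Some (Gadget i \<mu> 4)
      else if e = West \<and> p = 3 \<and> \<mu> = None then Some (Tooth (off + i * D + 1) False)
      else if e = North \<and> p = 3 \<and> \<mu> = None then Some (Base i 0)
      else if e = East \<and> p = 4 \<and> \<mu> = None then Some (Begin i None (digit i))
      else if e = Up \<and> p = 4 \<and> \<mu> \<noteq> None then Some (Gadget i \<mu> 5)
      else if e = North \<and> p = 5 then Some (Gadget i \<mu> 6)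
      else if e = West \<and> 6 \<le> p \<and> p \<le> 8 then Some (Gadget i \<mu> (Suc p))
      else if e = Down \<and> p = 9 then Some (Ret i (the \<mu>) (W - bits_end - 2))
      else None)"
| "out (Base i p) e =
     (if e = North then climb i
      else if e = West \<and> p = 0 then Some (Tooth (off + i * D + 1) (Suc i = c))
      else if e = East \<and> p < 2 then Some (Base i (Suc p)) else None)"
| "out (Ret i b l) e =
     (if e = North then climb i
      else if e = West \<and> 0 < l then Some (Ret i b (l - 1))
      else if e = Up \<and> l = 0 then Some (Rise i b) else None)"
| "out (Rise i b) e = (if e = North then Some (Over i b (bits_end + 2)) else None)"
| "out (Over i b w) e =
     (if e = West \<and> 5 < w then Some (Over i b (w - 1))
      else if e = South \<and> w \<le> 5 then Some (Read i b 0 0 0) else None)"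
| "out (Read i b j u p) e =
     (if p = 0 then
        if j < n then
          if e = Down then Some (Read i b j u 4)
          else if e = East then Some (Read i b j u 1) else None
        else if e = Down then
          Some (Sum i (2 ^ n \<le> u + of_bool b) ((u + of_bool b) mod 2 ^ n) 0)
        else None
      else if e = North \<and> 4 \<le> p \<and> p \<le> 7 then climb i
      else if e = Down \<and> (p = 2 \<or> p = 3) then Some (Leaf i)
      else if e = East \<and> p = 3 then Some (Read i b (Suc j) (u + 2 ^ j) 0)
      else if e = East \<and> p = 8 then Some (Read i b (Suc j) u 0)
      else if e = Up \<and> p = 7 then Some (Read i b j u 8)
      else if e = East \<and> (p < 3 \<or> 4 \<le> p \<and> p \<le> 6) then Some (Read i b j u (Suc p))
      else None)"
| "out (Sum i b u p) e =
     (if e = North \<and> p < 2 then climb i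
      else if e = East \<and> p = 0 then Some (Sum i b u 1)
      else if e = South \<and> p = 1 then Some (Sum i b u 2)
      else if e = East \<and> p = 2 then Some (Carry i b u) else None)"
| "out (Carry i b u) e =
     (if e = East then Some (Carry i b u)
      else if e = North then Some (Exit i b u 0) else None)"
| "out (Exit i b u p) e =
     (if e = North then climb i
      else if e = East \<and> p < 3 then Some (Exit i b u (Suc p))
      else if e = South \<and> p = 3 then Some (Begin i (Some b) u) else None)"
| "out (Begin i \<mu> u) e = (if e = East then Some (Write i \<mu> 0 u 0) else None)"
| "out (Write i \<mu> j u p) e =
     (if p = 0 then
        if j < n then
          if e = North \<and> odd u then Some (Write i \<mu> j u 1)
          else if e = East \<and> even u then Some (Write i \<mu> j u 5) else None
        else if e = Up then Some (Run i \<mu> bits_end) else None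
      else if e = North \<and> (p = 1 \<or> p = 2) then climb i
      else if e = East \<and> (p = 1 \<or> p = 7) \<or> e = South \<and> (p = 2 \<or> p = 8) \<or> e = East \<and> p = 3 \<or>
        e = Up \<and> p = 5 \<or> e = North \<and> p = 6 \<or> e = Down \<and> p = 9 then Some (Write i \<mu> j u (Suc p))
      else if e = East \<and> (p = 4 \<or> p = 10) then Some (Write i \<mu> j u 11)
      else if e = East \<and> p = 11 then Some (Write i \<mu> (Suc j) (u div 2) 0)
      else None)"
| "out (Run i \<mu> w) e =
     (if e = East then
        if w + 2 < D then Some (Run i \<mu> (Suc w))
        else if Suc i < c then Some (Vertical (Suc i) \<mu> (2 * i))
        else if \<mu> = Some True then Some Finish
        else Some (Vertical 0 (Some True) (2 * i))
      else None)"
| "out (Vertical i \<mu> y) e =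
     (if y = 2 * i \<and> e = East then Some (Gadget i \<mu> 0)
      else if y < 2 * i \<and> e = North then Some (Vertical i \<mu> (Suc y))
      else if 2 * i < y \<and> e = South then Some (Vertical i \<mu> (y - 1)) else None)"
| "out Finish e = (if e = Down then Some (Spine (2 * (c - 1))) else None)"
| "out (Spine y) e =
     (if e = West then Some (Tooth (tooth_length y) (y + 1 = 2 * c))
      else if e = North \<and> y + 2 = 2 * c then Some (Spine (Suc y))
      else if e = North \<and> y + 1 = 2 * c then Some (Climb (2 * c))
      else if e = South \<and> 0 < y \<and> y + 1 < 2 * c then Some (Spine (y - 1)) else None)"

section \<open>The terminal assembly as a function of the position\<close>

abbreviation live :: "nat \<Rightarrow> bool" where "live t \<equiv> t + c \<le> T"

text \<open>\<open>Finish\<close> drops onto the spine in row \<open>2 * (c - 1)\<close>; from there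
  the spine grows one row north and otherwise south.\<close>

definition spine_dir :: "nat \<Rightarrow> dir" where
  "spine_dir y = (if y + 2 = 2 * c then Down else if y + 1 = 2 * c then North else South)"

text \<open>Here \<open>j\<close> is the bit, \<open>\<rho>\<close> the column within it and
  \<open>r\<close> the row. For a 1 the writer makes a detour through the upper row of the bottom
  layer and so bars the reader's way down; for a 0 the detour runs through the top layer and bars
  its way east. What the writer leaves free is filled by the reader, or by teeth if nobody reads the
  window.\<close>

definition bits0 :: "nat \<Rightarrow> nat \<Rightarrow> nat \<Rightarrow> nat \<Rightarrow> state \<times> dir" where
  "bits0 t j \<rho> r =
    (let i = t mod c; u = digit t div 2 ^ j; q = Write i (mode_out t) j u in
     if r = 0 then
       if \<rho> = 0 then (q 0, East)
       else if \<rho> = 1 then if odd u then (q 3, South) else (q 5, East)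
       else if \<rho> = 2 then if odd u then (q 4, East) else (q 10, Down)
       else (q 11, East)
     else if odd u then
       if \<rho> = 0 then (q 1, North) else if \<rho> = 1 then (q 2, East) else (Leaf i, Down)
     else if live t then (Read i (carry_in (t + c)) j (digit t mod 2 ^ j) (4 + \<rho>), if \<rho> = 0 then Down else East)
     else (Tooth (4 * j + \<rho>) (Suc i = c), West))"

definition bits1 :: "nat \<Rightarrow> nat \<Rightarrow> nat \<Rightarrow> nat \<Rightarrow> (state \<times> dir) option" where
  "bits1 t j \<rho> r =
    (let i = t mod c; u = digit t div 2 ^ j; q = Write i (mode_out t) j u;
         s = Read i (carry_in (t + c)) j (digit t mod 2 ^ j) in
     if r = 0 then
       if odd u then None
       else if \<rho> = 1 then Some (q 6, Up)
       else if \<rho> = 2 then Some (q 9, South) else None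
     else if even u \<and> \<rho> = 1 then Some (q 7, North)
     else if even u \<and> \<rho> = 2 then Some (q 8, East)
     else if \<not> live t then None
     else if \<rho> = 0 then Some (s 0, if j = 0 then South else East)
     else if odd u then Some (s \<rho>, East)
     else Some (s 8, Up))"

text \<open>For \<open>c \<le> t\<close> the wall is the tile in column 2 of the lower row, and the
  hole is column 1 of the upper row, just east of the first return tile. The direction
  \<open>Up\<close> at \<open>t = 0\<close> is the fictitious one of the seed.\<close>

definition head0 :: "nat \<Rightarrow> nat \<Rightarrow> nat \<Rightarrow> state \<times> dir" where
  "head0 t w r =
    (let i = t mod c in
     if r = 0 then
       if w \<le> 1 then
         if t < c then (Tooth (B t + w) False, West) else (Carry i (carry_out t) (digit t), East)
       else if w = 2 then (Gadget i (mode_in t) 3, if t = 0 then Up else Down)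
       else if w = 3 then (Gadget i (mode_in t) 4, East)
       else (Begin i (mode_out t) (digit t), if t < c then East else South)
     else if t < c then
       if w \<le> 1 then (Tooth (B t + w) (Suc i = c), West)
       else (Base i (w - 2), if w = 2 then North else East)
     else if w = 0 then (Ret i (carry_in t) (W - bits_end - 2), Down)
     else (Exit i (carry_out t) (digit t) (w - 1), if w = 1 then North else East))"

text \<open>A window with \<open>live t\<close> is read by step \<open>s = t + c\<close>, and it is
  that step which fills the tail; hence the carries and the digit of \<open>s\<close>. The tails of
  the last \<open>c\<close> windows end at the spine.\<close>

definition tail0 :: "nat \<Rightarrow> nat \<Rightarrow> nat \<Rightarrow> state \<times> dir" where
  "tail0 t w r =
    (let i = t mod c; s = t + c in
     if r = 0 then
       if w = bits_end then (Write i (mode_out t) n 0 0, East)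
       else if live t then
         if w = bits_end + 1 then (Sum i (carry_out s) (digit s) 2, South)
         else (Carry i (carry_out s) (digit s), East)
       else if w + 1 = (c - i) * D then (Spine (2 * i), spine_dir (2 * i))
       else (Tooth (w - bits_end - 1) False, West)
     else if live t then
       if w \<le> bits_end + 1 then (Sum i (carry_out s) (digit s) (w - bits_end), if w = bits_end then Down else East)
       else (Ret i (carry_in s) (w - bits_end - 2), West)
     else if w + 1 = (c - i) * D then (Spine (2 * i + 1), spine_dir (2 * i + 1))
     else (Tooth (w - 5) (Suc i = c), West))"

definition cell0 :: "nat \<Rightarrow> nat \<Rightarrow> nat \<Rightarrow> state \<times> dir" where
  "cell0 t w r =
    (if w < 5 then head0 t w r
     else if w < bits_end then bits0 t ((w - 5) div 4) ((w - 5) mod 4) r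
     else tail0 t w r)"

text \<open>The bottom layer is divided into windows, the top layer into strips of \<open>D\<close>
  columns comprising all rows: in the strip of \<open>t\<close> only step \<open>t\<close> and the
  reading of its digit by step \<open>t + c\<close> place tiles. Therefore \<open>Over\<close> may
  use the row \<open>2 * i + 2\<close> of the next digit without meeting that digit's tiles.\<close>

definition cell1 :: "nat \<Rightarrow> nat \<Rightarrow> nat \<Rightarrow> (state \<times> dir) option" where
  "cell1 t w y =
    (let i = t mod c; s = t + c; i' = Suc t mod c in
     if w + 1 = D then
       if t = T then if y = 2 * i then Some (Finish, East) else None
       else if y = 2 * i then Some (Vertical i' (mode_in (Suc t)) y, East)
       else if 2 * i < y \<and> y \<le> 2 * i' then Some (Vertical i' (mode_in (Suc t)) y, North)
       else if 2 * i' \<le> y \<and> y < 2 * i then Some (Vertical i' (mode_in (Suc t)) y, South)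
       else None
     else if y = 2 * i then
       if w \<le> 2 then if t = 0 then None else Some (Gadget i (mode_in t) w, East)
       else if w = 3 then if t < c then None else Some (Gadget i (mode_in t) 5, Up)
       else if w = 4 then None
       else if w < bits_end then bits1 t ((w - 5) div 4) ((w - 5) mod 4) 0
       else Some (Run i (mode_out t) w, if w = bits_end then Up else East)
     else if y = 2 * i + 1 then
       if w \<le> 3 then if t < c then None else Some (Gadget i (mode_in t) (9 - w), if w = 3 then North else West)
       else if w = 4 then None
       else if w < bits_end then bits1 t ((w - 5) div 4) ((w - 5) mod 4) 1
       else if \<not> live t then None
       else if w = bits_end then Some (Read i (carry_in s) n (digit t) 0, East)
       else if w = bits_end + 2 then Some (Rise i (carry_in s), Up)
       else None
     else if y = 2 * i + 2 \<and> live t \<and> 5 \<le> w \<and> w \<le> bits_end + 2 then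
       Some (Over i (carry_in s) w, if w = bits_end + 2 then North else West)
     else None)"

definition layer0 :: "nat \<Rightarrow> nat \<Rightarrow> state \<times> dir" where
  "layer0 x y =
    (if 2 * c \<le> y then (Climb y, North)
     else if x < B (y div 2) then (Tooth x (y + 1 = 2 * c), West)
     else cell0 ((x - B (y div 2)) div W * c + y div 2) ((x - B (y div 2)) mod W) (y mod 2))"

definition layer1 :: "nat \<Rightarrow> nat \<Rightarrow> (state \<times> dir) option" where
  "layer1 x y = (if x < off then None else cell1 ((x - off) div D) ((x - off) mod D) y)"

definition F :: "pos \<Rightarrow> (state \<times> dir) option" where
  "F = (\<lambda>(x, y, z).
     if 0 \<le> x \<and> x < int N \<and> 0 \<le> y \<and> y < int k then
       if z = 0 then Some (layer0 (nat x) (nat y))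
       else if z = 1 then layer1 (nat x) (nat y) else None
     else None)"

definition pos0 :: "nat \<Rightarrow> nat \<Rightarrow> nat \<Rightarrow> pos" where
  "pos0 t w r = (int (B t + w), int (2 * (t mod c) + r), 0)"
definition pos1 :: "nat \<Rightarrow> nat \<Rightarrow> nat \<Rightarrow> pos" where
  "pos1 t w y = (int (B t + w), int y, 1)"

section \<open>Coordinates of windows and strips\<close>

lemma D_pos: "0 < D" and W_ge: "D \<le> W" and W_pos: "0 < W"
  using D_ge c_pos by auto

lemma N_eq: "N = B T + D"
proof -
  have "Suc T = (S + 1) * c" using c_pos by (simp add: T_def)
  then have "(S + 1) * (c * D) = Suc T * D" by (metis mult.assoc)
  then show ?thesis by (simp add: N_def B_def)
qed

lemma B_mono: "t \<le> s \<Longrightarrow> B t \<le> B s"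
  by (simp add: B_def)

lemma B_add: "B (t + s) = B t + s * D"
  by (simp add: B_def algebra_simps)

lemma in_window: "t \<le> T \<Longrightarrow> w < D \<Longrightarrow> B t + w < N"
  using B_mono[of t T] by (simp add: N_eq)

lemma in_window_live: "live t \<Longrightarrow> w < W \<Longrightarrow> B t + w < N"
  using B_mono[of "t + c" T] D_pos by (simp add: N_eq B_add)

lemma mod_c: "t mod c < c" using c_pos by simp

lemma F_pos0:
  assumes "B t + w < N" "w < W" "r < 2"
  shows "F (pos0 t w r) = Some (cell0 t w r)"
proof -
  have y: "(2 * (t mod c) + r) div 2 = t mod c" "(2 * (t mod c) + r) mod 2 = r" using assms by auto
  have yk: "2 * (t mod c) + r < 2 * c" using mod_c[of t] assms by linarith
  have "t = t div c * c + t mod c" by simp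
  then have Bt: "B t = B (t mod c) + t div c * W" by (metis B_add add.commute mult.assoc)
  then have x: "B t + w - B (t mod c) = w + t div c * W" by simp
  have "(B t + w - B (t mod c)) div W = t div c" "(B t + w - B (t mod c)) mod W = w"
    unfolding x using assms(2) W_pos by (simp_all only: div_mult_self1 mod_mult_self1 div_less mod_less)
  then have "layer0 (B t + w) (2 * (t mod c) + r) = cell0 t w r"
    using yk Bt assms(3) by (simp add: layer0_def y)
  moreover have "2 * (t mod c) + r < k" using yk k_ge by simp
  ultimately show ?thesis using assms(1) by (simp add: F_def pos0_def del: of_nat_add of_nat_mult)
qed

lemma F_pos1:
  assumes "t \<le> T" "w < D" "y < k"
  shows "F (pos1 t w y) = cell1 t w y"
proof -
  have "(B t + w - off) div D = t" "(B t + w - off) mod D = w" "\<not> B t + w < off"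
    using assms(2) by (auto simp: B_def)
  then have "layer1 (B t + w) y = cell1 t w y" by (simp add: layer1_def)
  then show ?thesis using in_window[OF assms(1,2)] assms(3)
    by (simp add: F_def pos1_def del: of_nat_add)
qed

lemma Tc: "t \<le> T \<longleftrightarrow> t div c \<le> S"
proof
  assume "t \<le> T"
  then have "t < Suc S * c" using c_pos by (auto simp: T_def)
  then show "t div c \<le> S" using c_pos by (simp add: less_mult_imp_div_less less_Suc_eq_le[symmetric])
next
  assume "t div c \<le> S"
  moreover have "t \<le> t div c * c + (c - 1)"
    using mod_c[of t] div_mult_mod_eq[of t c] by linarith
  ultimately show "t \<le> T" unfolding T_def by (meson add_mono le_trans mult_le_mono1 order_refl)
qed

section \<open>Arithmetic of the increment\<close>

lemma digit_less: "digit t < 2 ^ n" by (simp add: digit_def)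

lemma count_Suc: "count (Suc b) = Suc (count b)" by (simp add: count_def)

text \<open>With \<open>M\<close> the weight of the digit, \<open>Suc a div M\<close> exceeds
  \<open>a div M\<close> by one exactly when \<open>M\<close> divides \<open>Suc a\<close>, that is,
  when a carry arrives.\<close>

lemma
  shows digit_next: "(digit t + of_bool (carry_in (t + c))) mod 2 ^ n = digit (t + c)"
    and carry_out_next: "2 ^ n \<le> digit t + of_bool (carry_in (t + c)) \<longleftrightarrow> carry_out (t + c)"
proof -
  let ?M = "2 ^ (n * (t mod c)) :: nat" and ?m = "2 ^ n :: nat"
  define a q where "a = count (t div c)" and "q = a div ?M"
  have s: "(t + c) div c = Suc (t div c)" "(t + c) mod c = t mod c" using c_pos by auto
  have carry_in: "carry_in (t + c) \<longleftrightarrow> ?M dvd Suc a" by (simp add: carry_in_def s count_Suc a_def)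
  have q': "Suc a div ?M = q + of_bool (?M dvd Suc a)"
    by (simp add: q_def div_Suc dvd_eq_mod_eq_0)
  show "(digit t + of_bool (carry_in (t + c))) mod ?m = digit (t + c)"
    unfolding digit_def s count_Suc a_def[symmetric] q' carry_in q_def[symmetric] by (simp add: mod_simps)
  define x where "x = q mod ?m"
  then have x: "x < ?m" by simp
  have "?m * ?M dvd Suc a \<longleftrightarrow> ?M dvd Suc a \<and> ?m dvd Suc a div ?M"
    by (metis dvd_div_iff_mult dvd_mult_right mult.commute power_not_zero zero_neq_numeral)
  also have "\<dots> \<longleftrightarrow> ?M dvd Suc a \<and> ?m dvd Suc q" using q' by auto
  \<comment> \<open>The digit is below \<open>2 ^ n\<close>, so its successor is a multiple of
    \<open>2 ^ n\<close> only by reaching it.\<close>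
  also have "?m dvd Suc q \<longleftrightarrow> ?m \<le> q mod ?m + 1"
    using x by (auto simp: dvd_eq_mod_eq_0 mod_Suc x_def[symmetric])
  finally show "?m \<le> digit t + of_bool (carry_in (t + c)) \<longleftrightarrow> carry_out (t + c)"
    unfolding carry_out_def digit_def s count_Suc a_def[symmetric] carry_in q_def[symmetric]
    using x by (auto simp: power_add mult.commute x_def[symmetric])
qed

lemma mode_out_md: "Suc (t mod c) < c \<Longrightarrow> mode_in (Suc t) = mode_out t"
proof -
  assume a: "Suc (t mod c) < c"
  then have 1: "Suc t mod c = Suc (t mod c)" using mod_Suc by auto
  then have 2: "Suc t div c = t div c" using a by (simp add: div_Suc)
  have "t < c \<longleftrightarrow> t div c = 0" "Suc t < c \<longleftrightarrow> Suc t div c = 0" using c_pos by (auto simp: div_eq_0_iff)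
  then show ?thesis by (simp add: mode_out_def mode_in_def carry_in_def carry_out_def 1 2)
qed

lemma mode_in_top:
  assumes "Suc (t mod c) = c" shows "Suc t mod c = 0" "mode_in (Suc t) = Some True"
proof -
  show "Suc t mod c = 0" using assms by (simp add: mod_Suc)
  moreover have "c \<le> Suc t" using assms mod_less_eq_dividend[of t c] by linarith
  ultimately show "mode_in (Suc t) = Some True" by (simp add: mode_in_def carry_in_def)
qed

text \<open>The stop signal is right: for \<open>0 < b\<close> and \<open>b \<le> S\<close> the
  value \<open>count b\<close> is positive and at most \<open>2 ^ (n * c)\<close>, so it is
  divisible by that power only for \<open>b = S\<close>. Value 0 has mode \<open>None\<close> and
  cannot stop the counter.\<close>

lemma
  assumes "Suc (t mod c) = c" "t \<le> T"
  shows mode_out_top: "mode_out t = Some True \<longleftrightarrow> t = T"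
proof -
  have "t < c \<longleftrightarrow> t div c = 0" using c_pos by (auto simp: div_eq_0_iff)
  moreover have "T div c = S" "T mod c = c - 1"
    using c_pos unfolding T_def by (simp_all only: div_mult_self3 mod_mult_self3) simp_all
  moreover have "t = T \<longleftrightarrow> t div c = S"
    using assms(1) calculation by (metis diff_Suc_1 div_mult_mod_eq)
  moreover have "2 ^ (n * c) dvd count b \<longleftrightarrow> b = S" if "0 < b" "b \<le> S" for b
  proof
    assume "2 ^ (n * c) dvd count b"
    then show "b = S" using that S_le by (auto simp: count_def dest!: dvd_imp_le)
  qed (use S_le in \<open>simp add: count_def\<close>)
  ultimately show ?thesis using assms Tc[of t] S_pos by (auto simp: mode_out_def carry_out_def)
qed

lemma not_live: "t \<le> T \<Longrightarrow> \<not> live t \<longleftrightarrow> t div c = S"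
  using Tc[of t] Tc[of "t + c"] c_pos by auto

lemma digit_last: "t \<le> T \<Longrightarrow> \<not> live t \<Longrightarrow> digit t = 0"
proof -
  assume "t \<le> T" "\<not> live t"
  then have c: "count (t div c) = 2 ^ (n * c)" using not_live S_le by (simp add: count_def)
  have "n * c = n * (t mod c) + n + n * (c - Suc (t mod c))"
    using mod_c[of t] by (simp add: algebra_simps flip: mult_Suc_right add_mult_distrib2)
  then have "(2::nat) ^ (n * c) = 2 ^ (n * (t mod c)) * (2 ^ n * 2 ^ (n * (c - Suc (t mod c))))"
    by (simp add: power_add)
  then show ?thesis by (simp add: digit_def c)
qed

subsection \<open>Cells of the terminal assembly\<close>

abbreviation level :: "nat \<Rightarrow> nat" where "level t \<equiv> t mod c"

lemma F_near: "\<lbrakk>t \<le> T; w < D; r < 2\<rbrakk> \<Longrightarrow> F (pos0 t w r) = Some (cell0 t w r)"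
  using F_pos0[of t w r] in_window[of t w] W_ge by simp

lemma F_live: "\<lbrakk>live t; w < W; r < 2\<rbrakk> \<Longrightarrow> F (pos0 t w r) = Some (cell0 t w r)"
  using F_pos0[of t w r] in_window_live[of t w] by simp

lemma F_up: "\<lbrakk>t \<le> T; w < D; y \<le> 2 * level t + 2\<rbrakk> \<Longrightarrow> F (pos1 t w y) = cell1 t w y"
  using F_pos1[of t w y] k_ge mod_c[of t] by simp

lemma cell0_bits: "j < n \<Longrightarrow> \<rho> < 4 \<Longrightarrow> w = 5 + 4 * j + \<rho> \<Longrightarrow> cell0 t w r = bits0 t j \<rho> r"
  by (simp add: cell0_def)

lemma cell1_bits:
  "\<lbrakk>j < n; \<rho> < 4; w = 5 + 4 * j + \<rho>; r < 2; y = 2 * level t + r\<rbrakk> \<Longrightarrow> cell1 t w y = bits1 t j \<rho> r"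
  using D_ge by (auto simp: cell1_def Let_def less_2_cases_iff)

lemma not_init: "c \<le> t \<Longrightarrow> \<not> t < c" by simp

lemmas head_simps = cell0_def head0_def Let_def mode_in_def mode_out_def not_init

lemma
  assumes "t \<le> T" "c \<le> t"
  shows F_carry_head: "w \<le> 1 \<Longrightarrow> F (pos0 t w 0) = Some (Carry (level t) (carry_out t) (digit t), East)"
    and F_gad3: "F (pos0 t 2 0) = Some (Gadget (level t) (Some (carry_in t)) 3, Down)"
    and F_gad4: "F (pos0 t 3 0) = Some (Gadget (level t) (Some (carry_in t)) 4, East)"
    and F_begin: "F (pos0 t 4 0) = Some (Begin (level t) (Some (carry_out t)) (digit t), South)"
    and F_ret_head: "F (pos0 t 0 (Suc 0)) = Some (Ret (level t) (carry_in t) (W - bits_end - 2), Down)"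
    and F_exit: "p < 4 \<Longrightarrow> F (pos0 t (Suc p) (Suc 0)) =
      Some (Exit (level t) (carry_out t) (digit t) p, if p = 0 then North else East)"
  using assms D_ge c_pos by (simp_all add: F_near head_simps)

lemma
  assumes "t \<le> T" "c \<le> t"
  shows F_gad5: "F (pos1 t 3 (2 * level t)) = Some (Gadget (level t) (Some (carry_in t)) 5, Up)"
    and F_gad6: "F (pos1 t 3 (2 * level t + 1)) = Some (Gadget (level t) (Some (carry_in t)) 6, North)"
    and F_gad789: "w \<le> 2 \<Longrightarrow> F (pos1 t w (2 * level t + 1)) = Some (Gadget (level t) (Some (carry_in t)) (9 - w), West)"
  using assms D_ge by (simp_all add: F_up cell1_def Let_def mode_in_def)

lemma F_gad012:
  assumes "t \<le> T" "0 < t" "w \<le> 2"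
  shows "F (pos1 t w (2 * level t)) = Some (Gadget (level t) (mode_in t) w, East)"
  using assms D_ge by (simp add: F_up cell1_def Let_def)

lemma init_le: "t < c \<Longrightarrow> t \<le> T"
  using Tc[of t] by simp

lemma
  assumes "t < c"
  shows F_init3: "F (pos0 t 2 0) = Some (Gadget (level t) None 3, if t = 0 then Up else Down)"
    and F_init4: "F (pos0 t 3 0) = Some (Gadget (level t) None 4, East)"
    and F_init_begin: "F (pos0 t 4 0) = Some (Begin (level t) None (digit t), East)"
    and F_base: "p \<le> 2 \<Longrightarrow> F (pos0 t (2 + p) (Suc 0)) = Some (Base (level t) p, if p = 0 then North else East)"
  using assms init_le[OF assms] D_ge by (simp_all add: F_near head_simps)

text \<open>A tooth on the left counts absolute columns, so the padding and the two head columns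
  east of it form one row of teeth.\<close>

lemma F_left_tooth:
  assumes "t < c" "x < B t + 2" "r < 2"
  shows "F (int x, int (2 * t + r), 0) = Some (Tooth x (r = 1 \<and> Suc t = c), West)"
proof (cases "x < B t")
  case True
  have "x < N" "2 * t + r < k" "2 * t + r < 2 * c" "(2 * t + r) div 2 = t"
    "2 * t + r + 1 = 2 * c \<longleftrightarrow> r = 1 \<and> Suc t = c"
    using True in_window[OF init_le[OF assms(1)], of 0] D_pos assms k_ge by (auto, presburger)
  then show ?thesis using True by (simp add: F_def layer0_def del: of_nat_add of_nat_mult)
next
  case False
  then obtain w where w: "x = B t + w" "w < 2" using assms by (metis le_Suc_ex nat_add_left_cancel_less not_less)
  have "(int x, int (2 * t + r), 0) = pos0 t w r" using assms w by (simp add: pos0_def)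
  then show ?thesis using F_near[of t w r] w assms init_le[OF assms(1)] D_ge
    by (auto simp: head_simps less_2_cases_iff)
qed

abbreviation wr :: "nat \<Rightarrow> nat \<Rightarrow> nat \<Rightarrow> state" where
  "wr t j p \<equiv> Write (level t) (mode_out t) j (digit t div 2 ^ j) p"
abbreviation rd :: "nat \<Rightarrow> nat \<Rightarrow> nat \<Rightarrow> state" where
  "rd t j p \<equiv> Read (level t) (carry_in (t + c)) j (digit t mod 2 ^ j) p"
abbreviation bit :: "nat \<Rightarrow> nat \<Rightarrow> bool" where
  "bit t j \<equiv> odd (digit t div 2 ^ j)"

text \<open>This includes \<open>j = n\<close>, the tile behind the last bit, where nothing is left
  to write: \<open>digit t div 2 ^ n = 0\<close>.\<close>

lemma F_wr0: "t \<le> T \<Longrightarrow> j \<le> n \<Longrightarrow> F (pos0 t (5 + 4 * j) 0) = Some (wr t j 0, East)"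
  using D_ge digit_less[of t]
  by (cases "j = n") (auto simp: F_near cell0_bits[of j 0] bits0_def Let_def cell0_def tail0_def)

lemma
  assumes "t \<le> T" "j < n"
  shows F_wr11: "F (pos0 t (5 + 4 * j + 3) 0) = Some (wr t j 11, East)"
    and F_wr1: "bit t j \<Longrightarrow> F (pos0 t (5 + 4 * j) (Suc 0)) = Some (wr t j 1, North)"
    and F_wr2: "bit t j \<Longrightarrow> F (pos0 t (5 + 4 * j + 1) (Suc 0)) = Some (wr t j 2, East)"
    and F_wr3: "bit t j \<Longrightarrow> F (pos0 t (5 + 4 * j + 1) 0) = Some (wr t j 3, South)"
    and F_wr4: "bit t j \<Longrightarrow> F (pos0 t (5 + 4 * j + 2) 0) = Some (wr t j 4, East)"
    and F_leaf2: "bit t j \<Longrightarrow> F (pos0 t (5 + 4 * j + 2) (Suc 0)) = Some (Leaf (level t), Down)"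
    and F_leaf3: "bit t j \<Longrightarrow> F (pos0 t (5 + 4 * j + 3) (Suc 0)) = Some (Leaf (level t), Down)"
    and F_wr5: "\<not> bit t j \<Longrightarrow> F (pos0 t (5 + 4 * j + 1) 0) = Some (wr t j 5, East)"
    and F_wr10: "\<not> bit t j \<Longrightarrow> F (pos0 t (5 + 4 * j + 2) 0) = Some (wr t j 10, Down)"
    and F_wr6: "\<not> bit t j \<Longrightarrow> F (pos1 t (5 + 4 * j + 1) (2 * level t)) = Some (wr t j 6, Up)"
    and F_wr7: "\<not> bit t j \<Longrightarrow> F (pos1 t (5 + 4 * j + 1) (2 * level t + 1)) = Some (wr t j 7, North)"
    and F_wr8: "\<not> bit t j \<Longrightarrow> F (pos1 t (5 + 4 * j + 2) (2 * level t + 1)) = Some (wr t j 8, East)"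
    and F_wr9: "\<not> bit t j \<Longrightarrow> F (pos1 t (5 + 4 * j + 2) (2 * level t)) = Some (wr t j 9, South)"
  using assms D_ge
  by (simp_all add: F_near F_up cell0_bits[of j 0] cell0_bits[of j 1] cell0_bits[of j 2] cell0_bits[of j 3]
      cell1_bits[of j 1 _ 0] cell1_bits[of j 2 _ 0] cell1_bits[of j 1 _ 1] cell1_bits[of j 2 _ 1]
      bits0_def bits1_def Let_def)

lemma F_rd0:
  assumes "live t" "j \<le> n"
  shows "F (pos1 t (5 + 4 * j) (2 * level t + 1)) = Some (rd t j 0, if j = 0 then South else East)"
proof (cases "j = n")
  case True
  then show ?thesis using assms D_ge digit_less[of t] n_pos by (simp add: F_up cell1_def Let_def)
next
  case False
  then show ?thesis using assms D_ge
    by (simp add: F_up cell1_bits[of j 0 _ 1] bits1_def Let_def)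
qed

lemma
  assumes "live t" "j < n"
  shows F_rd1: "bit t j \<Longrightarrow> F (pos1 t (5 + 4 * j + 1) (2 * level t + 1)) = Some (rd t j 1, East)"
    and F_rd2: "bit t j \<Longrightarrow> F (pos1 t (5 + 4 * j + 2) (2 * level t + 1)) = Some (rd t j 2, East)"
    and F_rd3: "bit t j \<Longrightarrow> F (pos1 t (5 + 4 * j + 3) (2 * level t + 1)) = Some (rd t j 3, East)"
    and F_rd4: "\<not> bit t j \<Longrightarrow> F (pos0 t (5 + 4 * j) (Suc 0)) = Some (rd t j 4, Down)"
    and F_rd5: "\<not> bit t j \<Longrightarrow> F (pos0 t (5 + 4 * j + 1) (Suc 0)) = Some (rd t j 5, East)"
    and F_rd6: "\<not> bit t j \<Longrightarrow> F (pos0 t (5 + 4 * j + 2) (Suc 0)) = Some (rd t j 6, East)"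
    and F_rd7: "\<not> bit t j \<Longrightarrow> F (pos0 t (5 + 4 * j + 3) (Suc 0)) = Some (rd t j 7, East)"
    and F_rd8: "\<not> bit t j \<Longrightarrow> F (pos1 t (5 + 4 * j + 3) (2 * level t + 1)) = Some (rd t j 8, Up)"
  using assms D_ge
  by (simp_all add: F_near F_up cell0_bits[of j 0] cell0_bits[of j 1] cell0_bits[of j 2] cell0_bits[of j 3]
      cell1_bits[of j 1 _ 1] cell1_bits[of j 2 _ 1] cell1_bits[of j 3 _ 1]
      bits0_def bits1_def Let_def)

lemma
  assumes "live t"
  shows F_sum0: "F (pos0 t bits_end (Suc 0)) = Some (Sum (level t) (carry_out (t + c)) (digit (t + c)) 0, Down)"
    and F_sum1: "F (pos0 t (bits_end + 1) (Suc 0)) = Some (Sum (level t) (carry_out (t + c)) (digit (t + c)) 1, East)"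
    and F_sum2: "F (pos0 t (bits_end + 1) 0) = Some (Sum (level t) (carry_out (t + c)) (digit (t + c)) 2, South)"
    and F_rise: "F (pos1 t (bits_end + 2) (2 * level t + 1)) = Some (Rise (level t) (carry_in (t + c)), Up)"
  using assms D_ge by (simp_all add: F_near F_up cell0_def cell1_def tail0_def Let_def)

lemma
  assumes "live t" "bits_end + 2 \<le> w" "w < W"
  shows F_carry: "F (pos0 t w 0) = Some (Carry (level t) (carry_out (t + c)) (digit (t + c)), East)"
    and F_ret: "F (pos0 t w (Suc 0)) = Some (Ret (level t) (carry_in (t + c)) (w - bits_end - 2), West)"
  using assms by (simp_all add: F_live cell0_def tail0_def Let_def)

lemma F_over:
  assumes "live t" "5 \<le> w" "w \<le> bits_end + 2"
  shows "F (pos1 t w (2 * level t + 2)) =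
    Some (Over (level t) (carry_in (t + c)) w, if w = bits_end + 2 then North else West)"
  using assms D_ge by (simp add: F_up cell1_def Let_def)

lemma F_run:
  assumes "t \<le> T" "bits_end \<le> w" "w + 1 < D"
  shows "F (pos1 t w (2 * level t)) = Some (Run (level t) (mode_out t) w, if w = bits_end then Up else East)"
  using assms by (simp add: F_up cell1_def Let_def)

lemma Suc_dg: "Suc t mod c = (if Suc (level t) = c then 0 else Suc (level t))"
  by (simp add: mod_Suc)

lemma
  assumes "t < T"
  shows F_ver_start: "F (pos1 t (D - 1) (2 * level t)) = Some (Vertical (level (Suc t)) (mode_in (Suc t)) (2 * level t), East)"
    and F_ver_north: "2 * level t < y \<Longrightarrow> y \<le> 2 * level (Suc t) \<Longrightarrow>
      F (pos1 t (D - 1) y) = Some (Vertical (level (Suc t)) (mode_in (Suc t)) y, North)"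
    and F_ver_south: "2 * level (Suc t) \<le> y \<Longrightarrow> y < 2 * level t \<Longrightarrow>
      F (pos1 t (D - 1) y) = Some (Vertical (level (Suc t)) (mode_in (Suc t)) y, South)"
  using assms D_pos mod_c[of t]
  by (auto simp: F_up cell1_def Let_def Suc_dg split: if_splits)

lemma T_dg: "level T = c - 1"
  using c_pos unfolding T_def by (simp only: mod_mult_self3) simp

lemma F_fin: "F (pos1 T (D - 1) (2 * (c - 1))) = Some (Finish, East)"
  using D_pos by (simp add: F_up cell1_def Let_def T_dg)

lemma F_climb:
  "x < N \<Longrightarrow> 2 * c \<le> y \<Longrightarrow> y < k \<Longrightarrow> F (int x, int y, 0) = Some (Climb y, North)"
  by (simp add: F_def layer0_def)

text \<open>The step for digit \<open>i\<close> of the final value; the right border cuts its window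
  off after \<open>(c - i) * D\<close> columns.\<close>

definition last_step :: "nat \<Rightarrow> nat" where "last_step i = S * c + i"

lemma last_step:
  assumes "i < c"
  shows "last_step i \<le> T" "level (last_step i) = i" "\<not> live (last_step i)"
    "B (last_step i) + (c - i) * D = N"
proof -
  show le: "last_step i \<le> T" "level (last_step i) = i" "\<not> live (last_step i)"
    using assms by (auto simp: last_step_def T_def)
  have "off + (S * c + i) * D + (c - i) * D = off + (S * c + (i + (c - i))) * D"
    by (simp only: add_mult_distrib add.assoc)
  then show "B (last_step i) + (c - i) * D = N"
    using assms by (simp add: last_step_def B_def N_def algebra_simps)
qed

lemma last_step_eq: "t \<le> T \<Longrightarrow> \<not> live t \<Longrightarrow> t = last_step (level t)"
  using not_live[of t] unfolding last_step_def by (metis div_mult_mod_eq)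

lemma F_last:
  assumes "i < c" "w < (c - i) * D" "r < 2"
  shows "F (pos0 (last_step i) w r) = Some (cell0 (last_step i) w r)"
proof -
  have "w < W" using assms(2) by (meson diff_le_self less_le_trans mult_le_mono1)
  then show ?thesis using F_pos0[of "last_step i" w r] last_step(4)[OF assms(1)] assms by simp
qed

lemma
  assumes "i < c"
  shows F_spine0: "F (pos0 (last_step i) ((c - i) * D - 1) 0) = Some (Spine (2 * i), spine_dir (2 * i))"
    and F_spine1: "F (pos0 (last_step i) ((c - i) * D - 1) (Suc 0)) = Some (Spine (2 * i + 1), spine_dir (2 * i + 1))"
    and F_last_tooth0: "bits_end < w \<Longrightarrow> w + 1 < (c - i) * D \<Longrightarrow>
       F (pos0 (last_step i) w 0) = Some (Tooth (w - bits_end - 1) False, West)"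
    and F_last_tooth1: "5 \<le> w \<Longrightarrow> w + 1 < (c - i) * D \<Longrightarrow>
       F (pos0 (last_step i) w (Suc 0)) = Some (Tooth (w - 5) (Suc i = c), West)"
proof -
  note l = last_step[OF assms]
  have D: "D \<le> (c - i) * D" using assms by (cases "c - i") auto
  then have D': "\<not> (c - i) * D - Suc 0 < bits_end" "(c - i) * D - Suc 0 \<noteq> bits_end" "Suc ((c - i) * D - Suc 0) = (c - i) * D"
    "(c - i) * D - Suc 0 < (c - i) * D"
    using D D_ge by linarith+
  show "F (pos0 (last_step i) ((c - i) * D - 1) 0) = Some (Spine (2 * i), spine_dir (2 * i))"
   "F (pos0 (last_step i) ((c - i) * D - 1) (Suc 0)) = Some (Spine (2 * i + 1), spine_dir (2 * i + 1))"
    using D' D_ge l by (simp_all add: F_last[OF assms] cell0_def tail0_def Let_def)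
  show "F (pos0 (last_step i) w 0) = Some (Tooth (w - bits_end - 1) False, West)" if "bits_end < w" "w + 1 < (c - i) * D"
    using that l by (simp add: F_last[OF assms] cell0_def tail0_def Let_def)
  show "F (pos0 (last_step i) w (Suc 0)) = Some (Tooth (w - 5) (Suc i = c), West)"
    if "5 \<le> w" "w + 1 < (c - i) * D"
    using that l digit_last[OF l(1,3)]
    by (auto simp: F_last[OF assms] cell0_def tail0_def bits0_def Let_def)
qed

subsection \<open>Growth edges\<close>

abbreviation "E \<equiv> growth_edges out F"

definition edge :: "pos \<Rightarrow> dir \<Rightarrow> pos \<Rightarrow> bool" where
  "edge p e p' \<longleftrightarrow> (p, p') \<in> E \<and> p' = neighbour p e"

lemma edgeI:
  "\<lbrakk>F p = Some (q, d); F p' = Some (q', e); neighbour p e = p'; out q e = Some q'; e \<noteq> opposite d\<rbrakk>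
    \<Longrightarrow> edge p e p'"
  using growth_edgesI[of F p q d out e q' p'] by (auto simp: edge_def)

lemma edge_North_climb:
  assumes "F (int x, int y, 0) = Some (q, d)" "x < N" "2 * c \<le> y + 1" "y + 1 < k"
    "out q North = Some (Climb (y + 1))" "d \<noteq> South"
  shows "edge (int x, int y, 0) North (int x, int (y + 1), 0)"
  by (rule edgeI[OF assms(1) F_climb[OF assms(2)]]) (use assms in \<open>auto, cases d, auto\<close>)

lemma edge_climb: "x < N \<Longrightarrow> 2 * c \<le> y \<Longrightarrow> y + 1 < k \<Longrightarrow> edge (int x, int y, 0) North (int x, int (y + 1), 0)"
  by (rule edge_North_climb[OF F_climb]) auto

lemma edge_top:
  assumes "F (pos0 t w (Suc 0)) = Some (q, d)" "t \<le> T" "w < D \<or> live t \<and> w < W \<or> B t + w < N" "Suc (level t) = c"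
    "out q North = Some (Climb (2 * c))" "d \<noteq> South"
  shows "edge (pos0 t w (Suc 0)) North (int (B t + w), int (2 * c), 0)"
proof -
  have w: "B t + w < N" using assms(2,3) in_window in_window_live by blast
  have y: "2 * level t + Suc 0 + 1 = 2 * c" using assms(4) by linarith
  show ?thesis
    using edge_North_climb[of "B t + w" "2 * level t + Suc 0" q d] assms w k_ge unfolding pos0_def y by simp
qed

lemmas pos_defs = pos0_def pos1_def B_add

lemma edge_gad3: "t \<le> T \<Longrightarrow> edge (pos0 t 2 0) East (pos0 t 3 0)"
  by (cases "t < c"; rule edgeI[OF F_init3 F_init4] edgeI[OF F_gad3 F_gad4]) (auto simp: pos_defs)

lemma
  assumes "t \<le> T" "c \<le> t"
  shows edge_gad4: "edge (pos0 t 3 0) Up (pos1 t 3 (2 * level t))"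
    and edge_gad5: "edge (pos1 t 3 (2 * level t)) North (pos1 t 3 (2 * level t + 1))"
    and edge_gad6: "edge (pos1 t 3 (2 * level t + 1)) West (pos1 t 2 (2 * level t + 1))"
    and edge_gad78: "w \<le> 1 \<Longrightarrow> edge (pos1 t (Suc w) (2 * level t + 1)) West (pos1 t w (2 * level t + 1))"
    and edge_gad9: "edge (pos1 t 0 (2 * level t + 1)) Down (pos0 t 0 (Suc 0))"
  subgoal by (rule edgeI[OF F_gad4 F_gad5]) (use assms in \<open>auto simp: pos_defs\<close>)
  subgoal by (rule edgeI[OF F_gad5 F_gad6]) (use assms in \<open>auto simp: pos_defs\<close>)
  subgoal by (rule edgeI[OF F_gad6 F_gad789]) (use assms in \<open>auto simp: pos_defs\<close>)
  subgoal by (rule edgeI[OF F_gad789 F_gad789]) (use assms in \<open>auto simp: pos_defs\<close>)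
  subgoal by (rule edgeI[OF F_gad789 F_ret_head]) (use assms in \<open>auto simp: pos_defs\<close>)
  done

lemma edge_gad01: "\<lbrakk>t \<le> T; 0 < t; w \<le> 1\<rbrakk> \<Longrightarrow> edge (pos1 t w (2 * level t)) East (pos1 t (Suc w) (2 * level t))"
  by (rule edgeI[OF F_gad012 F_gad012]) (auto simp: pos_defs)

lemma edge_gad2: "\<lbrakk>t \<le> T; 0 < t\<rbrakk> \<Longrightarrow> edge (pos1 t 2 (2 * level t)) Down (pos0 t 2 0)"
proof -
  assume t: "t \<le> T" "0 < t"
  have "F (pos0 t 2 0) = Some (Gadget (level t) (mode_in t) 3, Down)"
    using t F_init3[of t] F_gad3[of t] by (auto simp: mode_in_def)
  then show ?thesis using t by (intro edgeI[OF F_gad012]) (auto simp: pos_defs)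
qed

lemma
  assumes "t < c"
  shows edge_init4: "edge (pos0 t 3 0) East (pos0 t 4 0)"
    and edge_base: "edge (pos0 t 2 0) North (pos0 t 2 (Suc 0))"
    and edge_base01: "p \<le> 1 \<Longrightarrow> edge (pos0 t (2 + p) (Suc 0)) East (pos0 t (2 + Suc p) (Suc 0))"
  subgoal by (rule edgeI[OF F_init4 F_init_begin]) (use assms in \<open>auto simp: pos_defs\<close>)
  subgoal using assms F_base[of t 0] by (intro edgeI[OF F_init3]) (auto simp: pos_defs)
  subgoal using assms F_base[of t "Suc p"] by (intro edgeI[OF F_base]) (auto simp: pos_defs)
  done

lemma
  assumes "live t"
  shows edge_ret_head: "edge (pos0 (t + c) 0 (Suc 0)) West (pos0 t (W - 1) (Suc 0))"
    and edge_ret: "bits_end + 2 \<le> w \<Longrightarrow> Suc w < W \<Longrightarrow> edge (pos0 t (Suc w) (Suc 0)) West (pos0 t w (Suc 0))"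
    and edge_ret_up: "edge (pos0 t (bits_end + 2) (Suc 0)) Up (pos1 t (bits_end + 2) (2 * level t + 1))"
    and edge_rise: "edge (pos1 t (bits_end + 2) (2 * level t + 1)) North (pos1 t (bits_end + 2) (2 * level t + 2))"
    and edge_over: "5 \<le> w \<Longrightarrow> w \<le> bits_end + 1 \<Longrightarrow> edge (pos1 t (Suc w) (2 * level t + 2)) West (pos1 t w (2 * level t + 2))"
    and edge_over5: "edge (pos1 t 5 (2 * level t + 2)) South (pos1 t 5 (2 * level t + 1))"
proof -
  have W: "bits_end + 3 < W" using D_ge W_ge by linarith
  show "edge (pos0 (t + c) 0 (Suc 0)) West (pos0 t (W - 1) (Suc 0))"
    using W by (intro edgeI[OF F_ret_head F_ret]) (use assms W_pos in \<open>auto simp: pos_defs of_nat_diff\<close>)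
  show "bits_end + 2 \<le> w \<Longrightarrow> Suc w < W \<Longrightarrow> edge (pos0 t (Suc w) (Suc 0)) West (pos0 t w (Suc 0))"
    by (rule edgeI[OF F_ret F_ret]) (use assms in \<open>auto simp: pos_defs\<close>)
  show "edge (pos0 t (bits_end + 2) (Suc 0)) Up (pos1 t (bits_end + 2) (2 * level t + 1))"
    by (rule edgeI[OF F_ret F_rise]) (use assms W in \<open>auto simp: pos_defs\<close>)
  show "edge (pos1 t (bits_end + 2) (2 * level t + 1)) North (pos1 t (bits_end + 2) (2 * level t + 2))"
    using assms F_over[OF assms, of "bits_end + 2"] by (intro edgeI[OF F_rise]) (auto simp: pos_defs)
  show "5 \<le> w \<Longrightarrow> w \<le> bits_end + 1 \<Longrightarrow> edge (pos1 t (Suc w) (2 * level t + 2)) West (pos1 t w (2 * level t + 2))"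
    using assms F_over[OF assms, of w] by (intro edgeI[OF F_over]) (auto simp: pos_defs)
  show "edge (pos1 t 5 (2 * level t + 2)) South (pos1 t 5 (2 * level t + 1))"
    using assms F_rd0[OF assms, of 0] by (intro edgeI[OF F_over]) (auto simp: pos_defs)
qed

text \<open>Reading bit \<open>j\<close> extends the known part of the digit from
  \<open>x mod 2 ^ j\<close> to \<open>x mod 2 ^ Suc j\<close>.\<close>

lemma mod_2_Suc: "(x::nat) mod 2 ^ Suc j = x mod 2 ^ j + (if odd (x div 2 ^ j) then 2 ^ j else 0)"
  by (simp only: power_Suc2 mod_mult2_eq) (simp add: odd_iff_mod_2_eq_one)

lemma
  assumes "live t" "j < n"
  shows edge_rd0: "bit t j \<Longrightarrow> edge (pos1 t (5 + 4 * j) (2 * level t + 1)) East (pos1 t (5 + 4 * j + 1) (2 * level t + 1))"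
    and edge_rd1: "bit t j \<Longrightarrow> edge (pos1 t (5 + 4 * j + 1) (2 * level t + 1)) East (pos1 t (5 + 4 * j + 2) (2 * level t + 1))"
    and edge_rd2: "bit t j \<Longrightarrow> edge (pos1 t (5 + 4 * j + 2) (2 * level t + 1)) East (pos1 t (5 + 4 * j + 3) (2 * level t + 1))"
    and edge_leaf2: "bit t j \<Longrightarrow> edge (pos1 t (5 + 4 * j + 2) (2 * level t + 1)) Down (pos0 t (5 + 4 * j + 2) (Suc 0))"
    and edge_leaf3: "bit t j \<Longrightarrow> edge (pos1 t (5 + 4 * j + 3) (2 * level t + 1)) Down (pos0 t (5 + 4 * j + 3) (Suc 0))"
    and edge_rd3: "bit t j \<Longrightarrow> edge (pos1 t (5 + 4 * j + 3) (2 * level t + 1)) East (pos1 t (5 + 4 * Suc j) (2 * level t + 1))"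
    and edge_rd0': "\<not> bit t j \<Longrightarrow> edge (pos1 t (5 + 4 * j) (2 * level t + 1)) Down (pos0 t (5 + 4 * j) (Suc 0))"
    and edge_rd4: "\<not> bit t j \<Longrightarrow> edge (pos0 t (5 + 4 * j) (Suc 0)) East (pos0 t (5 + 4 * j + 1) (Suc 0))"
    and edge_rd5: "\<not> bit t j \<Longrightarrow> edge (pos0 t (5 + 4 * j + 1) (Suc 0)) East (pos0 t (5 + 4 * j + 2) (Suc 0))"
    and edge_rd6: "\<not> bit t j \<Longrightarrow> edge (pos0 t (5 + 4 * j + 2) (Suc 0)) East (pos0 t (5 + 4 * j + 3) (Suc 0))"
    and edge_rd7: "\<not> bit t j \<Longrightarrow> edge (pos0 t (5 + 4 * j + 3) (Suc 0)) Up (pos1 t (5 + 4 * j + 3) (2 * level t + 1))"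
    and edge_rd8: "\<not> bit t j \<Longrightarrow> edge (pos1 t (5 + 4 * j + 3) (2 * level t + 1)) East (pos1 t (5 + 4 * Suc j) (2 * level t + 1))"
proof -
  note j = assms
  have t: "t \<le> T" and jn: "j \<le> n" "Suc j \<le> n" using assms by auto
  note next_bit = F_rd0[OF assms(1) jn(2)]
  show "bit t j \<Longrightarrow> edge (pos1 t (5 + 4 * j) (2 * level t + 1)) East (pos1 t (5 + 4 * j + 1) (2 * level t + 1))"
    by (rule edgeI[OF F_rd0[OF j(1) jn(1)] F_rd1[OF j]]) (use j in \<open>auto simp: pos_defs\<close>)
  show "bit t j \<Longrightarrow> edge (pos1 t (5 + 4 * j + 1) (2 * level t + 1)) East (pos1 t (5 + 4 * j + 2) (2 * level t + 1))"
    by (rule edgeI[OF F_rd1[OF j] F_rd2[OF j]]) (auto simp: pos_defs)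
  show "bit t j \<Longrightarrow> edge (pos1 t (5 + 4 * j + 2) (2 * level t + 1)) East (pos1 t (5 + 4 * j + 3) (2 * level t + 1))"
    by (rule edgeI[OF F_rd2[OF j] F_rd3[OF j]]) (auto simp: pos_defs)
  show "bit t j \<Longrightarrow> edge (pos1 t (5 + 4 * j + 2) (2 * level t + 1)) Down (pos0 t (5 + 4 * j + 2) (Suc 0))"
    by (rule edgeI[OF F_rd2[OF j] F_leaf2[OF t j(2)]]) (auto simp: pos_defs)
  show "bit t j \<Longrightarrow> edge (pos1 t (5 + 4 * j + 3) (2 * level t + 1)) Down (pos0 t (5 + 4 * j + 3) (Suc 0))"
    by (rule edgeI[OF F_rd3[OF j] F_leaf3[OF t j(2)]]) (auto simp: pos_defs)
  show "bit t j \<Longrightarrow> edge (pos1 t (5 + 4 * j + 3) (2 * level t + 1)) East (pos1 t (5 + 4 * Suc j) (2 * level t + 1))"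
    using next_bit by (intro edgeI[OF F_rd3[OF j]]) (auto simp: pos_defs mod_2_Suc simp del: power_Suc)
  show "\<not> bit t j \<Longrightarrow> edge (pos1 t (5 + 4 * j) (2 * level t + 1)) Down (pos0 t (5 + 4 * j) (Suc 0))"
    by (rule edgeI[OF F_rd0[OF j(1) jn(1)] F_rd4[OF j]]) (use j in \<open>auto simp: pos_defs\<close>)
  show "\<not> bit t j \<Longrightarrow> edge (pos0 t (5 + 4 * j) (Suc 0)) East (pos0 t (5 + 4 * j + 1) (Suc 0))"
    by (rule edgeI[OF F_rd4[OF j] F_rd5[OF j]]) (auto simp: pos_defs)
  show "\<not> bit t j \<Longrightarrow> edge (pos0 t (5 + 4 * j + 1) (Suc 0)) East (pos0 t (5 + 4 * j + 2) (Suc 0))"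
    by (rule edgeI[OF F_rd5[OF j] F_rd6[OF j]]) (auto simp: pos_defs)
  show "\<not> bit t j \<Longrightarrow> edge (pos0 t (5 + 4 * j + 2) (Suc 0)) East (pos0 t (5 + 4 * j + 3) (Suc 0))"
    by (rule edgeI[OF F_rd6[OF j] F_rd7[OF j]]) (auto simp: pos_defs)
  show "\<not> bit t j \<Longrightarrow> edge (pos0 t (5 + 4 * j + 3) (Suc 0)) Up (pos1 t (5 + 4 * j + 3) (2 * level t + 1))"
    by (rule edgeI[OF F_rd7[OF j] F_rd8[OF j]]) (auto simp: pos_defs)
  show "\<not> bit t j \<Longrightarrow> edge (pos1 t (5 + 4 * j + 3) (2 * level t + 1)) East (pos1 t (5 + 4 * Suc j) (2 * level t + 1))"
    using next_bit by (intro edgeI[OF F_rd8[OF j]]) (auto simp: pos_defs mod_2_Suc simp del: power_Suc)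
qed

lemma
  assumes "live t"
  shows edge_sum_start: "edge (pos1 t bits_end (2 * level t + 1)) Down (pos0 t bits_end (Suc 0))"
    and edge_sum0: "edge (pos0 t bits_end (Suc 0)) East (pos0 t (bits_end + 1) (Suc 0))"
    and edge_sum1: "edge (pos0 t (bits_end + 1) (Suc 0)) South (pos0 t (bits_end + 1) 0)"
    and edge_sum2: "edge (pos0 t (bits_end + 1) 0) East (pos0 t (bits_end + 2) 0)"
    and edge_carry: "bits_end + 2 \<le> w \<Longrightarrow> Suc w < W \<Longrightarrow> edge (pos0 t w 0) East (pos0 t (Suc w) 0)"
    and edge_carry_last: "edge (pos0 t (W - 1) 0) East (pos0 (t + c) 0 0)"
proof -
  have W: "bits_end + 3 < W" using D_ge W_ge by linarith
  \<comment> \<open>The point where tile rules meet arithmetic: the reader now holds the whole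
    digit, and its offer is the sum described by \<open>digit_next\<close> and
    \<open>carry_out_next\<close>.\<close>
  show "edge (pos1 t bits_end (2 * level t + 1)) Down (pos0 t bits_end (Suc 0))"
    using F_rd0[OF assms, of n] digit_less[of t] n_pos
    by (intro edgeI[OF _ F_sum0[OF assms]]) (auto simp: pos_defs digit_next carry_out_next)
  show "edge (pos0 t bits_end (Suc 0)) East (pos0 t (bits_end + 1) (Suc 0))"
    by (rule edgeI[OF F_sum0[OF assms] F_sum1[OF assms]]) (auto simp: pos_defs)
  show "edge (pos0 t (bits_end + 1) (Suc 0)) South (pos0 t (bits_end + 1) 0)"
    by (rule edgeI[OF F_sum1[OF assms] F_sum2[OF assms]]) (auto simp: pos_defs)
  show "edge (pos0 t (bits_end + 1) 0) East (pos0 t (bits_end + 2) 0)"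
    by (rule edgeI[OF F_sum2[OF assms] F_carry[OF assms]]) (use W in \<open>auto simp: pos_defs\<close>)
  show "bits_end + 2 \<le> w \<Longrightarrow> Suc w < W \<Longrightarrow> edge (pos0 t w 0) East (pos0 t (Suc w) 0)"
    by (rule edgeI[OF F_carry[OF assms] F_carry[OF assms]]) (auto simp: pos_defs)
  show "edge (pos0 t (W - 1) 0) East (pos0 (t + c) 0 0)"
  proof (rule edgeI[OF F_carry[OF assms] F_carry_head])
    have "int (W - 1) + 1 = int W" using W_pos by linarith
    then show "neighbour (pos0 t (W - 1) 0) East = pos0 (t + c) 0 0"
      by (simp add: pos_defs)
  qed (use W assms in auto)
qed

lemma
  assumes "t \<le> T" "c \<le> t"
  shows edge_carry_head: "edge (pos0 t 0 0) East (pos0 t 1 0)"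
    and edge_exit: "edge (pos0 t 1 0) North (pos0 t 1 (Suc 0))"
    and edge_exit012: "p < 3 \<Longrightarrow> edge (pos0 t (Suc p) (Suc 0)) East (pos0 t (Suc (Suc p)) (Suc 0))"
    and edge_exit3: "edge (pos0 t 4 (Suc 0)) South (pos0 t 4 0)"
  subgoal by (rule edgeI[OF F_carry_head F_carry_head]) (use assms in \<open>auto simp: pos_defs\<close>)
  subgoal using assms F_exit[OF assms, of 0] by (intro edgeI[OF F_carry_head]) (auto simp: pos_defs)
  subgoal using assms F_exit[of t "Suc p"] by (intro edgeI[OF F_exit]) (auto simp: pos_defs)
  subgoal using F_exit[OF assms, of 3] by (intro edgeI[OF _ F_begin[OF assms]]) (auto simp: pos_defs)
  done

lemma edge_begin: assumes "t \<le> T" shows "edge (pos0 t 4 0) East (pos0 t 5 0)"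
proof -
  have "F (pos0 t 5 0) = Some (Write (level t) (mode_out t) 0 (digit t) 0, East)"
    using F_wr0[OF assms, of 0] by simp
  then show ?thesis using assms
    by (cases "t < c"; intro edgeI[OF F_init_begin] edgeI[OF F_begin]) (auto simp: pos_defs mode_out_def)
qed

lemma
  assumes "t \<le> T" "j < n"
  shows edge_wr0: "bit t j \<Longrightarrow> edge (pos0 t (5 + 4 * j) 0) North (pos0 t (5 + 4 * j) (Suc 0))"
    and edge_wr1: "bit t j \<Longrightarrow> edge (pos0 t (5 + 4 * j) (Suc 0)) East (pos0 t (5 + 4 * j + 1) (Suc 0))"
    and edge_wr2: "bit t j \<Longrightarrow> edge (pos0 t (5 + 4 * j + 1) (Suc 0)) South (pos0 t (5 + 4 * j + 1) 0)"
    and edge_wr3: "bit t j \<Longrightarrow> edge (pos0 t (5 + 4 * j + 1) 0) East (pos0 t (5 + 4 * j + 2) 0)"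
    and edge_wr4: "bit t j \<Longrightarrow> edge (pos0 t (5 + 4 * j + 2) 0) East (pos0 t (5 + 4 * j + 3) 0)"
    and edge_wr0': "\<not> bit t j \<Longrightarrow> edge (pos0 t (5 + 4 * j) 0) East (pos0 t (5 + 4 * j + 1) 0)"
    and edge_wr5: "\<not> bit t j \<Longrightarrow> edge (pos0 t (5 + 4 * j + 1) 0) Up (pos1 t (5 + 4 * j + 1) (2 * level t))"
    and edge_wr6: "\<not> bit t j \<Longrightarrow> edge (pos1 t (5 + 4 * j + 1) (2 * level t)) North (pos1 t (5 + 4 * j + 1) (2 * level t + 1))"
    and edge_wr7: "\<not> bit t j \<Longrightarrow> edge (pos1 t (5 + 4 * j + 1) (2 * level t + 1)) East (pos1 t (5 + 4 * j + 2) (2 * level t + 1))"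
    and edge_wr8: "\<not> bit t j \<Longrightarrow> edge (pos1 t (5 + 4 * j + 2) (2 * level t + 1)) South (pos1 t (5 + 4 * j + 2) (2 * level t))"
    and edge_wr9: "\<not> bit t j \<Longrightarrow> edge (pos1 t (5 + 4 * j + 2) (2 * level t)) Down (pos0 t (5 + 4 * j + 2) 0)"
    and edge_wr10: "\<not> bit t j \<Longrightarrow> edge (pos0 t (5 + 4 * j + 2) 0) East (pos0 t (5 + 4 * j + 3) 0)"
    and edge_wr11: "edge (pos0 t (5 + 4 * j + 3) 0) East (pos0 t (5 + 4 * Suc j) 0)"
proof -
  note j = assms
  have jn: "j \<le> n" "Suc j \<le> n" using assms by auto
  show "bit t j \<Longrightarrow> edge (pos0 t (5 + 4 * j) 0) North (pos0 t (5 + 4 * j) (Suc 0))"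
    by (rule edgeI[OF F_wr0[OF j(1) jn(1)] F_wr1[OF j]]) (use j in \<open>auto simp: pos_defs\<close>)
  show "bit t j \<Longrightarrow> edge (pos0 t (5 + 4 * j) (Suc 0)) East (pos0 t (5 + 4 * j + 1) (Suc 0))"
    by (rule edgeI[OF F_wr1[OF j] F_wr2[OF j]]) (auto simp: pos_defs)
  show "bit t j \<Longrightarrow> edge (pos0 t (5 + 4 * j + 1) (Suc 0)) South (pos0 t (5 + 4 * j + 1) 0)"
    by (rule edgeI[OF F_wr2[OF j] F_wr3[OF j]]) (auto simp: pos_defs)
  show "bit t j \<Longrightarrow> edge (pos0 t (5 + 4 * j + 1) 0) East (pos0 t (5 + 4 * j + 2) 0)"
    by (rule edgeI[OF F_wr3[OF j] F_wr4[OF j]]) (auto simp: pos_defs)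
  show "bit t j \<Longrightarrow> edge (pos0 t (5 + 4 * j + 2) 0) East (pos0 t (5 + 4 * j + 3) 0)"
    by (rule edgeI[OF F_wr4[OF j] F_wr11[OF j]]) (auto simp: pos_defs)
  show "\<not> bit t j \<Longrightarrow> edge (pos0 t (5 + 4 * j) 0) East (pos0 t (5 + 4 * j + 1) 0)"
    by (rule edgeI[OF F_wr0[OF j(1) jn(1)] F_wr5[OF j]]) (use j in \<open>auto simp: pos_defs\<close>)
  show "\<not> bit t j \<Longrightarrow> edge (pos0 t (5 + 4 * j + 1) 0) Up (pos1 t (5 + 4 * j + 1) (2 * level t))"
    by (rule edgeI[OF F_wr5[OF j] F_wr6[OF j]]) (auto simp: pos_defs)
  show "\<not> bit t j \<Longrightarrow> edge (pos1 t (5 + 4 * j + 1) (2 * level t)) North (pos1 t (5 + 4 * j + 1) (2 * level t + 1))"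
    by (rule edgeI[OF F_wr6[OF j] F_wr7[OF j]]) (auto simp: pos_defs)
  show "\<not> bit t j \<Longrightarrow> edge (pos1 t (5 + 4 * j + 1) (2 * level t + 1)) East (pos1 t (5 + 4 * j + 2) (2 * level t + 1))"
    by (rule edgeI[OF F_wr7[OF j] F_wr8[OF j]]) (auto simp: pos_defs)
  show "\<not> bit t j \<Longrightarrow> edge (pos1 t (5 + 4 * j + 2) (2 * level t + 1)) South (pos1 t (5 + 4 * j + 2) (2 * level t))"
    by (rule edgeI[OF F_wr8[OF j] F_wr9[OF j]]) (auto simp: pos_defs)
  show "\<not> bit t j \<Longrightarrow> edge (pos1 t (5 + 4 * j + 2) (2 * level t)) Down (pos0 t (5 + 4 * j + 2) 0)"
    by (rule edgeI[OF F_wr9[OF j] F_wr10[OF j]]) (auto simp: pos_defs)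
  show "\<not> bit t j \<Longrightarrow> edge (pos0 t (5 + 4 * j + 2) 0) East (pos0 t (5 + 4 * j + 3) 0)"
    by (rule edgeI[OF F_wr10[OF j] F_wr11[OF j]]) (auto simp: pos_defs)
  show "edge (pos0 t (5 + 4 * j + 3) 0) East (pos0 t (5 + 4 * Suc j) 0)"
    by (rule edgeI[OF F_wr11[OF j] F_wr0[OF j(1) jn(2)]]) (auto simp: pos_defs simp flip: div_mult2_eq power_Suc2)
qed

lemma
  assumes "t \<le> T"
  shows edge_run_start: "edge (pos0 t bits_end 0) Up (pos1 t bits_end (2 * level t))"
    and edge_run: "bits_end \<le> w \<Longrightarrow> w + 2 < D \<Longrightarrow> edge (pos1 t w (2 * level t)) East (pos1 t (Suc w) (2 * level t))"
  subgoal using F_wr0[OF assms, of n] F_run[OF assms, of bits_end] D_ge digit_less[of t]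
    by (intro edgeI[of "pos0 t bits_end 0"]) (auto simp: pos_defs)
  subgoal using assms F_run[of t "Suc w"] by (intro edgeI[OF F_run]) (auto simp: pos_defs)
  done

lemma
  assumes "t < T"
  shows edge_ver_start: "edge (pos1 t (D - 2) (2 * level t)) East (pos1 t (D - 1) (2 * level t))"
    and edge_ver_north: "2 * level t \<le> y \<Longrightarrow> y < 2 * level (Suc t) \<Longrightarrow> edge (pos1 t (D - 1) y) North (pos1 t (D - 1) (Suc y))"
    and edge_ver_south: "2 * level (Suc t) \<le> y \<Longrightarrow> y < 2 * level t \<Longrightarrow> edge (pos1 t (D - 1) (Suc y)) South (pos1 t (D - 1) y)"
    and edge_ver_east: "edge (pos1 t (D - 1) (2 * level (Suc t))) East (pos1 (Suc t) 0 (2 * level (Suc t)))"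
proof -
  have t: "t \<le> T" and D: "bits_end \<le> D - 2" "D - 2 + 1 < D" "1 < D" using assms D_ge by auto
  show "edge (pos1 t (D - 2) (2 * level t)) East (pos1 t (D - 1) (2 * level t))"
  \<comment> \<open>After the top digit the run returns to digit 0 with mode
    \<open>Some True\<close>, the increment of the next value; otherwise the mode is handed on
    unchanged.\<close>
  proof (cases "Suc (level t) = c")
    case True
    then show ?thesis using assms mode_in_top[OF True] mode_out_top[OF True t] D
      by (intro edgeI[OF F_run[OF t D(1,2)] F_ver_start[OF assms]]) (auto simp: pos_defs of_nat_diff)
  next
    case False
    then have "Suc (level t) < c" using mod_c[of t] by simp
    then show ?thesis using mode_out_md[of t] D Suc_dg[of t]
      by (intro edgeI[OF F_run[OF t D(1,2)] F_ver_start[OF assms]]) (auto simp: pos_defs of_nat_diff)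
  qed
  show "edge (pos1 t (D - 1) y) North (pos1 t (D - 1) (Suc y))" if "2 * level t \<le> y" "y < 2 * level (Suc t)"
  proof -
    have "F (pos1 t (D - 1) y) = Some (Vertical (level (Suc t)) (mode_in (Suc t)) y, if y = 2 * level t then East else North)"
      using that F_ver_start[OF assms] F_ver_north[OF assms, of y] by auto
    then show ?thesis using that by (intro edgeI[OF _ F_ver_north[OF assms]]) (auto simp: pos_defs split: if_splits)
  qed
  show "edge (pos1 t (D - 1) (Suc y)) South (pos1 t (D - 1) y)" if "2 * level (Suc t) \<le> y" "y < 2 * level t"
  proof -
    have "F (pos1 t (D - 1) (Suc y)) =
        Some (Vertical (level (Suc t)) (mode_in (Suc t)) (Suc y), if Suc y = 2 * level t then East else South)"
      using that F_ver_start[OF assms] F_ver_south[OF assms, of "Suc y"] by auto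
    then show ?thesis using that by (intro edgeI[OF _ F_ver_south[OF assms]]) (auto simp: pos_defs split: if_splits)
  qed
  have e: "F (pos1 (Suc t) 0 (2 * level (Suc t))) = Some (Gadget (level (Suc t)) (mode_in (Suc t)) 0, East)"
    using F_gad012[of "Suc t" 0] assms by simp
  have nb: "neighbour (pos1 t (D - 1) (2 * level (Suc t))) East = pos1 (Suc t) 0 (2 * level (Suc t))"
    using D by (simp add: pos1_def B_def of_nat_diff)
  consider "level t = level (Suc t)" | "2 * level t < 2 * level (Suc t)" | "2 * level (Suc t) < 2 * level t" by linarith
  then show "edge (pos1 t (D - 1) (2 * level (Suc t))) East (pos1 (Suc t) 0 (2 * level (Suc t)))"
  proof cases
    case 1
    then show ?thesis using F_ver_start[OF assms] by (intro edgeI[OF _ e nb]) auto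
  next
    case 2
    then show ?thesis using F_ver_north[OF assms 2] by (intro edgeI[OF _ e nb]) auto
  next
    case 3
    then show ?thesis using F_ver_south[OF assms _ 3] by (intro edgeI[OF _ e nb]) auto
  qed
qed


section \<open>Fillers at the right and the left end\<close>

definition spine_pos :: "nat \<Rightarrow> pos" where "spine_pos y = (int (N - 1), int y, 0)"

lemma N_pos: "0 < N" using N_eq D_pos by simp

lemma D_le_last: "i < c \<Longrightarrow> D \<le> (c - i) * D"
  by (cases "c - i") auto

lemma spine_pos_q0: assumes "i < c" shows "spine_pos (2 * i + r) = pos0 (last_step i) ((c - i) * D - 1) r"
  using last_step[OF assms] D_le_last[OF assms] D_pos
  by (simp add: spine_pos_def pos0_def del: of_nat_add)

lemma F_sp: assumes "y < 2 * c" shows "F (spine_pos y) = Some (Spine y, spine_dir y)"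
proof -
  have i: "y div 2 < c" using assms by auto
  consider "y = 2 * (y div 2) + 0" | "y = 2 * (y div 2) + Suc 0" by linarith
  then show ?thesis
  proof cases
    case 1
    then show ?thesis using F_spine0[OF i] spine_pos_q0[OF i, of 0] by simp
  next
    case 2
    then show ?thesis using F_spine1[OF i] spine_pos_q0[OF i, of 1] by simp
  qed
qed

lemma edge_fin_start: "edge (pos1 T (D - 2) (2 * level T)) East (pos1 T (D - 1) (2 * (c - 1)))"
proof -
  have D: "bits_end \<le> D - 2" "D - 2 + 1 < D" "1 < D" using D_ge by auto
  have "Suc (level T) = c" using T_dg c_pos by simp
  then show ?thesis using mode_out_top[of T] D T_dg
    by (intro edgeI[OF F_run[OF order_refl D(1,2)] F_fin]) (auto simp: pos_defs of_nat_diff)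
qed

lemma edge_fin: "edge (pos1 T (D - 1) (2 * (c - 1))) Down (spine_pos (2 * (c - 1)))"
  using F_sp[of "2 * (c - 1)"] c_pos N_eq D_pos
  by (intro edgeI[OF F_fin]) (auto simp: pos_defs spine_pos_def spine_dir_def)

lemma edge_spine_north: "edge (spine_pos (2 * (c - 1))) North (spine_pos (Suc (2 * (c - 1))))"
proof -
  have y: "Suc (Suc (2 * (c - 1))) = 2 * c" using c_pos by simp
  then have d: "spine_dir (2 * (c - 1)) = Down" "spine_dir (Suc (2 * (c - 1))) = North"
    by (auto simp: spine_dir_def)
  show ?thesis
  proof (rule edgeI)
    show "F (spine_pos (2 * (c - 1))) = Some (Spine (2 * (c - 1)), Down)"
      "F (spine_pos (Suc (2 * (c - 1)))) = Some (Spine (Suc (2 * (c - 1))), North)"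
      using y F_sp d by auto
    show "out (Spine (2 * (c - 1))) North = Some (Spine (Suc (2 * (c - 1))))" using y by simp
  qed (auto simp: spine_pos_def)
qed

lemma edge_spine_south: "Suc (Suc y) < 2 * c \<Longrightarrow> edge (spine_pos (Suc y)) South (spine_pos y)"
  using F_sp[of "Suc y"] F_sp[of y]
  by (intro edgeI[of "spine_pos (Suc y)"]) (auto simp: spine_pos_def spine_dir_def split: if_splits)

lemma
  assumes "i < c"
  shows edge_last0_start: "edge (spine_pos (2 * i)) West (pos0 (last_step i) ((c - i) * D - 2) 0)"
    and edge_last1_start: "edge (spine_pos (2 * i + 1)) West (pos0 (last_step i) ((c - i) * D - 2) (Suc 0))"
    and edge_last0: "bits_end < w \<Longrightarrow> w + 2 < (c - i) * D \<Longrightarrow> edge (pos0 (last_step i) (Suc w) 0) West (pos0 (last_step i) w 0)"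
    and edge_last1: "5 \<le> w \<Longrightarrow> w + 2 < (c - i) * D \<Longrightarrow>
       edge (pos0 (last_step i) (Suc w) (Suc 0)) West (pos0 (last_step i) w (Suc 0))"
proof -
  have D: "bits_end < (c - i) * D - 2" "5 \<le> (c - i) * D - 2" "(c - i) * D - 2 + 1 < (c - i) * D" "2 \<le> (c - i) * D"
    using D_ge D_le_last[OF assms] by linarith+
  have even_div: "(2 * i + 1) div 2 = i" by simp
  have nb: "neighbour (spine_pos (2 * i + r)) West = pos0 (last_step i) ((c - i) * D - 2) r" for r
    using spine_pos_q0[OF assms, of r] D(4) by (simp add: pos0_def of_nat_diff del: of_nat_mult)
  show "edge (spine_pos (2 * i)) West (pos0 (last_step i) ((c - i) * D - 2) 0)"
    using assms nb[of 0]
    by (intro edgeI[OF F_sp F_last_tooth0[OF assms D(1,3)]]) (auto simp: spine_dir_def tooth_length_def)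
  show "edge (spine_pos (2 * i + 1)) West (pos0 (last_step i) ((c - i) * D - 2) (Suc 0))"
    using assms nb[of "Suc 0"]
    by (intro edgeI[OF F_sp F_last_tooth1[OF assms D(2,3)]])
      (auto simp: spine_dir_def tooth_length_def even_div)
  show "bits_end < w \<Longrightarrow> w + 2 < (c - i) * D \<Longrightarrow> edge (pos0 (last_step i) (Suc w) 0) West (pos0 (last_step i) w 0)"
    by (rule edgeI[OF F_last_tooth0 F_last_tooth0]) (use assms in \<open>auto simp: pos_defs\<close>)
  show "5 \<le> w \<Longrightarrow> w + 2 < (c - i) * D \<Longrightarrow> edge (pos0 (last_step i) (Suc w) (Suc 0)) West (pos0 (last_step i) w (Suc 0))"
    by (rule edgeI[OF F_last_tooth1 F_last_tooth1]) (use assms in \<open>auto simp: pos_defs\<close>)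
qed

text \<open>Columns west of \<open>B t\<close> belong to no window when \<open>t < c\<close>, so
  they are addressed absolutely.\<close>

definition left_pos :: "nat \<Rightarrow> nat \<Rightarrow> nat \<Rightarrow> pos" where "left_pos t x r = (int x, int (2 * t + r), 0)"

lemma F_left: "t < c \<Longrightarrow> x < B t + 2 \<Longrightarrow> r < 2 \<Longrightarrow> F (left_pos t x r) = Some (Tooth x (r = 1 \<and> Suc t = c), West)"
  unfolding left_pos_def by (rule F_left_tooth)

lemma
  assumes "t < c"
  shows edge_left_start0: "edge (pos0 t 2 0) West (left_pos t (B t + 1) 0)"
    and edge_left_start1: "edge (pos0 t 2 (Suc 0)) West (left_pos t (B t + 1) (Suc 0))"
    and edge_left: "Suc x < B t + 2 \<Longrightarrow> r < 2 \<Longrightarrow> edge (left_pos t (Suc x) r) West (left_pos t x r)"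
  subgoal by (rule edgeI[OF F_init3 F_left]) (use assms in \<open>auto simp: pos_defs left_pos_def B_def\<close>)
  subgoal using assms F_base[OF assms, of 0] by (intro edgeI[OF _ F_left]) (auto simp: pos_defs left_pos_def B_def)
  subgoal by (rule edgeI[OF F_left F_left]) (use assms in \<open>auto simp: left_pos_def\<close>)
  done

subsection \<open>Reachability\<close>

text \<open>The source \<open>x\<close> stays arbitrary: with the seed as source the following
  lemmas give reachability, with an obstructing tile as source they show that it precedes the tile
  it obstructs.\<close>

definition leads :: "pos \<Rightarrow> pos \<Rightarrow> bool" where "leads x p \<longleftrightarrow> (x, p) \<in> E\<^sup>*"

lemma leads_refl: "leads x x" by (simp add: leads_def)

lemma leads_ed: "leads x p \<Longrightarrow> edge p e p' \<Longrightarrow> leads x p'"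
  by (auto simp: leads_def edge_def)

lemma leads_down:
  assumes "leads x (f m)" "\<And>w. a \<le> w \<Longrightarrow> w < m \<Longrightarrow> \<exists>e. edge (f (Suc w)) e (f w)" "a \<le> w" "w \<le> m"
  shows "leads x (f w)"
  using assms(4,3)
proof (induction rule: inc_induct)
  case (step v)
  then obtain e where "edge (f (Suc v)) e (f v)" using assms(2)[of v] by auto
  moreover have "leads x (f (Suc v))" using step by simp
  ultimately show ?case by (rule leads_ed[rotated])
qed (rule assms(1))

lemma leads_up:
  assumes "leads x (f a)" "\<And>w. a \<le> w \<Longrightarrow> w < m \<Longrightarrow> \<exists>e. edge (f w) e (f (Suc w))" "a \<le> w" "w \<le> m"
  shows "leads x (f w)"
  using assms(3,4)
proof (induction rule: dec_induct)
  case (step v)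
  then obtain e where e: "edge (f v) e (f (Suc v))" using assms(2)[of v] by auto
  have "leads x (f v)" using step by simp
  then show ?case using e by (rule leads_ed)
qed (rule assms(1))

lemma leads_gadget:
  assumes t: "t \<le> T" "c \<le> t" and x: "leads x (pos0 t 2 0)"
  shows "leads x (pos0 t 3 0)" "leads x (pos1 t 3 (2 * level t))"
    "w \<le> 3 \<Longrightarrow> leads x (pos1 t w (2 * level t + 1))" "leads x (pos0 t 0 (Suc 0))"
proof -
  show 1: "leads x (pos0 t 3 0)" using leads_ed[OF x edge_gad3] t by blast
  show 2: "leads x (pos1 t 3 (2 * level t))" by (rule leads_ed[OF 1 edge_gad4[OF t]])
  have 3: "leads x (pos1 t 3 (2 * level t + 1))" by (rule leads_ed[OF 2 edge_gad5[OF t]])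
  have 4: "leads x (pos1 t 2 (2 * level t + 1))" by (rule leads_ed[OF 3 edge_gad6[OF t]])
  have 5: "leads x (pos1 t 1 (2 * level t + 1))" using leads_ed[OF _ edge_gad78[OF t, of 1]] 4 by (simp add: numeral_2_eq_2)
  have 6: "leads x (pos1 t 0 (2 * level t + 1))" using leads_ed[OF _ edge_gad78[OF t, of 0]] 5 by simp
  show "leads x (pos1 t w (2 * level t + 1))" if "w \<le> 3"
  proof -
    have "w = 0 \<or> w = 1 \<or> w = 2 \<or> w = 3" using that by linarith
    then show ?thesis using 3 4 5 6 by blast
  qed
  show "leads x (pos0 t 0 (Suc 0))" by (rule leads_ed[OF 6 edge_gad9[OF t]])
qed

lemma W_big: "bits_end + 3 < W" using D_ge W_ge by linarith

lemma leads_return: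
  assumes l: "live t" and x: "leads x (pos0 t m (Suc 0))" and m: "bits_end + 2 \<le> m" "m < W"
  shows "bits_end + 2 \<le> w \<Longrightarrow> w \<le> m \<Longrightarrow> leads x (pos0 t w (Suc 0))"
    and "leads x (pos1 t (bits_end + 2) (2 * level t + 1))"
    and "5 \<le> w \<Longrightarrow> w \<le> bits_end + 2 \<Longrightarrow> leads x (pos1 t w (2 * level t + 2))"
    and "leads x (pos1 t 5 (2 * level t + 1))"
proof -
  show 1: "leads x (pos0 t w (Suc 0))" if "bits_end + 2 \<le> w" "w \<le> m" for w
    by (rule leads_down[where f = "\<lambda>w. pos0 t w (Suc 0)", OF x _ that])
      (use edge_ret[OF l] m in \<open>meson le_less_trans Suc_leI\<close>)
  show 2: "leads x (pos1 t (bits_end + 2) (2 * level t + 1))"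
    by (rule leads_ed[OF 1 edge_ret_up[OF l]]) (use m in auto)
  have 3: "leads x (pos1 t (bits_end + 2) (2 * level t + 2))" by (rule leads_ed[OF 2 edge_rise[OF l]])
  show 4: "leads x (pos1 t w (2 * level t + 2))" if "5 \<le> w" "w \<le> bits_end + 2" for w
  proof (rule leads_down[where f = "\<lambda>w. pos1 t w (2 * level t + 2)", OF 3 _ that])
    show "\<exists>e. edge (pos1 t (Suc w) (2 * level t + 2)) e (pos1 t w (2 * level t + 2))" if "5 \<le> w" "w < bits_end + 2" for w
      using edge_over[OF l, of w] that by auto
  qed
  show "leads x (pos1 t 5 (2 * level t + 1))" by (rule leads_ed[OF 4 edge_over5[OF l]]) auto
qed

lemma leads_read_bit:
  assumes l: "live t" and j: "j < n" and x: "leads x (pos1 t (5 + 4 * j) (2 * level t + 1))"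
  shows "leads x (pos1 t (5 + 4 * Suc j) (2 * level t + 1))"
    and "bit t j \<Longrightarrow> leads x (pos1 t (5 + 4 * j + 1) (2 * level t + 1))"
    and "bit t j \<Longrightarrow> leads x (pos1 t (5 + 4 * j + 2) (2 * level t + 1))"
    and "leads x (pos1 t (5 + 4 * j + 3) (2 * level t + 1))"
    and "bit t j \<Longrightarrow> leads x (pos0 t (5 + 4 * j + 2) (Suc 0))"
    and "bit t j \<Longrightarrow> leads x (pos0 t (5 + 4 * j + 3) (Suc 0))"
    and "\<not> bit t j \<Longrightarrow> leads x (pos0 t (5 + 4 * j) (Suc 0))"
    and "\<not> bit t j \<Longrightarrow> leads x (pos0 t (5 + 4 * j + 1) (Suc 0))"
    and "\<not> bit t j \<Longrightarrow> leads x (pos0 t (5 + 4 * j + 2) (Suc 0))"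
    and "\<not> bit t j \<Longrightarrow> leads x (pos0 t (5 + 4 * j + 3) (Suc 0))"
proof -
  note a = l j
  show 1: "leads x (pos1 t (5 + 4 * j + 1) (2 * level t + 1))" if "bit t j" by (rule leads_ed[OF x edge_rd0[OF a that]])
  show 2: "leads x (pos1 t (5 + 4 * j + 2) (2 * level t + 1))" if "bit t j" by (rule leads_ed[OF 1[OF that] edge_rd1[OF a that]])
  have 3: "leads x (pos1 t (5 + 4 * j + 3) (2 * level t + 1))" if "bit t j" by (rule leads_ed[OF 2[OF that] edge_rd2[OF a that]])
  show "leads x (pos0 t (5 + 4 * j + 2) (Suc 0))" if "bit t j" by (rule leads_ed[OF 2[OF that] edge_leaf2[OF a that]])
  show "leads x (pos0 t (5 + 4 * j + 3) (Suc 0))" if "bit t j" by (rule leads_ed[OF 3[OF that] edge_leaf3[OF a that]])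
  show 4: "leads x (pos0 t (5 + 4 * j) (Suc 0))" if "\<not> bit t j" by (rule leads_ed[OF x edge_rd0'[OF a that]])
  show 5: "leads x (pos0 t (5 + 4 * j + 1) (Suc 0))" if "\<not> bit t j" by (rule leads_ed[OF 4[OF that] edge_rd4[OF a that]])
  show 6: "leads x (pos0 t (5 + 4 * j + 2) (Suc 0))" if "\<not> bit t j" by (rule leads_ed[OF 5[OF that] edge_rd5[OF a that]])
  show 7: "leads x (pos0 t (5 + 4 * j + 3) (Suc 0))" if "\<not> bit t j" by (rule leads_ed[OF 6[OF that] edge_rd6[OF a that]])
  have 8: "leads x (pos1 t (5 + 4 * j + 3) (2 * level t + 1))" if "\<not> bit t j" by (rule leads_ed[OF 7[OF that] edge_rd7[OF a that]])
  show 9: "leads x (pos1 t (5 + 4 * j + 3) (2 * level t + 1))" using 3 8 by blast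
  show "leads x (pos1 t (5 + 4 * Suc j) (2 * level t + 1))"
    using leads_ed[OF 9 edge_rd3[OF a]] leads_ed[OF 9 edge_rd8[OF a]] by blast
qed

lemma leads_read:
  assumes "live t" "leads x (pos1 t (5 + 4 * i) (2 * level t + 1))" "i \<le> j" "j \<le> n"
  shows "leads x (pos1 t (5 + 4 * j) (2 * level t + 1))"
  using assms(3,4)
proof (induction rule: dec_induct)
  case (step j)
  then show ?case using leads_read_bit(1)[OF assms(1), of j x] by simp
qed (rule assms(2))

lemma leads_sum:
  assumes l: "live t" and x: "leads x (pos1 t bits_end (2 * level t + 1))"
  shows "leads x (pos0 t bits_end (Suc 0))" "leads x (pos0 t (bits_end + 1) (Suc 0))" "leads x (pos0 t (bits_end + 1) 0)"
    "bits_end + 2 \<le> w \<Longrightarrow> w < W \<Longrightarrow> leads x (pos0 t w 0)" "leads x (pos0 (t + c) 0 0)"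
proof -
  show 1: "leads x (pos0 t bits_end (Suc 0))" by (rule leads_ed[OF x edge_sum_start[OF l]])
  show 2: "leads x (pos0 t (bits_end + 1) (Suc 0))" by (rule leads_ed[OF 1 edge_sum0[OF l]])
  show 3: "leads x (pos0 t (bits_end + 1) 0)" by (rule leads_ed[OF 2 edge_sum1[OF l]])
  have 4: "leads x (pos0 t (bits_end + 2) 0)" by (rule leads_ed[OF 3 edge_sum2[OF l]])
  show 5: "leads x (pos0 t w 0)" if "bits_end + 2 \<le> w" "w < W" for w
  proof (rule leads_up[where f = "\<lambda>w. pos0 t w 0" and m = "W - 1", OF 4 _ that(1)])
    show "\<exists>e. edge (pos0 t w 0) e (pos0 t (Suc w) 0)" if "bits_end + 2 \<le> w" "w < W - 1" for w
      using edge_carry[OF l, of w] that less_diff_conv[of w W 1] by auto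
  qed (use that in linarith)
  show "leads x (pos0 (t + c) 0 0)" by (rule leads_ed[OF 5 edge_carry_last[OF l]]) (use W_big in auto)
qed

lemma leads_exit:
  assumes t: "t \<le> T" "c \<le> t" and x: "leads x (pos0 t 0 0)"
  shows "leads x (pos0 t 1 0)" "p < 4 \<Longrightarrow> leads x (pos0 t (Suc p) (Suc 0))" "leads x (pos0 t 4 0)"
proof -
  show 1: "leads x (pos0 t 1 0)" by (rule leads_ed[OF x edge_carry_head[OF t]])
  have 2: "leads x (pos0 t (Suc 0) (Suc 0))" using leads_ed[OF 1 edge_exit[OF t]] by simp
  show 3: "leads x (pos0 t (Suc p) (Suc 0))" if "p < 4" for p
    by (rule leads_up[where f = "\<lambda>p. pos0 t (Suc p) (Suc 0)" and m = 3, OF 2])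
      (use edge_exit012[OF t] that in auto)
  show "leads x (pos0 t 4 0)" using leads_ed[OF _ edge_exit3[OF t]] 3[of 3] by simp
qed

lemma leads_write_bit:
  assumes t: "t \<le> T" and j: "j < n" and x: "leads x (pos0 t (5 + 4 * j) 0)"
  shows "leads x (pos0 t (5 + 4 * Suc j) 0)"
    and "leads x (pos0 t (5 + 4 * j + 1) 0)"
    and "leads x (pos0 t (5 + 4 * j + 2) 0)"
    and "leads x (pos0 t (5 + 4 * j + 3) 0)"
    and "bit t j \<Longrightarrow> leads x (pos0 t (5 + 4 * j) (Suc 0))"
    and "bit t j \<Longrightarrow> leads x (pos0 t (5 + 4 * j + 1) (Suc 0))"
    and "\<not> bit t j \<Longrightarrow> leads x (pos1 t (5 + 4 * j + 1) (2 * level t))"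
    and "\<not> bit t j \<Longrightarrow> leads x (pos1 t (5 + 4 * j + 1) (2 * level t + 1))"
    and "\<not> bit t j \<Longrightarrow> leads x (pos1 t (5 + 4 * j + 2) (2 * level t + 1))"
    and "\<not> bit t j \<Longrightarrow> leads x (pos1 t (5 + 4 * j + 2) (2 * level t))"
proof -
  note a = t j
  show 1: "leads x (pos0 t (5 + 4 * j) (Suc 0))" if "bit t j" by (rule leads_ed[OF x edge_wr0[OF a that]])
  show 2: "leads x (pos0 t (5 + 4 * j + 1) (Suc 0))" if "bit t j" by (rule leads_ed[OF 1[OF that] edge_wr1[OF a that]])
  have 3: "leads x (pos0 t (5 + 4 * j + 1) 0)" if "bit t j" by (rule leads_ed[OF 2[OF that] edge_wr2[OF a that]])
  have 4: "leads x (pos0 t (5 + 4 * j + 2) 0)" if "bit t j" by (rule leads_ed[OF 3[OF that] edge_wr3[OF a that]])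
  have 5: "leads x (pos0 t (5 + 4 * j + 3) 0)" if "bit t j" by (rule leads_ed[OF 4[OF that] edge_wr4[OF a that]])
  have 6: "leads x (pos0 t (5 + 4 * j + 1) 0)" if "\<not> bit t j" by (rule leads_ed[OF x edge_wr0'[OF a that]])
  show 7: "leads x (pos1 t (5 + 4 * j + 1) (2 * level t))" if "\<not> bit t j" by (rule leads_ed[OF 6[OF that] edge_wr5[OF a that]])
  show 8: "leads x (pos1 t (5 + 4 * j + 1) (2 * level t + 1))" if "\<not> bit t j" by (rule leads_ed[OF 7[OF that] edge_wr6[OF a that]])
  show 9: "leads x (pos1 t (5 + 4 * j + 2) (2 * level t + 1))" if "\<not> bit t j" by (rule leads_ed[OF 8[OF that] edge_wr7[OF a that]])
  show 10: "leads x (pos1 t (5 + 4 * j + 2) (2 * level t))" if "\<not> bit t j" by (rule leads_ed[OF 9[OF that] edge_wr8[OF a that]])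
  have 11: "leads x (pos0 t (5 + 4 * j + 2) 0)" if "\<not> bit t j" by (rule leads_ed[OF 10[OF that] edge_wr9[OF a that]])
  have 12: "leads x (pos0 t (5 + 4 * j + 3) 0)" if "\<not> bit t j" by (rule leads_ed[OF 11[OF that] edge_wr10[OF a that]])
  show "leads x (pos0 t (5 + 4 * j + 1) 0)" "leads x (pos0 t (5 + 4 * j + 2) 0)"
    using 3 4 6 11 by blast+
  show 13: "leads x (pos0 t (5 + 4 * j + 3) 0)" using 5 12 by blast
  show "leads x (pos0 t (5 + 4 * Suc j) 0)" by (rule leads_ed[OF 13 edge_wr11[OF a]])
qed

lemma leads_write:
  assumes "t \<le> T" "leads x (pos0 t (5 + 4 * i) 0)" "i \<le> j" "j \<le> n"
  shows "leads x (pos0 t (5 + 4 * j) 0)"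
  using assms(3,4)
proof (induction rule: dec_induct)
  case (step j)
  then show ?case using leads_write_bit(1)[OF assms(1), of j x] by simp
qed (rule assms(2))

lemma leads_run:
  assumes t: "t \<le> T" and x: "leads x (pos0 t bits_end 0)"
  shows "bits_end \<le> w \<Longrightarrow> w + 1 < D \<Longrightarrow> leads x (pos1 t w (2 * level t))"
proof -
  have 1: "leads x (pos1 t bits_end (2 * level t))" by (rule leads_ed[OF x edge_run_start[OF t]])
  show "leads x (pos1 t w (2 * level t))" if "bits_end \<le> w" "w + 1 < D"
  proof (rule leads_up[where f = "\<lambda>w. pos1 t w (2 * level t)" and m = "D - 2", OF 1 _ that(1)])
    show "\<exists>e. edge (pos1 t w (2 * level t)) e (pos1 t (Suc w) (2 * level t))" if "bits_end \<le> w" "w < D - 2" for w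
      using edge_run[OF t, of w] that less_diff_conv[of w D 2] by auto
  qed (use that in linarith)
qed

lemma leads_vertical:
  assumes t: "t < T" and x: "leads x (pos0 t bits_end 0)"
  shows "2 * level t \<le> y \<Longrightarrow> y \<le> 2 * level (Suc t) \<Longrightarrow> leads x (pos1 t (D - 1) y)"
    and "2 * level (Suc t) \<le> y \<Longrightarrow> y \<le> 2 * level t \<Longrightarrow> leads x (pos1 t (D - 1) y)"
    and "w \<le> 2 \<Longrightarrow> leads x (pos1 (Suc t) w (2 * level (Suc t)))"
    and "leads x (pos0 (Suc t) 2 0)"
proof -
  have 0: "leads x (pos1 t (D - 1) (2 * level t))"
    by (rule leads_ed[OF leads_run[OF _ x] edge_ver_start[OF t]]) (use t D_ge in auto)
  show 1: "leads x (pos1 t (D - 1) y)" if "2 * level t \<le> y" "y \<le> 2 * level (Suc t)" for y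
    by (rule leads_up[where f = "\<lambda>y. pos1 t (D - 1) y", OF 0 _ that]) (use edge_ver_north[OF t] in blast)
  show 2: "leads x (pos1 t (D - 1) y)" if "2 * level (Suc t) \<le> y" "y \<le> 2 * level t" for y
    by (rule leads_down[where f = "\<lambda>y. pos1 t (D - 1) y", OF 0 _ that]) (use edge_ver_south[OF t] in blast)
  have "leads x (pos1 t (D - 1) (2 * level (Suc t)))"
    using 1[of "2 * level (Suc t)"] 2[of "2 * level (Suc t)"] by linarith
  from leads_ed[OF this edge_ver_east[OF t]] have 3: "leads x (pos1 (Suc t) 0 (2 * level (Suc t)))" .
  show 4: "leads x (pos1 (Suc t) w (2 * level (Suc t)))" if "w \<le> 2" for w
    by (rule leads_up[where f = "\<lambda>w. pos1 (Suc t) w (2 * level (Suc t))" and m = 2, OF 3])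
      (use edge_gad01[of "Suc t"] t that in \<open>auto simp: less_2_cases_iff\<close>)
  show "leads x (pos0 (Suc t) 2 0)"
    by (rule leads_ed[OF 4 edge_gad2]) (use t in auto)
qed

lemma leads_init:
  assumes t: "t < c" and x: "leads x (pos0 t 2 0)"
  shows "leads x (pos0 t 3 0)" "leads x (pos0 t 4 0)" "p \<le> 2 \<Longrightarrow> leads x (pos0 t (2 + p) (Suc 0))"
    "r < 2 \<Longrightarrow> y < B t + 2 \<Longrightarrow> leads x (left_pos t y r)"
proof -
  show 1: "leads x (pos0 t 3 0)" using leads_ed[OF x edge_gad3] init_le[OF t] by blast
  show "leads x (pos0 t 4 0)" by (rule leads_ed[OF 1 edge_init4[OF t]])
  have 2: "leads x (pos0 t (2 + 0) (Suc 0))" using leads_ed[OF x edge_base[OF t]] by simp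
  show "leads x (pos0 t (2 + p) (Suc 0))" if "p \<le> 2"
    by (rule leads_up[where f = "\<lambda>p. pos0 t (2 + p) (Suc 0)" and m = 2, OF 2])
      (use edge_base01[OF t] that in \<open>auto simp: less_2_cases_iff\<close>)
  show "leads x (left_pos t y r)" if "r < 2" "y < B t + 2"
  proof -
    have "leads x (left_pos t (B t + 1) r)"
      using leads_ed[OF x edge_left_start0[OF t]] leads_ed[OF _ edge_left_start1[OF t], of x] 2 that(1)
      by (auto simp: less_2_cases_iff)
    then show ?thesis
      by (rule leads_down[where f = "\<lambda>y. left_pos t y r" and a = 0]) (use edge_left[OF t] that in force)+
  qed
qed

text \<open>The round trip of step \<open>t + c\<close>: from its wall tile back into window
  \<open>t\<close>, along all its bits, and home with the new digit.\<close>

lemma leads_read_start: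
  assumes "live t" "leads x (pos0 (t + c) 2 0)"
  shows "leads x (pos0 t (W - 1) (Suc 0))" "j \<le> n \<Longrightarrow> leads x (pos1 t (5 + 4 * j) (2 * level t + 1))"
    "leads x (pos0 (t + c) 0 0)" "leads x (pos0 (t + c) 4 0)"
proof -
  have tc: "c \<le> t + c" by simp
  show 1: "leads x (pos0 t (W - 1) (Suc 0))"
    by (rule leads_ed[OF leads_gadget(4)[OF assms(1) tc assms(2)] edge_ret_head[OF assms(1)]])
  show 2: "leads x (pos1 t (5 + 4 * j) (2 * level t + 1))" if "j \<le> n" for j
    using leads_read[OF assms(1), of x 0 j] leads_return(4)[OF assms(1) 1] W_big that by simp
  show 3: "leads x (pos0 (t + c) 0 0)" using leads_sum(5)[OF assms(1)] 2[of n] by simp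
  show "leads x (pos0 (t + c) 4 0)" by (rule leads_exit(3)[OF assms(1) tc 3])
qed

lemma leads_begin:
  assumes "t \<le> T" "leads x (pos0 t 2 0)"
  shows "leads x (pos0 t 4 0)" "j \<le> n \<Longrightarrow> leads x (pos0 t (5 + 4 * j) 0)"
proof -
  show 1: "leads x (pos0 t 4 0)"
  proof (cases "t < c")
    case False
    then have "t = t - c + c" by simp
    then show ?thesis using leads_read_start(4)[of "t - c" x] assms by simp
  qed (use leads_init(2) assms in blast)
  show "leads x (pos0 t (5 + 4 * j) 0)" if "j \<le> n"
    using leads_write[OF assms(1), of x 0 j] leads_ed[OF 1 edge_begin[OF assms(1)]] that by simp
qed

text \<open>The wall tile \<open>pos0 t 2 0\<close> serves as the checkpoint of step
  \<open>t\<close>: it is the first tile that the path puts into window \<open>t\<close>, and for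
  \<open>t = 0\<close> it is the seed.\<close>

lemma leads_step:
  assumes "t \<le> s" "s \<le> T" "leads x (pos0 t 2 0)" shows "leads x (pos0 s 2 0)"
  using assms(1,2)
proof (induction rule: dec_induct)
  case (step s)
  then show ?case using leads_vertical(4)[of s x] leads_begin(2)[of s x n] by simp
qed (rule assms(3))

lemma leads_seed: "t \<le> T \<Longrightarrow> leads (pos0 0 2 0) (pos0 t 2 0)"
  by (rule leads_step[OF _ _ leads_refl]) auto

text \<open>The order behind all bit obstructions: the path finishes bit \<open>j\<close> of window
  \<open>t\<close> before step \<open>t + c\<close> starts to read that bit.\<close>

lemma leads_write_read:
  assumes "live t" "j < n" "leads x (pos0 t (5 + 4 * Suc j) 0)"
  shows "leads x (pos1 t (5 + 4 * j) (2 * level t + 1))"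
proof -
  have "t < T" using assms(1) c_pos by linarith
  moreover have "leads x (pos0 t bits_end 0)" using leads_write[of t x "Suc j" n] assms by simp
  ultimately have "leads x (pos0 (Suc t) 2 0)" by (rule leads_vertical(4))
  then have "leads x (pos0 (t + c) 2 0)" using leads_step[of "Suc t" "t + c" x] assms(1) c_pos by simp
  then show ?thesis using leads_read_start(2)[OF assms(1)] assms(2) by simp
qed

subsection \<open>No output leads astray\<close>

text \<open>The two disjuncts are the two alternatives of \<open>outs\<close> in
  \<open>tree_growth\<close>.\<close>

definition handled :: "pos \<Rightarrow> dir \<Rightarrow> bool" where
  "handled p e \<longleftrightarrow> (\<exists>p'. edge p e p') \<or> leads (neighbour p e) p"

text \<open>Joins what \<open>reach\<close> and \<open>outs\<close> demand at one position, so that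
  a single case analysis over positions serves both.\<close>

definition sound :: "pos \<Rightarrow> bool" where
  "sound p \<longleftrightarrow> leads (pos0 0 2 0) p \<and>
     (\<forall>q d e. F p = Some (q, d) \<longrightarrow> out q e \<noteq> None \<longrightarrow> e \<noteq> opposite d \<longrightarrow> handled p e)"

lemma handled_ed: "edge p e p' \<Longrightarrow> handled p e"
  unfolding handled_def by blast

lemma handled_blocked: "neighbour p e = p' \<Longrightarrow> leads p' p \<Longrightarrow> handled p e"
  unfolding handled_def by blast

lemma soundI:
  assumes "leads (pos0 0 2 0) p" "F p = Some (q, d)"
    and "\<lbrakk>out q East \<noteq> None; d \<noteq> West\<rbrakk> \<Longrightarrow> handled p East"
    and "\<lbrakk>out q West \<noteq> None; d \<noteq> East\<rbrakk> \<Longrightarrow> handled p West"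
    and "\<lbrakk>out q North \<noteq> None; d \<noteq> South\<rbrakk> \<Longrightarrow> handled p North"
    and "\<lbrakk>out q South \<noteq> None; d \<noteq> North\<rbrakk> \<Longrightarrow> handled p South"
    and "\<lbrakk>out q Up \<noteq> None; d \<noteq> Down\<rbrakk> \<Longrightarrow> handled p Up"
    and "\<lbrakk>out q Down \<noteq> None; d \<noteq> Up\<rbrakk> \<Longrightarrow> handled p Down"
  shows "sound p"
  unfolding sound_def
proof (intro conjI allI impI)
  fix q' d' e
  assume "F p = Some (q', d')" "out q' e \<noteq> None" "e \<noteq> opposite d'"
  then show "handled p e" using assms(2-) by (cases e; cases d') auto
qed (rule assms(1))

lemma handled_climb:
  assumes "F (pos0 t w (Suc 0)) = Some (q, d)" "B t + w < N" "t \<le> T"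
    "out q North = climb (level t)" "out q North \<noteq> None" "d \<noteq> South"
  shows "handled (pos0 t w (Suc 0)) North"
  using assms by (intro handled_ed[OF edge_top[OF assms(1)]]) (auto simp: climb_def split: if_splits)

lemma sound1I:
  assumes "leads (pos0 0 2 0) (pos0 t w (Suc 0))" "F (pos0 t w (Suc 0)) = Some (q, d)"
    and "B t + w < N" "t \<le> T" "out q North = climb (level t)"
    and "\<lbrakk>out q East \<noteq> None; d \<noteq> West\<rbrakk> \<Longrightarrow> handled (pos0 t w (Suc 0)) East"
    and "\<lbrakk>out q West \<noteq> None; d \<noteq> East\<rbrakk> \<Longrightarrow> handled (pos0 t w (Suc 0)) West"
    and "\<lbrakk>out q South \<noteq> None; d \<noteq> North\<rbrakk> \<Longrightarrow> handled (pos0 t w (Suc 0)) South"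
    and "\<lbrakk>out q Up \<noteq> None; d \<noteq> Down\<rbrakk> \<Longrightarrow> handled (pos0 t w (Suc 0)) Up"
    and "\<lbrakk>out q Down \<noteq> None; d \<noteq> Up\<rbrakk> \<Longrightarrow> handled (pos0 t w (Suc 0)) Down"
  shows "sound (pos0 t w (Suc 0))"
  using assms by (intro soundI[OF assms(1,2)] handled_climb[OF assms(2-5)]) auto

lemma
  assumes t: "t \<le> T" "c \<le> t"
  shows sound_carry_head: "w \<le> 1 \<Longrightarrow> sound (pos0 t w 0)"
    and sound_begin: "sound (pos0 t 4 0)"
    and sound_gad4: "sound (pos0 t 3 0)"
    and sound_gad5: "sound (pos1 t 3 (2 * level t))"
    and sound_gad6789: "w \<le> 3 \<Longrightarrow> sound (pos1 t w (2 * level t + 1))"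
    and sound_ret_head: "sound (pos0 t 0 (Suc 0))"
    and sound_exit: "p < 4 \<Longrightarrow> sound (pos0 t (Suc p) (Suc 0))"
proof -
  define s where "s = t - c"
  have s: "live s" "s + c = t" using t by (auto simp: s_def)
  note g = leads_seed[OF t(1)] and near = in_window[OF t(1)]
  note r0 = leads_read_start(3)[OF s(1), unfolded s(2)]
  have DW: "5 < D" using D_ge by simp
  \<comment> \<open>The return path leaves through the upper row of column 0 before the carry
    arrives below it, so the carry cannot exit one column too early.\<close>
  have r2: "leads (pos0 t 0 (Suc 0)) (pos0 t 0 0)"
  proof -
    have "leads (pos0 t 0 (Suc 0)) (pos0 s (W - 1) (Suc 0))"
      using leads_ed[OF leads_refl edge_ret_head[OF s(1)]] s(2) by simp
    then have "leads (pos0 t 0 (Suc 0)) (pos1 s 5 (2 * level s + 1))"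
      using leads_return(4)[OF s(1)] W_big by simp
    then have "leads (pos0 t 0 (Suc 0)) (pos1 s bits_end (2 * level s + 1))"
      using leads_read[OF s(1), of _ 0 n] by simp
    then show ?thesis using leads_sum(5)[OF s(1)] s(2) by simp
  qed
  have "sound (pos0 t 0 0)"
  proof (rule soundI[OF r0[OF g] F_carry_head[OF t]])
    show "handled (pos0 t 0 0) East" by (rule handled_ed[OF edge_carry_head[OF t]])
    show "handled (pos0 t 0 0) North" by (rule handled_blocked[OF _ r2]) (simp add: pos0_def)
  qed simp_all
  moreover have "sound (pos0 t 1 0)"
  proof (rule soundI[OF leads_exit(1)[OF t r0[OF g]] F_carry_head[OF t]])
    show "handled (pos0 t 1 0) North" by (rule handled_ed[OF edge_exit[OF t]])
    \<comment> \<open>The wall at work: column 2 was occupied when the step began, so the repetition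
      of \<open>Carry\<close> ends in column 1.\<close>
    show "handled (pos0 t 1 0) East"
      by (rule handled_blocked[OF _ leads_exit(1)[OF t r0[OF leads_refl]]]) (simp add: pos0_def)
  qed simp_all
  ultimately show "sound (pos0 t w 0)" if "w \<le> 1" using that by (cases w) auto
  show "sound (pos0 t 4 0)"
    by (rule soundI[OF leads_exit(3)[OF t r0[OF g]] F_begin[OF t]]; (rule handled_ed[OF edge_begin[OF t(1)]] | simp))
  show "sound (pos0 t 3 0)"
    by (rule soundI[OF leads_gadget(1)[OF t g] F_gad4[OF t]]; (rule handled_ed[OF edge_gad4[OF t]] | simp))
  show "sound (pos1 t 3 (2 * level t))"
    by (rule soundI[OF leads_gadget(2)[OF t g] F_gad5[OF t]]; (rule handled_ed[OF edge_gad5[OF t]] | simp))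
  show "sound (pos1 t w (2 * level t + 1))" if "w \<le> 3"
  proof -
    note r = leads_gadget(3)[OF t g]
    have "sound (pos1 t 3 (2 * level t + 1))"
      by (rule soundI[OF r F_gad6[OF t]]; (rule handled_ed[OF edge_gad6[OF t]] | simp))
    moreover have "sound (pos1 t (Suc v) (2 * level t + 1))" if "v \<le> 1" for v
      by (rule soundI[OF r F_gad789[OF t]]; (rule handled_ed[OF edge_gad78[OF t that]] | use that in \<open>cases v; simp\<close>))
    moreover have "sound (pos1 t 0 (2 * level t + 1))"
      by (rule soundI[OF r F_gad789[OF t]]; (rule handled_ed[OF edge_gad9[OF t]] | simp))
    ultimately show ?thesis using that
      by (metis le_Suc_eq le_zero_eq One_nat_def numeral_2_eq_2 numeral_3_eq_3)
  qed
  show "sound (pos0 t 0 (Suc 0))"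
    by (rule sound1I[OF leads_gadget(4)[OF t g] F_ret_head[OF t] near t(1)];
        (rule handled_ed[OF edge_ret_head[OF s(1), unfolded s(2)]] | use W_big DW in simp))
  show "sound (pos0 t (Suc p) (Suc 0))" if "p < 4"
  proof (rule sound1I[OF leads_exit(2)[OF t r0[OF g] that] F_exit[OF t that] near t(1)])
    show "handled (pos0 t (Suc p) (Suc 0)) East" if "out (Exit (level t) (carry_out t) (digit t) p) East \<noteq> None"
      by (rule handled_ed[OF edge_exit012[OF t]]) (use that in \<open>simp split: if_splits\<close>)
    show "handled (pos0 t (Suc p) (Suc 0)) South" if "out (Exit (level t) (carry_out t) (digit t) p) South \<noteq> None"
    proof -
      have "p = 3" using that by (simp split: if_splits)
      then show ?thesis using handled_ed[OF edge_exit3[OF t]] by simp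
    qed
  qed (use that DW in simp_all)
qed

lemma sound_gad012:
  assumes t: "t \<le> T" "0 < t" "w \<le> 2"
  shows "sound (pos1 t w (2 * level t))"
proof -
  obtain s where s: "t = Suc s" using t(2) by (cases t) auto
  have st: "s < T" "s \<le> T" using t s by auto
  have r: "leads (pos0 0 2 0) (pos1 t v (2 * level t))" if "v \<le> 2" for v
    using leads_vertical(3)[OF st(1) leads_begin(2)[OF st(2) leads_seed[OF st(2)] order_refl] that] s by simp
  have "sound (pos1 t v (2 * level t))" if "v \<le> 1" for v
    by (rule soundI[OF r F_gad012[OF t(1,2)]]; (rule handled_ed[OF edge_gad01[OF t(1,2) that]] | use that in simp))
  moreover have "sound (pos1 t 2 (2 * level t))"
    by (rule soundI[OF r F_gad012[OF t(1,2)]]; (rule handled_ed[OF edge_gad2[OF t(1,2)]] | simp))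
  ultimately show ?thesis using t(3) by (metis le_Suc_eq numeral_2_eq_2 One_nat_def)
qed

lemma sound_gad3: assumes t: "t \<le> T" shows "sound (pos0 t 2 0)"
proof (cases "t < c")
  case True
  show ?thesis
    by (rule soundI[OF leads_seed[OF t] F_init3[OF True]];
        (rule handled_ed[OF edge_gad3[OF t]] handled_ed[OF edge_base[OF True]] handled_ed[OF edge_left_start0[OF True]] | simp))
next
  case False
  then have c: "c \<le> t" by simp
  show ?thesis
    by (rule soundI[OF leads_seed[OF t] F_gad3[OF t c]]; (rule handled_ed[OF edge_gad3[OF t]] | simp))
qed

lemma
  assumes t: "t < c"
  shows sound_init4: "sound (pos0 t 3 0)"
    and sound_init_begin: "sound (pos0 t 4 0)"
    and sound_base: "p \<le> 2 \<Longrightarrow> sound (pos0 t (2 + p) (Suc 0))"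
    and sound_left: "x < B t + 2 \<Longrightarrow> r < 2 \<Longrightarrow> sound (left_pos t x r)"
proof -
  note tT = init_le[OF t]
  note g = leads_seed[OF tT] and near = in_window[OF tT]
  have DW: "5 < D" using D_ge by simp
  show "sound (pos0 t 3 0)"
    by (rule soundI[OF leads_init(1)[OF t g] F_init4[OF t]]; (rule handled_ed[OF edge_init4[OF t]] | simp))
  show "sound (pos0 t 4 0)"
    by (rule soundI[OF leads_init(2)[OF t g] F_init_begin[OF t]]; (rule handled_ed[OF edge_begin[OF tT]] | simp))
  show "sound (pos0 t (2 + p) (Suc 0))" if "p \<le> 2"
  proof (rule sound1I[OF leads_init(3)[OF t g that] F_base[OF t that] near tT])
    show "handled (pos0 t (2 + p) (Suc 0)) East" if "out (Base (level t) p) East \<noteq> None"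
      by (rule handled_ed[OF edge_base01[OF t]]) (use that in \<open>simp split: if_splits\<close>)
    show "handled (pos0 t (2 + p) (Suc 0)) West" if "out (Base (level t) p) West \<noteq> None"
    proof -
      have "p = 0" using that by (simp split: if_splits)
      then show ?thesis using handled_ed[OF edge_left_start1[OF t]] by simp
    qed
  qed (use that DW in simp_all)
  show "sound (left_pos t x r)" if x: "x < B t + 2" and r: "r < 2"
  proof (rule soundI[OF leads_init(4)[OF t g r x] F_left[OF t x r]])
    show "handled (left_pos t x r) West" if o: "out (Tooth x (r = 1 \<and> Suc t = c)) West \<noteq> None"
    proof -
      obtain x' where "x = Suc x'" using o by (cases x) auto
      then show ?thesis using handled_ed[OF edge_left[OF t _ r]] x by simp
    qed
    show "handled (left_pos t x r) North" if "out (Tooth x (r = 1 \<and> Suc t = c)) North \<noteq> None"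
    proof -
      have rc: "r = 1" "Suc t = c" using that by (simp_all split: if_splits)
      have N: "x < N" using near[of 2] x DW by simp
      have "2 * t + r + 1 = 2 * c" using rc by simp
      then show ?thesis
        using edge_North_climb[of x "2 * t + r"] F_left[OF t x r] rc N k_ge
        unfolding left_pos_def by (intro handled_ed) auto
    qed
  qed simp_all
qed

lemma
  assumes t: "t \<le> T" and j: "j < n"
  shows sound_wr0: "sound (pos0 t (5 + 4 * j) 0)"
    and sound_wr11: "sound (pos0 t (5 + 4 * j + 3) 0)"
    and sound_wr1: "bit t j \<Longrightarrow> sound (pos0 t (5 + 4 * j) (Suc 0))"
    and sound_wr2: "bit t j \<Longrightarrow> sound (pos0 t (5 + 4 * j + 1) (Suc 0))"
    and sound_wr35: "sound (pos0 t (5 + 4 * j + 1) 0)"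
    and sound_wr410: "sound (pos0 t (5 + 4 * j + 2) 0)"
    and sound_wr6: "\<not> bit t j \<Longrightarrow> sound (pos1 t (5 + 4 * j + 1) (2 * level t))"
    and sound_wr7: "\<not> bit t j \<Longrightarrow> sound (pos1 t (5 + 4 * j + 1) (2 * level t + 1))"
    and sound_wr8: "\<not> bit t j \<Longrightarrow> sound (pos1 t (5 + 4 * j + 2) (2 * level t + 1))"
    and sound_wr9: "\<not> bit t j \<Longrightarrow> sound (pos1 t (5 + 4 * j + 2) (2 * level t))"
proof -
  note a = t j
  have jn: "j \<le> n" using j by simp
  have win: "B t + (5 + 4 * j) < N" "B t + (5 + 4 * j + 1) < N"
    using in_window[OF t] D_ge j by auto
  note x = leads_begin(2)[OF t leads_seed[OF t] jn]
  note leads = leads_write_bit[OF a x]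
  show "sound (pos0 t (5 + 4 * j) 0)"
    by (cases "bit t j"; rule soundI[OF x F_wr0[OF t jn]]; (rule handled_ed[OF edge_wr0[OF a]] handled_ed[OF edge_wr0'[OF a]], assumption | use j in simp))
  show "sound (pos0 t (5 + 4 * j + 3) 0)"
    by (rule soundI[OF leads(4) F_wr11[OF a]]; (rule handled_ed[OF edge_wr11[OF a]] | simp))
  show "sound (pos0 t (5 + 4 * j) (Suc 0))" if b: "bit t j"
    by (rule sound1I[OF leads(5)[OF b] F_wr1[OF a b] win(1) t]; (rule handled_ed[OF edge_wr1[OF a b]] | simp))
  show "sound (pos0 t (5 + 4 * j + 1) (Suc 0))" if b: "bit t j"
    by (rule sound1I[OF leads(6)[OF b] F_wr2[OF a b] win(2) t]; (rule handled_ed[OF edge_wr2[OF a b]] | simp))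
  show "sound (pos0 t (5 + 4 * j + 1) 0)"
  proof (cases "bit t j")
    case b: True
    show ?thesis by (rule soundI[OF leads(2) F_wr3[OF a b]]; (rule handled_ed[OF edge_wr3[OF a b]] | simp))
  next
    case b: False
    show ?thesis by (rule soundI[OF leads(2) F_wr5[OF a b]]; (rule handled_ed[OF edge_wr5[OF a b]] | simp))
  qed
  show "sound (pos0 t (5 + 4 * j + 2) 0)"
  proof (cases "bit t j")
    case b: True
    show ?thesis by (rule soundI[OF leads(3) F_wr4[OF a b]]; (rule handled_ed[OF edge_wr4[OF a b]] | simp))
  next
    case b: False
    show ?thesis by (rule soundI[OF leads(3) F_wr10[OF a b]]; (rule handled_ed[OF edge_wr10[OF a b]] | simp))
  qed
  show "sound (pos1 t (5 + 4 * j + 1) (2 * level t))" if b: "\<not> bit t j"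
    by (rule soundI[OF leads(7)[OF b] F_wr6[OF a b]]; (rule handled_ed[OF edge_wr6[OF a b]] | simp))
  show "sound (pos1 t (5 + 4 * j + 1) (2 * level t + 1))" if b: "\<not> bit t j"
    by (rule soundI[OF leads(8)[OF b] F_wr7[OF a b]]; (rule handled_ed[OF edge_wr7[OF a b]] | simp))
  show "sound (pos1 t (5 + 4 * j + 2) (2 * level t + 1))" if b: "\<not> bit t j"
    by (rule soundI[OF leads(9)[OF b] F_wr8[OF a b]]; (rule handled_ed[OF edge_wr8[OF a b]] | simp))
  show "sound (pos1 t (5 + 4 * j + 2) (2 * level t))" if b: "\<not> bit t j"
    by (rule soundI[OF leads(10)[OF b] F_wr9[OF a b]]; (rule handled_ed[OF edge_wr9[OF a b]] | simp))
qed

text \<open>Of the two offers made at the start of a bit, the wrong one hits the writer's detour,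
  which is an ancestor by \<open>leads_write_read\<close>.\<close>

lemma
  assumes l: "live t" and j: "j < n"
  shows sound_rd0: "sound (pos1 t (5 + 4 * j) (2 * level t + 1))"
    and sound_rd1: "bit t j \<Longrightarrow> sound (pos1 t (5 + 4 * j + 1) (2 * level t + 1))"
    and sound_rd2: "bit t j \<Longrightarrow> sound (pos1 t (5 + 4 * j + 2) (2 * level t + 1))"
    and sound_rd38: "sound (pos1 t (5 + 4 * j + 3) (2 * level t + 1))"
    and sound_rd4: "\<not> bit t j \<Longrightarrow> sound (pos0 t (5 + 4 * j) (Suc 0))"
    and sound_rd5: "\<not> bit t j \<Longrightarrow> sound (pos0 t (5 + 4 * j + 1) (Suc 0))"
    and sound_rd62: "sound (pos0 t (5 + 4 * j + 2) (Suc 0))"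
    and sound_rd73: "sound (pos0 t (5 + 4 * j + 3) (Suc 0))"
proof -
  note a = l j
  have t: "t \<le> T" and jn: "j \<le> n" using l j by auto
  have win: "B t + (5 + 4 * j) < N" "B t + (5 + 4 * j + 1) < N" "B t + (5 + 4 * j + 2) < N" "B t + (5 + 4 * j + 3) < N"
    using in_window[OF t] D_ge j by auto
  note x = leads_read_start(2)[OF l leads_seed[OF l] jn]
  note leads = leads_read_bit[OF a x]
  have wj: "leads p (pos0 t (5 + 4 * j + 3) 0) \<Longrightarrow> leads p (pos1 t (5 + 4 * j) (2 * level t + 1))" for p
    using leads_write_read[OF a] leads_ed[OF _ edge_wr11[OF t j]] by blast
  show "sound (pos1 t (5 + 4 * j) (2 * level t + 1))"
  proof (cases "bit t j")
    case b: True
    \<comment> \<open>The tile below the reader is the first one of the detour for a 1; the path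
      continues from it to the end of the bit.\<close>
    note step = leads_ed[OF leads_ed[OF leads_ed[OF leads_ed[OF leads_refl
      edge_wr1[OF t j b]] edge_wr2[OF t j b]] edge_wr3[OF t j b]] edge_wr4[OF t j b]]
    show ?thesis
    proof (rule soundI[OF x F_rd0[OF l jn]])
      show "handled (pos1 t (5 + 4 * j) (2 * level t + 1)) Down"
        by (rule handled_blocked[OF _ wj[OF step]]) (simp add: pos0_def pos1_def)
    qed (rule handled_ed[OF edge_rd0[OF a b]] | use j in simp)+
  next
    case b: False
    \<comment> \<open>The tile east of the reader is the top-layer corner of the detour for a
      0.\<close>
    note step = leads_ed[OF leads_ed[OF leads_ed[OF leads_ed[OF leads_refl
      edge_wr7[OF t j b]] edge_wr8[OF t j b]] edge_wr9[OF t j b]] edge_wr10[OF t j b]]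
    show ?thesis
    proof (rule soundI[OF x F_rd0[OF l jn]])
      show "handled (pos1 t (5 + 4 * j) (2 * level t + 1)) East"
        by (rule handled_blocked[OF _ wj[OF step]]) (simp add: pos1_def)
    qed (rule handled_ed[OF edge_rd0'[OF a b]] | use j in simp)+
  qed
  show "sound (pos1 t (5 + 4 * j + 1) (2 * level t + 1))" if b: "bit t j"
    by (rule soundI[OF leads(2)[OF b] F_rd1[OF a b]]; (rule handled_ed[OF edge_rd1[OF a b]] | simp))
  show "sound (pos1 t (5 + 4 * j + 2) (2 * level t + 1))" if b: "bit t j"
    by (rule soundI[OF leads(3)[OF b] F_rd2[OF a b]]; (rule handled_ed[OF edge_rd2[OF a b]] handled_ed[OF edge_leaf2[OF a b]] | simp))
  show "sound (pos1 t (5 + 4 * j + 3) (2 * level t + 1))"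
  proof (cases "bit t j")
    case b: True
    show ?thesis by (rule soundI[OF leads(4) F_rd3[OF a b]]; (rule handled_ed[OF edge_rd3[OF a b]] handled_ed[OF edge_leaf3[OF a b]] | simp))
  next
    case b: False
    show ?thesis by (rule soundI[OF leads(4) F_rd8[OF a b]]; (rule handled_ed[OF edge_rd8[OF a b]] | simp))
  qed
  show "sound (pos0 t (5 + 4 * j) (Suc 0))" if b: "\<not> bit t j"
    by (rule sound1I[OF leads(7)[OF b] F_rd4[OF a b] win(1) t]; (rule handled_ed[OF edge_rd4[OF a b]] | simp))
  show "sound (pos0 t (5 + 4 * j + 1) (Suc 0))" if b: "\<not> bit t j"
    by (rule sound1I[OF leads(8)[OF b] F_rd5[OF a b] win(2) t]; (rule handled_ed[OF edge_rd5[OF a b]] | simp))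
  show "sound (pos0 t (5 + 4 * j + 2) (Suc 0))"
  proof (cases "bit t j")
    case b: True
    show ?thesis by (rule sound1I[OF leads(5)[OF b] F_leaf2[OF t j b] win(3) t]; simp)
  next
    case b: False
    show ?thesis by (rule sound1I[OF leads(9)[OF b] F_rd6[OF a b] win(3) t]; (rule handled_ed[OF edge_rd6[OF a b]] | simp))
  qed
  show "sound (pos0 t (5 + 4 * j + 3) (Suc 0))"
  proof (cases "bit t j")
    case b: True
    show ?thesis by (rule sound1I[OF leads(6)[OF b] F_leaf3[OF t j b] win(4) t]; simp)
  next
    case b: False
    show ?thesis by (rule sound1I[OF leads(10)[OF b] F_rd7[OF a b] win(4) t]; (rule handled_ed[OF edge_rd7[OF a b]] | simp))
  qed
qed

lemma
  assumes l: "live t"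
  shows sound_rdn: "sound (pos1 t bits_end (2 * level t + 1))"
    and sound_sum0: "sound (pos0 t bits_end (Suc 0))"
    and sound_sum1: "sound (pos0 t (bits_end + 1) (Suc 0))"
    and sound_sum2: "sound (pos0 t (bits_end + 1) 0)"
    and sound_carry: "bits_end + 2 \<le> w \<Longrightarrow> w < W \<Longrightarrow> sound (pos0 t w 0)"
    and sound_ret: "bits_end + 2 \<le> w \<Longrightarrow> w < W \<Longrightarrow> sound (pos0 t w (Suc 0))"
    and sound_rise: "sound (pos1 t (bits_end + 2) (2 * level t + 1))"
    and sound_over: "5 \<le> w \<Longrightarrow> w \<le> bits_end + 2 \<Longrightarrow> sound (pos1 t w (2 * level t + 2))"
proof -
  have t: "t \<le> T" using l by simp
  note g = leads_seed[OF l] and near = in_window_live[OF l]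
  note x = leads_read_start(2)[OF l g order_refl]
  note sum = leads_sum[OF l x]
  have W1: "W - 1 < W" "bits_end + 2 \<le> W - 1" "bits_end < W" "bits_end + 1 < W" "bits_end + 2 < W" using W_big by linarith+
  note ret = leads_return[OF l leads_read_start(1)[OF l g] W1(2,1)]
  show "sound (pos1 t bits_end (2 * level t + 1))"
    by (rule soundI[OF x F_rd0[OF l order_refl]]; (rule handled_ed[OF edge_sum_start[OF l]] | simp))
  show "sound (pos0 t bits_end (Suc 0))"
    by (rule sound1I[OF sum(1) F_sum0[OF l] near t]; (rule W1 handled_ed[OF edge_sum0[OF l]] | simp))
  show "sound (pos0 t (bits_end + 1) (Suc 0))"
    by (rule sound1I[OF sum(2) F_sum1[OF l] near t]; (rule W1 handled_ed[OF edge_sum1[OF l]] | simp))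
  show "sound (pos0 t (bits_end + 1) 0)"
    by (rule soundI[OF sum(3) F_sum2[OF l]]; (rule handled_ed[OF edge_sum2[OF l]] | simp))
  show "sound (pos0 t w 0)" if w: "bits_end + 2 \<le> w" "w < W"
  proof (rule soundI[OF sum(4)[OF w] F_carry[OF l w]])
    have "handled (pos0 t w 0) East"
    proof (cases "Suc w < W")
      case True
      then show ?thesis by (rule handled_ed[OF edge_carry[OF l w(1)]])
    next
      case False
      then have "w = W - 1" using w by linarith
      then show ?thesis using handled_ed[OF edge_carry_last[OF l]] by simp
    qed
    then show "handled (pos0 t w 0) East" .
    \<comment> \<open>The return row directly north of the carry was laid before the digit was read,
      so no \<open>Exit\<close> can attach along the way.\<close>
    have "leads (pos0 t w (Suc 0)) (pos1 t 5 (2 * level t + 1))" by (rule leads_return(4)[OF l leads_refl w])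
    then have "leads (pos0 t w (Suc 0)) (pos1 t bits_end (2 * level t + 1))"
      using leads_read[OF l, of _ 0 n] by simp
    then have "leads (pos0 t w (Suc 0)) (pos0 t w 0)" using leads_sum(4)[OF l] w by simp
    then show "handled (pos0 t w 0) North" by (rule handled_blocked[rotated]) (simp add: pos0_def)
  qed simp_all
  show "sound (pos0 t w (Suc 0))" if w: "bits_end + 2 \<le> w" "w < W"
  proof -
    have r: "leads (pos0 0 2 0) (pos0 t w (Suc 0))" by (rule ret(1)) (use w in auto)
    show ?thesis
    proof (cases "w = bits_end + 2")
      case True
      show ?thesis
        by (rule sound1I[OF r F_ret[OF l w] near t]; (rule w | unfold True, rule handled_ed[OF edge_ret_up[OF l]] | simp add: True))
    next
      case False
      then obtain v where v: "w = Suc v" "bits_end + 2 \<le> v" using w by (cases w) auto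
      show ?thesis
        by (rule sound1I[OF r F_ret[OF l w] near t];
            (rule w | unfold v(1), rule handled_ed[OF edge_ret[OF l v(2) w(2)[unfolded v(1)]]] | use v in simp))
    qed
  qed
  show "sound (pos1 t (bits_end + 2) (2 * level t + 1))"
    by (rule soundI[OF ret(2) F_rise[OF l]]; (rule handled_ed[OF edge_rise[OF l]] | simp))
  show "sound (pos1 t w (2 * level t + 2))" if w: "5 \<le> w" "w \<le> bits_end + 2"
  proof (cases "w = 5")
    case True
    show ?thesis
      by (rule soundI[OF ret(3)[OF w] F_over[OF l w]]; (unfold True, rule handled_ed[OF edge_over5[OF l]] | simp add: True))
  next
    case False
    then obtain v where v: "w = Suc v" "5 \<le> v" "v \<le> bits_end + 1" using w by (cases w) auto
    show ?thesis
      by (rule soundI[OF ret(3)[OF w] F_over[OF l w]];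
          (unfold v(1), rule handled_ed[OF edge_over[OF l v(2,3)]] | use v in simp))
  qed
qed

lemma
  assumes t: "t \<le> T"
  shows sound_wrn: "sound (pos0 t bits_end 0)"
    and sound_run: "bits_end \<le> w \<Longrightarrow> w + 1 < D \<Longrightarrow> sound (pos1 t w (2 * level t))"
proof -
  note x = leads_begin(2)[OF t leads_seed[OF t] order_refl]
  show "sound (pos0 t bits_end 0)"
    by (rule soundI[OF x F_wr0[OF t order_refl]]; (rule handled_ed[OF edge_run_start[OF t]] | simp))
  show "sound (pos1 t w (2 * level t))" if w: "bits_end \<le> w" "w + 1 < D"
  proof (rule soundI[OF leads_run[OF t x w] F_run[OF t w]])
    show "handled (pos1 t w (2 * level t)) East"
    proof (cases "w + 2 < D")
      case True
      then show ?thesis by (rule handled_ed[OF edge_run[OF t w(1)]])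
    next
      case False
      then have "w = D - 2" using w by linarith
      then show ?thesis using handled_ed[OF edge_fin_start] handled_ed[OF edge_ver_start[of t]] t
        by (cases "t = T") auto
    qed
  qed simp_all
qed

lemma sound_vertical:
  assumes t: "t < T" and y: "2 * level t \<le> y \<and> y \<le> 2 * level (Suc t) \<or> 2 * level (Suc t) \<le> y \<and> y \<le> 2 * level t"
  shows "sound (pos1 t (D - 1) y)"
proof -
  have tT: "t \<le> T" using t by simp
  note x = leads_begin(2)[OF tT leads_seed[OF tT] order_refl]
  have r: "leads (pos0 0 2 0) (pos1 t (D - 1) y)" using leads_vertical(1,2)[OF t x] y by blast
  have F: "\<exists>d. F (pos1 t (D - 1) y) = Some (Vertical (level (Suc t)) (mode_in (Suc t)) y, d)"
    using F_ver_start[OF t] F_ver_north[OF t, of y] F_ver_south[OF t, of y] y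
    by (cases "y = 2 * level t") auto
  then obtain d where F: "F (pos1 t (D - 1) y) = Some (Vertical (level (Suc t)) (mode_in (Suc t)) y, d)" ..
  show ?thesis
  proof (rule soundI[OF r F])
    show "handled (pos1 t (D - 1) y) East" if "out (Vertical (level (Suc t)) (mode_in (Suc t)) y) East \<noteq> None"
    proof -
      have "y = 2 * level (Suc t)" using that by (simp split: if_splits)
      then show ?thesis using handled_ed[OF edge_ver_east[OF t]] by simp
    qed
    show "handled (pos1 t (D - 1) y) North" if "out (Vertical (level (Suc t)) (mode_in (Suc t)) y) North \<noteq> None"
    proof -
      have "y < 2 * level (Suc t)" using that by (simp split: if_splits)
      then show ?thesis using handled_ed[OF edge_ver_north[OF t]] y by auto
    qed
    show "handled (pos1 t (D - 1) y) South" if "out (Vertical (level (Suc t)) (mode_in (Suc t)) y) South \<noteq> None"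
    proof -
      have a: "2 * level (Suc t) < y" using that by (simp split: if_splits)
      then obtain v where "y = Suc v" by (cases y) auto
      then show ?thesis using handled_ed[OF edge_ver_south[OF t, of v]] y a by auto
    qed
  qed simp_all
qed

lemma leads_fin: "leads (pos0 0 2 0) (pos1 T (D - 1) (2 * (c - 1)))"
  by (rule leads_ed[OF leads_run[OF order_refl leads_begin(2)[OF order_refl leads_seed[OF order_refl] order_refl]] edge_fin_start])
    (use D_ge in auto)

lemma sound_fin: "sound (pos1 T (D - 1) (2 * (c - 1)))"
  by (rule soundI[OF leads_fin F_fin]; (rule handled_ed[OF edge_fin] | simp))

lemma leads_sp: assumes "y < 2 * c" shows "leads (pos0 0 2 0) (spine_pos y)"
proof -
  note 1 = leads_ed[OF leads_fin edge_fin]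
  show ?thesis
  proof (cases "y \<le> 2 * (c - 1)")
    case True
    show ?thesis
    proof (rule leads_down[where f = spine_pos and a = 0, OF 1 _ _ True])
      show "\<exists>e. edge (spine_pos (Suc w)) e (spine_pos w)" if "w < 2 * (c - 1)" for w
      proof -
        have "Suc (Suc w) < 2 * c" using that by linarith
        then show ?thesis using edge_spine_south by blast
      qed
    qed simp
  next
    case False
    then have "y = Suc (2 * (c - 1))" using assms by linarith
    then show ?thesis using leads_ed[OF 1 edge_spine_north] by simp
  qed
qed

lemma
  assumes i: "i < c"
  shows sound_last0: "bits_end < w \<Longrightarrow> w + 1 < (c - i) * D \<Longrightarrow> sound (pos0 (last_step i) w 0)"
    and sound_last1: "5 \<le> w \<Longrightarrow> w + 1 < (c - i) * D \<Longrightarrow> sound (pos0 (last_step i) w (Suc 0))"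
proof -
  have sub: "w < (c - i) * D - 2 \<longleftrightarrow> w + 2 < (c - i) * D" "w \<le> (c - i) * D - 2 \<longleftrightarrow> w + 1 < (c - i) * D" for w
    using D_le_last[OF i] D_ge by linarith+
  have s: "2 * i < 2 * c" "2 * i + 1 < 2 * c" using i by auto
  have r0: "leads (pos0 0 2 0) (pos0 (last_step i) w 0)" if "bits_end < w" "w + 1 < (c - i) * D" for w
  proof (rule leads_down[where f = "\<lambda>w. pos0 (last_step i) w 0" and a = "Suc bits_end",
        OF leads_ed[OF leads_sp[OF s(1)] edge_last0_start[OF i]]])
    show "\<exists>e. edge (pos0 (last_step i) (Suc v) 0) e (pos0 (last_step i) v 0)"
      if "Suc bits_end \<le> v" "v < (c - i) * D - 2" for v
      using edge_last0[OF i, of v] that sub by auto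
  qed (use that sub in auto)
  have r1: "leads (pos0 0 2 0) (pos0 (last_step i) w (Suc 0))" if "5 \<le> w" "w + 1 < (c - i) * D" for w
  proof (rule leads_down[where f = "\<lambda>w. pos0 (last_step i) w (Suc 0)" and a = 5,
        OF leads_ed[OF leads_sp[OF s(2)] edge_last1_start[OF i]]])
    show "\<exists>e. edge (pos0 (last_step i) (Suc v) (Suc 0)) e (pos0 (last_step i) v (Suc 0))"
      if "5 \<le> v" "v < (c - i) * D - 2" for v
      using edge_last1[OF i, of v] that sub by auto
  qed (use that sub in auto)
  show "sound (pos0 (last_step i) w 0)" if w: "bits_end < w" "w + 1 < (c - i) * D"
  proof (rule soundI[OF r0[OF w] F_last_tooth0[OF i w]])
    show "handled (pos0 (last_step i) w 0) West" if o: "out (Tooth (w - bits_end - 1) False) West \<noteq> None"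
    proof -
      obtain v where "w = Suc v" "bits_end < v" using o w(1) by (cases w) (auto split: if_splits)
      then show ?thesis using handled_ed[OF edge_last0[OF i, of v]] w by simp
    qed
  qed simp_all
  show "sound (pos0 (last_step i) w (Suc 0))" if w: "5 \<le> w" "w + 1 < (c - i) * D"
  proof (rule sound1I[OF r1[OF w] F_last_tooth1[OF i w]])
    show "handled (pos0 (last_step i) w (Suc 0)) West" if o: "out (Tooth (w - 5) (Suc i = c)) West \<noteq> None"
    proof -
      obtain v where "w = Suc v" "5 \<le> v" using o w(1) by (cases w) (auto split: if_splits)
      then show ?thesis using handled_ed[OF edge_last1[OF i, of v]] w by simp
    qed
  qed (use w last_step[OF i] in \<open>auto simp: climb_def\<close>)
qed

lemma sound_sp: assumes y: "y < 2 * c" shows "sound (spine_pos y)"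
proof (rule soundI[OF leads_sp[OF y] F_sp[OF y]])
  show "handled (spine_pos y) West"
  proof -
    have i: "y div 2 < c" using y by auto
    consider "y = 2 * (y div 2)" | "y = 2 * (y div 2) + 1" by linarith
    then show ?thesis
      by cases (metis handled_ed edge_last0_start[OF i], metis handled_ed edge_last1_start[OF i])
  qed
  show "handled (spine_pos y) North" if "out (Spine y) North \<noteq> None"
  proof (cases "y + 1 = 2 * c")
    case True
    have "F (int (N - 1), int y, 0) = Some (Spine y, North)"
      using F_sp[OF y] True by (simp add: spine_pos_def spine_dir_def)
    then show ?thesis using True N_pos k_ge unfolding spine_pos_def
      by (intro handled_ed[OF edge_North_climb]) auto
  next
    case False
    then have "y = 2 * (c - 1)" using that by (simp split: if_splits)
    then show ?thesis using handled_ed[OF edge_spine_north] by simp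
  qed
  show "handled (spine_pos y) South" if "out (Spine y) South \<noteq> None"
  proof -
    have a: "0 < y" "y + 1 < 2 * c" using that by (simp_all split: if_splits)
    then obtain v where "y = Suc v" by (cases y) auto
    then show ?thesis using handled_ed[OF edge_spine_south[of v]] a by simp
  qed
qed simp_all

section \<open>Every position of the assembly is sound\<close>

lemma bit_index:
  assumes "5 \<le> w" "w < bits_end"
  obtains j \<rho> where "j < n" "\<rho> < 4" "w = 5 + 4 * j + \<rho>"
proof
  show "(w - 5) div 4 < n" "(w - 5) mod 4 < 4" "w = 5 + 4 * ((w - 5) div 4) + (w - 5) mod 4"
    using assms by auto
qed

lemma sound_pos0_0:
  assumes t: "t \<le> T" and w: "w < W" "B t + w < N"
  shows "sound (pos0 t w 0)"
proof -
  consider "w \<le> 1" | "w = 2" | "w = 3" | "w = 4" | "5 \<le> w" "w < bits_end" | "w = bits_end" | "bits_end < w" by linarith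
  then show ?thesis
  proof cases
    case 1
    show ?thesis
    proof (cases "t < c")
      case True
      then have "pos0 t w 0 = left_pos t (B t + w) 0" by (simp add: pos0_def left_pos_def)
      then show ?thesis using sound_left[OF True, of "B t + w" 0] 1 by simp
    qed (use sound_carry_head[OF t] 1 in simp)
  next
    case 5
    then obtain j \<rho> where j: "j < n" "\<rho> < 4" "w = 5 + 4 * j + \<rho>" by (rule bit_index)
    then have "\<rho> = 0 \<or> \<rho> = 1 \<or> \<rho> = 2 \<or> \<rho> = 3" by linarith
    then show ?thesis
      using sound_wr0[OF t j(1)] sound_wr11[OF t j(1)] sound_wr35[OF t j(1)] sound_wr410[OF t j(1)] j(3)
      by (elim disjE) (simp_all only: add_0_right)
  next
    case 7
    show ?thesis
    proof (cases "live t")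
      case True
      then show ?thesis using sound_sum2[OF True] sound_carry[OF True, of w] w 7
        by (cases "w = bits_end + 1") auto
    next
      case False
      define i where "i = level t"
      have i: "i < c" "t = last_step i" using last_step_eq[OF t False] mod_c by (auto simp: i_def)
      have lt: "w < (c - i) * D" using w(2) unfolding i(2) last_step(4)[OF i(1), symmetric] by simp
      show ?thesis
      proof (cases "w + 1 < (c - i) * D")
        case True
        then show ?thesis using sound_last0[OF i(1) 7] i(2) by simp
      next
        case False
        then have "w = (c - i) * D - 1" using lt by linarith
        then show ?thesis using sound_sp[of "2 * i"] spine_pos_q0[OF i(1), of 0] i by simp
      qed
    qed
  qed (use t sound_gad3 sound_wrn sound_init4 sound_gad4 sound_init_begin sound_begin
      in \<open>cases "t < c"; simp\<close>)+
qed

lemma sound_pos0_1: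
  assumes t: "t \<le> T" and w: "w < W" "B t + w < N"
  shows "sound (pos0 t w (Suc 0))"
proof -
  have last: "sound (pos0 t w (Suc 0))" if w5: "5 \<le> w" and "\<not> live t"
  proof -
    define i where "i = level t"
    have i: "i < c" "t = last_step i" using last_step_eq[OF t that(2)] mod_c by (auto simp: i_def)
    have lt: "w < (c - i) * D" using w(2) unfolding i(2) last_step(4)[OF i(1), symmetric] by simp
    show ?thesis
    proof (cases "w + 1 < (c - i) * D")
      case True
      then show ?thesis using sound_last1[OF i(1) w5] i(2) by simp
    next
      case False
      then have "w = (c - i) * D - 1" using lt by linarith
      then show ?thesis using sound_sp[of "2 * i + 1"] spine_pos_q0[OF i(1), of "Suc 0"] i by simp
    qed
  qed
  consider "w < 5" "t < c" | "w < 5" "c \<le> t" | "5 \<le> w" "\<not> live t"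
    | "5 \<le> w" "w < bits_end" "live t" | "bits_end \<le> w" "live t" by linarith
  then show ?thesis
  proof cases
    case 1
    show ?thesis
    proof (cases "w < 2")
      case True
      have "pos0 t w (Suc 0) = left_pos t (B t + w) (Suc 0)" using 1 by (simp add: pos0_def left_pos_def)
      then show ?thesis using sound_left[OF 1(2), of "B t + w" "Suc 0"] True by simp
    next
      case False
      then have "w = 2 + (w - 2)" by simp
      then show ?thesis using sound_base[OF 1(2), of "w - 2"] 1 by simp
    qed
  next
    case 2
    then show ?thesis using sound_ret_head[OF t 2(2)] sound_exit[OF t 2(2), of "w - 1"] by (cases w) auto
  next
    case 3
    then show ?thesis by (rule last)
  next
    case 4
    obtain j \<rho> where j: "j < n" "\<rho> < 4" "w = 5 + 4 * j + \<rho>" by (rule bit_index[OF 4(1,2)])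
    then have "\<rho> = 0 \<or> \<rho> = 1 \<or> \<rho> = 2 \<or> \<rho> = 3" by linarith
    moreover have "sound (pos0 t (5 + 4 * j) (Suc 0))" "sound (pos0 t (5 + 4 * j + 1) (Suc 0))"
      using sound_wr1[OF t j(1)] sound_rd4[OF 4(3) j(1)] sound_wr2[OF t j(1)] sound_rd5[OF 4(3) j(1)] by blast+
    ultimately show ?thesis
      using sound_rd62[OF 4(3) j(1)] sound_rd73[OF 4(3) j(1)] j(3)
      by (elim disjE) (simp_all only: add_0_right)
  next
    case 5
    then consider "w = bits_end" | "w = bits_end + 1" | "bits_end + 2 \<le> w" by linarith
    then show ?thesis using sound_sum0 sound_sum1 sound_ret w 5 by cases auto
  qed
qed

lemma sound_pos1:
  assumes t: "t \<le> T" and w: "w < D" and y: "y < k" and s: "F (pos1 t w y) = Some s"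
  shows "sound (pos1 t w y)"
proof -
  have c1: "cell1 t w y = Some s" using F_pos1[OF t w y] s by simp
  consider "w + 1 = D" | "w + 1 \<noteq> D" "w < 5" | "w + 1 \<noteq> D" "5 \<le> w" "w < bits_end" | "w + 1 \<noteq> D" "bits_end \<le> w"
    by linarith
  then show ?thesis
  proof cases
    case 1
    then have wD: "w = D - 1" by simp
    show ?thesis
    proof (cases "t = T")
      case True
      then have "y = 2 * (c - 1)" using c1 1 T_dg by (simp add: cell1_def Let_def split: if_splits)
      then show ?thesis using sound_fin True wD by simp
    next
      case False
      then have tT: "t < T" using t by simp
      have "2 * level t \<le> y \<and> y \<le> 2 * level (Suc t) \<or> 2 * level (Suc t) \<le> y \<and> y \<le> 2 * level t"
        using c1 1 False by (auto simp: cell1_def Let_def split: if_splits)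
      then show ?thesis using sound_vertical[OF tT] wD by simp
    qed
  next
    case 2
    have "y = 2 * level t \<and> w \<le> 2 \<and> 0 < t \<or> y = 2 * level t \<and> w = 3 \<and> c \<le> t \<or> y = 2 * level t + 1 \<and> w \<le> 3 \<and> c \<le> t"
      using c1 2 by (auto simp: cell1_def Let_def split: if_splits)
    then show ?thesis
      using sound_gad012[OF t] sound_gad5[OF t] sound_gad6789[OF t] by (elim disjE conjE) auto
  next
    case 3
    obtain j \<rho> where j: "j < n" "\<rho> < 4" "w = 5 + 4 * j + \<rho>" by (rule bit_index[OF 3(2,3)])
    then have \<rho>: "\<rho> = 0 \<or> \<rho> = 1 \<or> \<rho> = 2 \<or> \<rho> = 3" by linarith
    have y3: "y = 2 * level t \<or> y = 2 * level t + 1 \<or> y = 2 * level t + 2 \<and> live t"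
      using c1 3 by (auto simp: cell1_def Let_def split: if_splits)
    show ?thesis
    proof (cases "y = 2 * level t + 2 \<and> live t")
      case True
      then show ?thesis using sound_over[of t w] 3 by simp
    next
      case False
      note wr = sound_wr6[OF t j(1)] sound_wr7[OF t j(1)] sound_wr8[OF t j(1)] sound_wr9[OF t j(1)]
      note rd = sound_rd0[OF _ j(1), of t] sound_rd1[OF _ j(1), of t] sound_rd2[OF _ j(1), of t] sound_rd38[OF _ j(1), of t]
      consider "y = 2 * level t" "bits1 t j \<rho> 0 = Some s" | "y = 2 * level t + 1" "bits1 t j \<rho> 1 = Some s"
        using y3 False c1 cell1_bits[OF j, of 0 y t] cell1_bits[OF j, of 1 y t] by auto
      then show ?thesis
      proof cases
        case 1
        then have "\<not> bit t j \<and> (\<rho> = 1 \<or> \<rho> = 2)" by (auto simp: bits1_def Let_def split: if_splits)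
        then show ?thesis using wr 1(1) j(3) by (elim conjE disjE) (simp_all only: simp_thms)
      next
        case 2
        then have "\<not> bit t j \<and> (\<rho> = 1 \<or> \<rho> = 2) \<or> live t \<and> (bit t j \<or> \<rho> = 0 \<or> \<rho> = 3)"
          using \<rho> by (auto simp: bits1_def Let_def split: if_splits)
        then show ?thesis using wr rd 2(1) j(3) \<rho> by (elim conjE disjE) (simp_all only: simp_thms add_0_right)
      qed
    qed
  next
    case 4
    then consider "y = 2 * level t" | "y = 2 * level t + 1" "live t" "w = bits_end \<or> w = bits_end + 2"
      | "y = 2 * level t + 2" "live t" "w \<le> bits_end + 2"
      using c1 by (auto simp: cell1_def Let_def split: if_splits)
    then show ?thesis
    proof cases
      case 1
      then show ?thesis using sound_run[OF t 4(2)] 4 w by simp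
    next
      case 2
      then show ?thesis using sound_rdn[OF 2(2)] sound_rise[OF 2(2)] by (elim disjE) (simp_all only:)
    next
      case 3
      then show ?thesis using sound_over[OF 3(2), of w] 4 by simp
    qed
  qed
qed

text \<open>The inverse of the window coordinates: steps with equal rows differ by multiples of
  \<open>c\<close>, so division by \<open>W\<close> finds the window, except in the padding.\<close>

lemma bottom_cases:
  assumes "x < N" "y < 2 * c"
  obtains "x < B (y div 2)" "(int x, int y, 0) = left_pos (y div 2) x (y mod 2)"
  | t w where "t \<le> T" "w < W" "B t + w < N" "(int x, int y, 0) = pos0 t w (y mod 2)" "level t = y div 2"
      "F (int x, int y, 0) = Some (cell0 t w (y mod 2))"
proof (cases "x < B (y div 2)")
  case True
  then show thesis by (rule that(1)) (simp add: left_pos_def)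
next
  case False
  define i u where "i = y div 2" and "u = x - B i"
  define t w where "t = u div W * c + i" and "w = u mod W"
  have i: "i < c" using assms(2) by (auto simp: i_def)
  then have level: "level t = i" by (simp add: t_def)
  have "B t = B i + u div W * W" by (simp add: t_def B_def algebra_simps)
  moreover have "u div W * W + w = u" unfolding w_def by (rule div_mult_mod_eq)
  moreover have "B i + u = x" using False by (simp add: u_def i_def)
  ultimately have x: "B t + w = x" by linarith
  have w: "w < W" using W_pos by (simp add: w_def)
  have "t * D < (T + 1) * D" using assms(1) x unfolding N_eq B_def by simp
  then have t: "t \<le> T" unfolding mult_less_cancel2 by simp
  have p: "(int x, int y, 0) = pos0 t w (y mod 2)"
    using x by (auto simp: pos0_def level i_def)
  show thesis
  proof (rule that(2)[OF t w _ p])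
    show "B t + w < N" "level t = y div 2" using x assms(1) level by (auto simp: i_def)
    then show "F (int x, int y, 0) = Some (cell0 t w (y mod 2))"
      unfolding p by (intro F_pos0) (use w in auto)
  qed
qed

lemma sound_bottom: assumes "x < N" "y < 2 * c" shows "sound (int x, int y, 0)"
  using assms
proof (cases rule: bottom_cases)
  case 1
  have "y div 2 < c" using assms by auto
  then show ?thesis unfolding 1(2) using 1(1) by (intro sound_left) auto
next
  case (2 t w)
  have "y mod 2 = 0 \<or> y mod 2 = Suc 0" by auto
  then show ?thesis unfolding 2(4) using sound_pos0_0[OF 2(1-3)] sound_pos0_1[OF 2(1-3)] by auto
qed

text \<open>Whatever the counter does, each tile in row \<open>2 * c - 1\<close> of the bottom layer
  starts a column into the rows above. It must not have been attached southward, since its north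
  side would then be its input.\<close>

lemma cell0_top:
  assumes "Suc (level t) = c" "cell0 t w (Suc 0) = (q, d)"
  shows "out q North = Some (Climb (2 * c))" "d \<noteq> South"
proof -
  have cl: "climb (level t) = Some (Climb (2 * c))" using assms(1) by (simp add: climb_def)
  have sd: "spine_dir (2 * level t + 1) = North" "Suc (Suc (2 * level t)) = 2 * c"
    using assms(1) by (auto simp: spine_dir_def)
  have "(w - 5) mod 4 < 4" by simp
  then have \<rho>: "4 \<le> (w - 5) mod 4 + 4 \<and> (w - 5) mod 4 + 4 \<le> 7" by linarith
  show "out q North = Some (Climb (2 * c))" "d \<noteq> South"
    using assms cl sd \<rho>
    by (auto simp: cell0_def head0_def bits0_def tail0_def Let_def split: if_splits)
qed

lemma sound_climb:
  assumes "x < N" "2 * c \<le> y" "y < k" shows "sound (int x, int y, 0)"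
proof -
  define y0 where "y0 = 2 * c - 1"
  have y0: "y0 < 2 * c" "y0 + 1 = 2 * c" "y0 div 2 = c - 1" "y0 mod 2 = Suc 0"
    using c_pos unfolding y0_def by (auto, presburger)
  have "edge (int x, int y0, 0) North (int x, int (y0 + 1), 0)"
    using assms(1) y0(1)
  proof (cases rule: bottom_cases)
    case 1
    have "F (int x, int y0, 0) = Some (Tooth x True, West)"
      unfolding 1(2) using F_left[of "c - 1" x "Suc 0"] 1(1) y0 c_pos by simp
    then show ?thesis using y0 assms k_ge by (intro edge_North_climb) auto
  next
    case (2 t w)
    obtain q d where qd: "cell0 t w (Suc 0) = (q, d)" by force
    have "Suc (level t) = c" using 2(5) y0(3) c_pos by simp
    from cell0_top[OF this qd] 2(6) qd y0 show ?thesis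
      using assms k_ge by (intro edge_North_climb[of x y0 q d]) auto
  qed
  moreover have "leads (pos0 0 2 0) (int x, int y0, 0)"
    using sound_bottom[OF assms(1) y0(1)] by (simp add: sound_def)
  ultimately have "leads (pos0 0 2 0) (int x, int (2 * c), 0)" using leads_ed y0(2) by metis
  then have r: "leads (pos0 0 2 0) (int x, int y, 0)"
  proof (rule leads_up[where f = "\<lambda>y. (int x, int y, 0)" and m = y, OF _ _ assms(2) order_refl])
    show "\<exists>e. edge (int x, int v, 0) e (int x, int (Suc v), 0)" if "2 * c \<le> v" "v < y" for v
      using edge_climb[OF assms(1) that(1)] that assms(3) by auto
  qed
  show ?thesis
  proof (rule soundI[OF r F_climb[OF assms]])
    show "handled (int x, int y, 0) North" if "out (Climb y) North \<noteq> None"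
      by (rule handled_ed[OF edge_climb[OF assms(1,2)]]) (use that in \<open>simp split: if_splits\<close>)
  qed simp_all
qed

lemma F_dom: "F (x, y, z) = Some s \<Longrightarrow> 0 \<le> x \<and> x < int N \<and> 0 \<le> y \<and> y < int k \<and> (z = 0 \<or> z = 1)"
  by (auto simp: F_def split: if_splits)

lemma sound_dom: assumes "F p = Some s" shows "sound p"
proof -
  obtain x y z where p0: "p = (x, y, z)" by (cases p) auto
  from F_dom[of x y z s] assms p0 obtain x' y' where p: "p = (int x', int y', z)" "x' < N" "y' < k" "z = 0 \<or> z = 1"
    using zero_le_imp_eq_int by (metis of_nat_less_iff)
  show ?thesis
  proof (cases "z = 0")
    case True
    then show ?thesis using sound_bottom[OF p(2)] sound_climb[OF p(2)] p by (cases "y' < 2 * c") auto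
  next
    case False
    then have z: "z = 1" using p by simp
    then have l: "\<not> x' < off" using assms p by (auto simp: F_def layer1_def split: if_splits)
    define t w where "t = (x' - off) div D" and "w = (x' - off) mod D"
    have w: "w < D" using D_pos by (simp add: w_def)
    have x: "B t + w = x'" using l by (simp add: B_def t_def w_def)
    then have "t * D < (T + 1) * D" using p(2) unfolding N_eq B_def by simp
    then have t: "t \<le> T" unfolding mult_less_cancel2 by simp
    have "p = pos1 t w y'" using p x z by (simp add: pos1_def)
    then show ?thesis using sound_pos1[OF t w p(3)] assms by simp
  qed
qed

subsection \<open>The number of tile types\<close>

text \<open>\<open>off + W\<close> dominates the arguments that count columns and
  \<open>2 ^ n\<close> the digit values.\<close>

definition size_bound :: nat where "size_bound = off + W + 2 ^ n + 2"

text \<open>The essential bounds are those on \<open>u\<close> in \<open>Read\<close> and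
  \<open>Write\<close>: the reader knows \<open>j\<close> bits and the writer has
  \<open>n - j\<close> bits left. With \<open>2 ^ n\<close> in their place the number of tile types
  would gain a factor \<open>n\<close>. Sub-steps \<open>p\<close> never exceed 11.\<close>

fun valid :: "state \<Rightarrow> bool" where
  "valid (Climb y) \<longleftrightarrow> y < k"
| "valid (Tooth l b) \<longleftrightarrow> l < size_bound"
| "valid (Leaf i) \<longleftrightarrow> i < k"
| "valid (Gadget i \<mu> p) \<longleftrightarrow> i < k \<and> p < 12"
| "valid (Base i p) \<longleftrightarrow> i < k \<and> p < 12"
| "valid (Ret i b l) \<longleftrightarrow> i < k \<and> l < size_bound"
| "valid (Rise i b) \<longleftrightarrow> i < k"
| "valid (Over i b w) \<longleftrightarrow> i < k \<and> w < size_bound"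
| "valid (Read i b j u p) \<longleftrightarrow> i < k \<and> j \<le> n \<and> u < 2 ^ j \<and> p < 12"
| "valid (Sum i b u p) \<longleftrightarrow> i < k \<and> u < size_bound \<and> p < 12"
| "valid (Carry i b u) \<longleftrightarrow> i < k \<and> u < size_bound"
| "valid (Exit i b u p) \<longleftrightarrow> i < k \<and> u < size_bound \<and> p < 12"
| "valid (Begin i \<mu> u) \<longleftrightarrow> i < k \<and> u < size_bound"
| "valid (Write i \<mu> j u p) \<longleftrightarrow> i < k \<and> j \<le> n \<and> u < 2 ^ (n - j) \<and> p < 12"
| "valid (Run i \<mu> w) \<longleftrightarrow> i < k \<and> w < size_bound"
| "valid (Vertical i \<mu> y) \<longleftrightarrow> i < k \<and> y < size_bound"
| "valid Finish \<longleftrightarrow> True"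
| "valid (Spine y) \<longleftrightarrow> y < k"

definition small :: "(nat \<times> bool option \<times> nat) set" where "small = {..<k} \<times> UNIV \<times> {..<12}"

text \<open>All constructors except \<open>Read\<close> and \<open>Write\<close> fit one pattern, a
  triple with few values and one long counter. Missing arguments are ignored, and a flag is coded as
  \<open>\<mu> = Some True\<close>.\<close>

definition families :: "(nat \<times> bool option \<times> nat \<Rightarrow> nat \<Rightarrow> state) set" where
  "families = {\<lambda>(i, \<mu>, p) l. Climb i, \<lambda>(i, \<mu>, p) l. Tooth l (\<mu> = Some True), \<lambda>(i, \<mu>, p) l. Leaf i,
     \<lambda>(i, \<mu>, p) l. Gadget i \<mu> p, \<lambda>(i, \<mu>, p) l. Base i p, \<lambda>(i, \<mu>, p) l. Ret i (\<mu> = Some True) l,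
     \<lambda>(i, \<mu>, p) l. Rise i (\<mu> = Some True), \<lambda>(i, \<mu>, p) l. Over i (\<mu> = Some True) l,
     \<lambda>(i, \<mu>, p) l. Sum i (\<mu> = Some True) l p, \<lambda>(i, \<mu>, p) l. Carry i (\<mu> = Some True) l,
     \<lambda>(i, \<mu>, p) l. Exit i (\<mu> = Some True) l p, \<lambda>(i, \<mu>, p) l. Begin i \<mu> l,
     \<lambda>(i, \<mu>, p) l. Run i \<mu> l, \<lambda>(i, \<mu>, p) l. Vertical i \<mu> l, \<lambda>(i, \<mu>, p) l. Finish, \<lambda>(i, \<mu>, p) l. Spine i}"

definition states :: "state set" where
  "states = (\<Union>g\<in>families. (\<lambda>(s, l). g s l) ` (small \<times> {..<size_bound}))
     \<union> (\<lambda>((i, \<mu>, p), (j, u)). Read i (\<mu> = Some True) j u p) ` (small \<times> (SIGMA j:{..n}. {..<2 ^ j}))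
     \<union> (\<lambda>((i, \<mu>, p), (j, u)). Write i \<mu> j u p) ` (small \<times> (SIGMA j:{..n}. {..<2 ^ (n - j)}))"

lemma in_states:
  assumes "g \<in> families" "i < k" "p < 12" "l < size_bound"
  shows "g (i, \<mu>, p) l \<in> states"
  using assms unfolding states_def small_def by (intro UnI1 UN_I[of g]) (auto intro!: image_eqI[of _ _ "((i, \<mu>, p), l)"])

lemma valid_states: assumes "valid s" shows "s \<in> states"
proof -
  have k0: "0 < k" and L0: "0 < size_bound" using k_ge by (auto simp: size_bound_def)
  show ?thesis
  proof (cases s)
    case (Read i b j u p)
    then show ?thesis using assms unfolding states_def small_def
      by (intro UnI1 UnI2 image_eqI[of _ _ "((i, Some b, p), (j, u))"]) auto
  next
    case (Write i \<mu> j u p)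
    then show ?thesis using assms unfolding states_def small_def
      by (intro UnI2 image_eqI[of _ _ "((i, \<mu>, p), (j, u))"]) auto
  next
    case (Climb y)
    then show ?thesis using assms in_states[of "\<lambda>(i, \<mu>, p) l. Climb i" y 0 0] L0 by (simp add: families_def)
  next
    case (Tooth l b)
    then show ?thesis using assms in_states[of "\<lambda>(i, \<mu>, p) l. Tooth l (\<mu> = Some True)" 0 0 l "Some b"] k0
      by (simp add: families_def)
  next
    case (Leaf i)
    then show ?thesis using assms in_states[of "\<lambda>(i, \<mu>, p) l. Leaf i" i 0 0] L0 by (simp add: families_def)
  next
    case (Gadget i \<mu> p)
    then show ?thesis using assms in_states[of "\<lambda>(i, \<mu>, p) l. Gadget i \<mu> p" i p 0 \<mu>] L0 by (simp add: families_def)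
  next
    case (Base i p)
    then show ?thesis using assms in_states[of "\<lambda>(i, \<mu>, p) l. Base i p" i p 0] L0 by (simp add: families_def)
  next
    case (Ret i b l)
    then show ?thesis using assms in_states[of "\<lambda>(i, \<mu>, p) l. Ret i (\<mu> = Some True) l" i 0 l "Some b"]
      by (simp add: families_def)
  next
    case (Rise i b)
    then show ?thesis using assms in_states[of "\<lambda>(i, \<mu>, p) l. Rise i (\<mu> = Some True)" i 0 0 "Some b"] L0
      by (simp add: families_def)
  next
    case (Over i b w)
    then show ?thesis using assms in_states[of "\<lambda>(i, \<mu>, p) l. Over i (\<mu> = Some True) l" i 0 w "Some b"]
      by (simp add: families_def)
  next
    case (Sum i b u p)
    then show ?thesis using assms in_states[of "\<lambda>(i, \<mu>, p) l. Sum i (\<mu> = Some True) l p" i p u "Some b"]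
      by (simp add: families_def)
  next
    case (Carry i b u)
    then show ?thesis using assms in_states[of "\<lambda>(i, \<mu>, p) l. Carry i (\<mu> = Some True) l" i 0 u "Some b"]
      by (simp add: families_def)
  next
    case (Exit i b u p)
    then show ?thesis using assms in_states[of "\<lambda>(i, \<mu>, p) l. Exit i (\<mu> = Some True) l p" i p u "Some b"]
      by (simp add: families_def)
  next
    case (Begin i \<mu> u)
    then show ?thesis using assms in_states[of "\<lambda>(i, \<mu>, p) l. Begin i \<mu> l" i 0 u \<mu>] by (simp add: families_def)
  next
    case (Run i \<mu> w)
    then show ?thesis using assms in_states[of "\<lambda>(i, \<mu>, p) l. Run i \<mu> l" i 0 w \<mu>] by (simp add: families_def)
  next
    case (Vertical i \<mu> y)
    then show ?thesis using assms in_states[of "\<lambda>(i, \<mu>, p) l. Vertical i \<mu> l" i 0 y \<mu>] by (simp add: families_def)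
  next
    case Finish
    then show ?thesis using in_states[of "\<lambda>(i, \<mu>, p) l. Finish" 0 0 0] k0 L0 by (simp add: families_def)
  next
    case (Spine y)
    then show ?thesis using assms in_states[of "\<lambda>(i, \<mu>, p) l. Spine i" y 0 0] L0 by (simp add: families_def)
  qed
qed

text \<open>The factor \<open>36 * k\<close> counts level, three modes and twelve sub-steps; 16 is
  the number of families.\<close>

lemma card_states: "finite states" "card states \<le> 36 * k * (16 * size_bound + 4 * 2 ^ n)"
proof -
  have s: "finite small" "card small = 36 * k"
    by (simp_all add: small_def card_cartesian_product UNIV_option_conv UNIV_bool)
  have f: "finite families" "card families \<le> 16"
    unfolding families_def by (simp, intro card_insert_le_m1) simp_all
  \<comment> \<open>Geometric sums: partial digits of all lengths together are at most twice as many
    as full digits.\<close>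
  have r: "(\<Sum>j\<le>n. 2 ^ j) \<le> 2 * (2::nat) ^ n" for n by (induction n) auto
  have w: "(\<Sum>j\<le>n. 2 ^ (n - j)) \<le> 2 * (2::nat) ^ n" for n
    by (induction n) (auto simp: sum.atMost_Suc_shift simp del: sum.atMost_Suc)
  have 1: "card (\<Union>g\<in>families. (\<lambda>(s, l). g s l) ` (small \<times> {..<size_bound})) \<le> 16 * (36 * k * size_bound)"
  proof -
    have "card (\<Union>g\<in>families. (\<lambda>(s, l). g s l) ` (small \<times> {..<size_bound}))
        \<le> (\<Sum>g\<in>families. card ((\<lambda>(s, l). g s l) ` (small \<times> {..<size_bound})))"
      by (rule card_UN_le[OF f(1)])
    also have "\<dots> \<le> (\<Sum>g\<in>families. 36 * k * size_bound)"
      by (intro sum_mono order_trans[OF card_image_le]) (use s in \<open>auto simp: card_cartesian_product\<close>)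
    also have "\<dots> \<le> 16 * (36 * k * size_bound)" using f(2) by simp
    finally show ?thesis .
  qed
  have 2: "card ((\<lambda>((i, \<mu>, p), (j, u)). Read i (\<mu> = Some True) j u p) ` (small \<times> (SIGMA j:{..n}. {..<2 ^ j})))
      \<le> 36 * k * (2 * 2 ^ n)"
    by (rule order_trans[OF card_image_le]) (use s r[of n] in \<open>auto simp: card_cartesian_product\<close>)
  have 3: "card ((\<lambda>((i, \<mu>, p), (j, u)). Write i \<mu> j u p) ` (small \<times> (SIGMA j:{..n}. {..<2 ^ (n - j)})))
      \<le> 36 * k * (2 * 2 ^ n)"
    by (rule order_trans[OF card_image_le]) (use s w[of n] in \<open>auto simp: card_cartesian_product\<close>)
  show "finite states" unfolding states_def using s(1) f(1) by auto
  have "card states \<le> 16 * (36 * k * size_bound) + 36 * k * (2 * 2 ^ n) + 36 * k * (2 * 2 ^ n)"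
    unfolding states_def by (intro order_trans[OF card_Un_le] add_mono 1 2 3)
  then show "card states \<le> 36 * k * (16 * size_bound + 4 * 2 ^ n)" by (simp add: algebra_simps)
qed

lemma digit_L: "digit t < size_bound" using digit_less[of t] by (simp add: size_bound_def)

lemma div_pow_less: assumes "j \<le> n" shows "digit t div 2 ^ j < 2 ^ (n - j)"
proof -
  have "digit t < 2 ^ (n - j) * 2 ^ j" using digit_less[of t] assms by (simp flip: power_add)
  then show ?thesis by (rule less_mult_imp_div_less)
qed

lemma valid_bits0:
  assumes "j < n" "\<rho> < 4" shows "valid (fst (bits0 t j \<rho> r))"
proof -
  have "level t < k" using mod_c[of t] k_ge by simp
  moreover have "4 * j + \<rho> < size_bound" using assms D_ge W_ge unfolding size_bound_def by linarith
  ultimately show ?thesis using assms div_pow_less[of j t] by (simp add: bits0_def Let_def)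
qed

lemma valid_bits1:
  assumes "j < n" "\<rho> < 4" "bits1 t j \<rho> r = Some s" shows "valid (fst s)"
proof -
  have "level t < k" using mod_c[of t] k_ge by simp
  then show ?thesis using assms div_pow_less[of j t] by (auto simp: bits1_def Let_def split: if_splits)
qed

lemma valid_cell0:
  assumes "w < W" "r < 2" shows "valid (fst (cell0 t w r))"
proof -
  have k: "level t < k" "2 * level t + 1 < k" using mod_c[of t] k_ge by auto
  have size_bound: "w < size_bound" using assms by (simp add: size_bound_def)
  have B: "B t + w < size_bound" if "t < c" "w \<le> 1"
  proof -
    have "t * D \<le> W" using that by simp
    then show ?thesis using that unfolding size_bound_def B_def by linarith
  qed
  consider "w < 5" | "5 \<le> w" "w < bits_end" | "bits_end \<le> w" by linarith
  then show ?thesis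
  proof cases
    case 1
    then show ?thesis using k size_bound B digit_L W_big by (auto simp: cell0_def head0_def Let_def size_bound_def)
  next
    case 2
    then obtain j \<rho> where j: "j < n" "\<rho> < 4" "w = 5 + 4 * j + \<rho>" by (rule bit_index)
    then show ?thesis using cell0_bits[OF j] valid_bits0 by simp
  next
    case 3
    then show ?thesis using k size_bound digit_L by (auto simp: cell0_def tail0_def Let_def)
  qed
qed

lemma valid_cell1:
  assumes "w < D" "cell1 t w y = Some s" shows "valid (fst s)"
proof -
  have k: "level t < k" "level (Suc t) < k" using mod_c[of t] mod_c[of "Suc t"] k_ge by linarith+
  have size_bound: "w < size_bound" using assms(1) W_ge unfolding size_bound_def by linarith
  have kL: "2 * level t < size_bound" "2 * level (Suc t) < size_bound"
  proof -
    have "c * 2 \<le> W" using D_ge by (intro mult_le_mono) auto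
    then show "2 * level t < size_bound" "2 * level (Suc t) < size_bound"
      using mod_c[of t] mod_c[of "Suc t"] unfolding size_bound_def by linarith+
  qed
  show ?thesis
  proof (cases "5 \<le> w \<and> w < bits_end \<and> y \<noteq> 2 * level t + 2")
    case True
    then obtain j \<rho> where j: "j < n" "\<rho> < 4" "w = 5 + 4 * j + \<rho>" using bit_index by blast
    have "bits1 t j \<rho> 0 = Some s \<or> bits1 t j \<rho> 1 = Some s"
      using assms(2) True D_ge j(2,3) by (auto simp: cell1_def Let_def split: if_splits)
    then show ?thesis using valid_bits1[OF j(1,2)] by blast
  next
    case False
    show ?thesis
    proof (cases "w + 1 = D")
      case True
      then have "fst s = Finish \<or> fst s = Vertical (level (Suc t)) (mode_in (Suc t)) y \<and> (y \<le> 2 * level t \<or> y \<le> 2 * level (Suc t))"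
        using assms(2) by (auto simp: cell1_def Let_def split: if_splits)
      then show ?thesis using kL k(2) by auto
    next
      case ne: False
      show ?thesis using assms(2) k size_bound kL digit_less[of t] False ne
        by (auto simp: cell1_def Let_def split: if_splits)
    qed
  qed
qed

lemma ran_F: "ran F \<subseteq> states \<times> UNIV"
proof
  fix s assume "s \<in> ran F"
  then obtain x y z where s: "F (x, y, z) = Some s" by (auto simp: ran_def)
  note d = F_dom[OF s]
  have "valid (fst s)"
  proof (cases "z = 0")
    case True
    then have "s = layer0 (nat x) (nat y)" using s d by (simp add: F_def)
    moreover have "valid (fst (layer0 x' y'))" if "y' < k" for x' y'
    proof -
      have "x' < size_bound" if "x' < B (y' div 2)" "y' < 2 * c"
      proof -
        have "y' div 2 * D \<le> W" using that(2) by (intro mult_le_mono1) auto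
        then show ?thesis using that(1) unfolding size_bound_def B_def by linarith
      qed
      then show ?thesis using that valid_cell0 W_pos by (auto simp: layer0_def)
    qed
    moreover have "nat y < k" using d by linarith
    ultimately show ?thesis by simp
  next
    case False
    then have "layer1 (nat x) (nat y) = Some s" using s d by (simp add: F_def split: if_splits)
    then show ?thesis using valid_cell1[OF mod_less_divisor[OF D_pos]] by (auto simp: layer1_def split: if_splits)
  qed
  then show "s \<in> states \<times> UNIV" using valid_states by (cases s) auto
qed

lemma finite_dom_F: "finite (dom F)"
proof (rule finite_subset)
  show "dom F \<subseteq> {0..<int N} \<times> {0..<int k} \<times> {0, 1}" using F_dom by force
qed simp

text \<open>The seed is the wall tile of step 0. Its fictitious direction is \<open>Up\<close>
  because no state offers \<open>Gadget 0 None 3\<close> upward.\<close>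

sublocale growth: tree_growth out F "pos0 0 2 0" "Gadget 0 None 3" Up
proof
  show "F (pos0 0 2 0) = Some (Gadget 0 None 3, Up)" using F_init3[OF c_pos] by simp
  show "finite (dom F)" by (rule finite_dom_F)
  show "(pos0 0 2 0, p) \<in> E\<^sup>*" if "p \<in> dom F" for p
    using sound_dom[of p] that unfolding sound_def leads_def by blast
  show "F (neighbour p e) = Some (q', e) \<or> (neighbour p e, p) \<in> E\<^sup>*"
    if F: "F p = Some (q, d)" and o: "out q e = Some q'" and e: "e \<noteq> opposite d" for p q d e q'
  proof -
    have "handled p e" using sound_dom[OF F] F o e unfolding sound_def by blast
    then show ?thesis unfolding handled_def
    proof
      assume "\<exists>p'. edge p e p'"
      then obtain p' where "(p, p') \<in> E" "p' = neighbour p e" by (auto simp: edge_def)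
      \<comment> \<open>An edge only stores two positions; the direction is recovered from their
        difference.\<close>
      then obtain pos1 d1 e1 q2 where *: "F p = Some (pos1, d1)" "out pos1 e1 = Some q2"
        "neighbour p e = neighbour p e1" "F (neighbour p e) = Some (q2, e1)"
        by (auto simp: growth_edges_def)
      have "e1 = e" using *(3) by (cases p; cases e; cases e1; simp)
      then show ?thesis using * F o by simp
    qed (simp add: leads_def)
  qed
  show "out q Up \<noteq> Some (Gadget 0 None 3)" for q
    by (cases q) (auto split: if_splits)
qed

lemma rectangle: "is_rectangle_3D k N (dom F)"
  unfolding is_rectangle_3D_def
proof
  show "{0..<int N} \<times> {0..<int k} \<times> {0} \<subseteq> dom F" by (auto simp: F_def dom_def)
  show "dom F \<subseteq> {0..<int N} \<times> {0..<int k} \<times> {0, 1}" using F_dom by force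
qed

lemma K_USA_counter: "K_USA 1 (dom F) \<le> enat (216 * k * (16 * size_bound + 4 * 2 ^ n))"
proof -
  have "card (UNIV :: dir set) = 6" by (simp add: UNIV_dir)
  then have "card (states \<times> (UNIV :: dir set)) \<le> 216 * k * (16 * size_bound + 4 * 2 ^ n)"
    using card_states(2) by (simp add: card_cartesian_product)
  moreover have "K_USA 1 (dom F) \<le> enat (card (states \<times> (UNIV :: dir set)))"
    by (rule growth.K_USA_le[OF _ ran_F]) (use card_states(1) in simp)
  ultimately show ?thesis by (meson enat_ord_simps(1) order_trans)
qed

end

section \<open>The bound\<close>

text \<open>A comb: the first row grows east and each of its tiles starts a column. The bound is
  linear in \<open>N\<close>, which is what is asked for when \<open>k div 2 = 1\<close>.\<close>

lemma rectangle_by_position: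
  fixes k N :: nat
  assumes "0 < k" "0 < N"
  shows "\<exists>R. is_rectangle_3D k N R \<and> K_USA 1 R \<le> enat (6 * k * N)"
proof -
  define out :: "nat \<times> nat \<Rightarrow> dir \<Rightarrow> (nat \<times> nat) option" where
    "out = (\<lambda>(x, y) e. if e = East \<and> y = 0 \<and> x + 1 < N then Some (x + 1, 0)
       else if e = North \<and> y + 1 < k then Some (x, y + 1) else None)"
  define F :: "pos \<Rightarrow> ((nat \<times> nat) \<times> dir) option" where
    "F = (\<lambda>(x, y, z). if 0 \<le> x \<and> x < int N \<and> 0 \<le> y \<and> y < int k \<and> z = 0
       then Some ((nat x, nat y), if 0 < y then North else if 0 < x then East else Up) else None)"
  let ?E = "growth_edges out F"
  have F: "F (int x, int y, 0) = Some ((x, y), if 0 < y then North else if 0 < x then East else Up)"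
    if "x < N" "y < k" for x y using that by (auto simp: F_def)
  have dom: "dom F = {0..<int N} \<times> {0..<int k} \<times> {0}"
    by (auto simp: F_def dom_def split: if_splits)
  have east: "((int x, 0, 0), (int (Suc x), 0, 0)) \<in> ?E" if "Suc x < N" for x
    using F[of x 0] F[of "Suc x" 0] that assms
    by (intro growth_edgesI[of F _ "(x, 0)" _ out East "(Suc x, 0)"]) (auto simp: out_def split: if_splits)
  have north: "((int x, int y, 0), (int x, int (Suc y), 0)) \<in> ?E" if "x < N" "Suc y < k" for x y
    using F[of x y] F[of x "Suc y"] that
    by (intro growth_edgesI[of F _ "(x, y)" _ out North "(x, Suc y)"]) (auto simp: out_def split: if_splits)
  have row: "((0, 0, 0), (int x, 0, 0)) \<in> ?E\<^sup>*" if "x < N" for x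
    using that
  proof (induction x)
    case (Suc x)
    then show ?case using rtrancl_into_rtrancl[OF _ east[of x]] by simp
  qed simp
  have col: "((0, 0, 0), (int x, int y, 0)) \<in> ?E\<^sup>*" if "x < N" "y < k" for x y
    using that
  proof (induction y)
    case (Suc y)
    then show ?case using rtrancl_into_rtrancl[OF _ north[of x y]] by simp
  qed (use row in simp)
  interpret tree_growth out F "(0, 0, 0)" "(0, 0)" Up
  proof
    show "F (0, 0, 0) = Some ((0, 0), Up)" using F[of 0 0] assms by simp
    show "finite (dom F)" unfolding dom by simp
    show "((0, 0, 0), p) \<in> ?E\<^sup>*" if "p \<in> dom F" for p
    proof -
      obtain x y where "p = (x, y, 0)" "0 \<le> x" "x < int N" "0 \<le> y" "y < int k" using \<open>p \<in> dom F\<close> unfolding dom by auto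
      then show ?thesis using col[of "nat x" "nat y"] by auto
    qed
    show "F (neighbour p e) = Some (q', e) \<or> (neighbour p e, p) \<in> ?E\<^sup>*"
      if "F p = Some (q, d)" "out q e = Some q'" for p q d e q'
      using that by (cases p) (auto simp: F_def out_def split: if_splits)
    show "out q Up \<noteq> Some (0, 0)" for q by (auto simp: out_def split: prod.splits)
  qed
  have card_dir: "card (UNIV :: dir set) = 6" by (simp add: UNIV_dir)
  have "ran F \<subseteq> ({..<N} \<times> {..<k}) \<times> UNIV" by (auto simp: F_def ran_def split: if_splits)
  then have "K_USA 1 (dom F) \<le> enat (card (({..<N} \<times> {..<k}) \<times> (UNIV :: dir set)))"
    by (intro K_USA_le) auto
  also have "card (({..<N} \<times> {..<k}) \<times> (UNIV :: dir set)) = 6 * k * N"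
    by (simp add: card_cartesian_product card_dir)
  finally show ?thesis using dom unfolding is_rectangle_3D_def by (intro exI[of _ "dom F"]) auto
qed

text \<open>A digit of width \<open>2 ^ n\<close> has to hold four columns per bit and ten more;
  this fails for \<open>n = 4\<close>.\<close>

lemma two_pow_ge: "5 \<le> n \<Longrightarrow> 4 * n + 10 \<le> (2::nat) ^ n"
proof (induction rule: dec_induct)
  case (step n)
  then show ?case by simp
qed simp

text \<open>The counter is run with \<open>D = 2 ^ n\<close>, \<open>S + 1 = N div W\<close> values
  and padding \<open>N mod W\<close>. The threshold on \<open>N\<close> is chosen to force
  \<open>5 \<le> n\<close>, as \<open>two_pow_ge\<close> requires.\<close>

lemma rectangle_by_counting:
  fixes k N :: nat
  assumes k: "4 \<le> k" and N: "2 ^ (4 * (k div 2)) < N"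
  obtains n R where "2 ^ ((n - 1) * (k div 2)) < N" "0 < n" "is_rectangle_3D k N R"
    "K_USA 1 R \<le> enat (216 * k * (32 * k + 36) * 2 ^ n)"
proof -
  define d where "d = k div 2"
  define c where "c = d - 1"
  have d: "d = c + 1" "0 < c" "2 * c + 2 \<le> k" using k by (auto simp: d_def c_def)
  have "N \<le> 2 ^ N" using less_exp[of N] by simp
  also have "\<dots> \<le> 2 ^ (N * d)" using d(1) by (intro power_increasing) auto
  finally have "N \<le> 2 ^ (N * d)" .
  define n where "n = (LEAST n. N \<le> 2 ^ (n * d))"
  have n1: "N \<le> 2 ^ (n * d)" unfolding n_def by (rule LeastI) fact
  have n5: "5 \<le> n"
  proof (rule ccontr)
    assume "\<not> 5 \<le> n"
    then have "n * d \<le> 4 * d" by (intro mult_le_mono1) simp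
    then have "(2::nat) ^ (n * d) \<le> 2 ^ (4 * d)" by (intro power_increasing) simp_all
    then show False using n1 N unfolding d_def by linarith
  qed
  have n2: "2 ^ ((n - 1) * d) < N"
    using not_less_Least[of "n - 1" "\<lambda>n. N \<le> 2 ^ (n * d)"] n5 unfolding n_def[symmetric] by simp
  define W where "W = c * 2 ^ n"
  have Wpos: "0 < W" using d by (simp add: W_def)
  \<comment> \<open>Goal: at least two blocks fit into the rectangle, so that \<open>S\<close> is
    positive.\<close>
  have "2 * c \<le> 2 ^ c" using d(2) by (induction c rule: nat_induct_non_zero) (auto simp: mult_2)
  then have "2 * W \<le> 2 ^ c * 2 ^ n" unfolding W_def by (metis mult.assoc mult_le_mono1)
  also have "\<dots> = 2 ^ (c + n)" by (simp add: power_add)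
  also have "\<dots> \<le> 2 ^ ((n - 1) * d)"
  proof (intro power_increasing)
    have "c + n \<le> (n - 1) * c + (n - 1)"
    proof -
      have "4 * c \<le> (n - 1) * c" using n5 by (intro mult_le_mono1) simp
      then show ?thesis using d(2) n5 by linarith
    qed
    then show "c + n \<le> (n - 1) * d" by (simp add: d(1))
  qed simp
  finally have W2: "2 * W \<le> N" using n2 by linarith
  define S where "S = N div W - 1"
  have NW: "2 \<le> N div W" using W2 Wpos by (simp add: less_eq_div_iff_mult_less_eq)
  \<comment> \<open>A block is at least \<open>2 ^ n\<close> columns wide, so
    \<open>c = d - 1\<close> digits suffice to count the blocks.\<close>
  have "N \<le> 2 ^ (n * c) * 2 ^ n" using n1 by (simp add: d(1) power_add mult.commute)
  also have "\<dots> \<le> 2 ^ (n * c) * W" using d(2) by (simp add: W_def)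
  finally have "N div W \<le> 2 ^ (n * c)"
    using Wpos by (metis div_le_mono nonzero_mult_div_cancel_right not_gr_zero)
  then interpret counter n c "2 ^ n" "N mod W" S k
    using n5 d two_pow_ge[OF n5] NW by unfold_locales (auto simp: S_def)
  have "counter.N c (2 ^ n) (N mod W) S = N mod W + (S + 1) * W"
    unfolding N_def by (simp only: W_def)
  also have "S + 1 = N div W" using NW by (simp add: S_def)
  finally have NN: "counter.N c (2 ^ n) (N mod W) S = N" by simp
  have "size_bound = N mod W + W + 2 ^ n + 2" unfolding size_bound_def by (simp only: W_def)
  also have "\<dots> \<le> 2 * W + 2 ^ n + 2" using mod_less_divisor[OF Wpos, of N] by linarith
  also have "\<dots> \<le> (2 * c + 2) * 2 ^ n"
    using two_pow_ge[OF n5] unfolding W_def by (simp add: algebra_simps)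
  also have "\<dots> \<le> k * 2 ^ n" using d(3) by (intro mult_le_mono1)
  finally have "16 * size_bound + 4 * 2 ^ n \<le> (32 * k + 36) * 2 ^ n" by (simp add: algebra_simps)
  then have "216 * k * (16 * size_bound + 4 * 2 ^ n) \<le> 216 * k * (32 * k + 36) * 2 ^ n"
    by (metis mult.assoc mult_le_mono2)
  then have "K_USA 1 (dom F) \<le> enat (216 * k * (32 * k + 36) * 2 ^ n)"
    using K_USA_counter by (meson enat_ord_simps(1) order_trans)
  then show thesis using that[of n "dom F"] n2 n5 rectangle unfolding NN d_def by simp
qed

theorem theorem2:
  fixes k :: nat
  assumes "k \<ge> 2"
  shows "\<exists>C > 0. \<exists>N\<^sub>0. \<forall>N \<ge> N\<^sub>0. \<exists>R. is_rectangle_3D k N R \<and>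
           ereal_of_enat (K_USA 1 R) \<le>
             ereal (C * (real N powr (1 / real (k div 2)) + log 2 (real N)))"
proof -
  define d where "d = k div 2"
  \<comment> \<open>Minimality of \<open>n\<close> bounds only \<open>2 ^ (n - 1)\<close> by the
    root of \<open>N\<close>; the last factor 2 makes up for this.\<close>
  define C where "C = real (216 * k * (32 * k + 36) * 2)"
  have C: "0 < C" using assms by (simp add: C_def)
  have "\<exists>R. is_rectangle_3D k N R \<and>
           ereal_of_enat (K_USA 1 R) \<le> ereal (C * (real N powr (1 / real d) + log 2 (real N)))"
    if N: "2 ^ (4 * d) < N" for N
  proof -
    have N1: "1 \<le> N" using N by simp
    then have lg: "0 \<le> log 2 (real N)" by simp
    have "\<exists>R m. is_rectangle_3D k N R \<and> K_USA 1 R \<le> enat m \<and> real m \<le> C * real N powr (1 / real d)"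
    proof (cases "k < 4")
      case True
      then have "d = 1" using assms by (auto simp: d_def)
      moreover have "real (6 * k * N) \<le> C * real N"
      proof -
        have "6 * k \<le> 216 * k * (32 * k + 36) * 2" by simp
        then have "6 * k * N \<le> 216 * k * (32 * k + 36) * 2 * N" by (rule mult_le_mono1)
        then show ?thesis unfolding C_def by (metis of_nat_le_iff of_nat_mult)
      qed
      moreover obtain R where "is_rectangle_3D k N R" "K_USA 1 R \<le> enat (6 * k * N)"
        using rectangle_by_position[of k N] assms N1 by auto
      ultimately show ?thesis
        by (intro exI[of _ R] exI[of _ "6 * k * N"] conjI) auto
    next
      case False
      then have d0: "0 < d" by (simp add: d_def)
      obtain n R where n: "2 ^ ((n - 1) * d) < N" "0 < n" "is_rectangle_3D k N R"
        "K_USA 1 R \<le> enat (216 * k * (32 * k + 36) * 2 ^ n)"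
        using rectangle_by_counting[of k N] False N unfolding d_def by auto
      have "(2 ^ (n - 1)) powr real d = real (2 ^ ((n - 1) * d))"
        by (simp add: powr_realpow power_mult)
      also have "\<dots> \<le> real N" using n(1) by (metis less_imp_le of_nat_le_iff)
      finally have "((2 ^ (n - 1)) powr real d) powr (1 / real d) \<le> real N powr (1 / real d)"
        by (intro powr_mono2) auto
      then have "2 ^ (n - 1) \<le> real N powr (1 / real d)" using d0 by (simp add: powr_powr)
      moreover have "(2::real) ^ n = 2 * 2 ^ (n - 1)" using n(2) by (simp flip: power_Suc)
      ultimately have "real (216 * k * (32 * k + 36)) * 2 ^ n \<le> real (216 * k * (32 * k + 36)) * (2 * real N powr (1 / real d))"
        by (intro mult_left_mono) auto
      then have "real (216 * k * (32 * k + 36) * 2 ^ n) \<le> C * real N powr (1 / real d)"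
        by (simp only: C_def of_nat_mult of_nat_power of_nat_numeral mult.assoc)
      then show ?thesis using n(3,4) by blast
    qed
    then obtain R m where R: "is_rectangle_3D k N R" "K_USA 1 R \<le> enat m" "real m \<le> C * real N powr (1 / real d)"
      by blast
    have "ereal_of_enat (K_USA 1 R) \<le> ereal_of_enat (enat m)" using R(2) by (simp only: ereal_of_enat_le_iff)
    also have "\<dots> = ereal (real m)" by simp
    also have "\<dots> \<le> ereal (C * (real N powr (1 / real d) + log 2 (real N)))"
    proof -
      have "0 \<le> C * log 2 (real N)" using C lg by simp
      then show ?thesis using R(3) by (simp add: distrib_left)
    qed
    finally show ?thesis using R(1) by blast
  qed
  then show ?thesis using C unfolding d_def by (metis Suc_le_eq)
qed

end
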